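(* Let $X=W/\langle f\rangle$ be a classical Hopf manifold of dimension $n\ge3$ and let $\mathcal F$ be a singular codimension-one holomorphic foliation on $X$. Then either $\mathcal F$ has an invariant analytic hypersurface, or $\mathcal F$ has a one-dimensional subfoliation by elliptic curves.
   Context: Let $W=\mathbb C^n\setminus\{0\}$ and $f(z)=\mu z$ with $0<|\mu|<1$. The compact complex manifold $X=W/\langle f\rangle$ is called a classical Hopf manifold. For $b\in\mathbb C^*$, $L_b$ is the line bundle on $X$ obtained as the quotient of $W\times\mathbb C$ by $(z,v)\mapsto(f(z),bv)$; every line bundle on $X$ is of this form. A singular codimension-one holomorphic foliation $\mathcal F$ on $X$ is given by a nonzero section of $\Omega^1_X\otimes L$, for some line bundle $L$ on $X$ (the section is allowed to have zeros), whose pullback to $W$, a holomorphic $1$-form $\omega$ on $W$, satisfies the integrability condition $\omega\wedge d\omega=0$. An analytic hypersurface $H\subset X$ (a nonempty closed analytic subset of pure codimension one) is invariant by $\mathcal F$ if, for every local reduced equation $h=0$ of its preimage in $W$, the form $\omega\wedge dh$ vanishes along $\{h=0\}$. A one-dimensional subfoliation by elliptic curves is a one-dimensional holomorphic foliation on $X$ whose leaves are elliptic curves (compact Riemann surfaces of genus one) tangent to $\mathcal F$, i.e. on which the $1$-form defining $\mathcal F$ restricts to zero. *)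

theory Defs
  imports "HOL-Analysis.Analysis"
begin

section \<open>Holomorphic functions, maps and forms in several variables\<close>

text \<open>Points of $\mathbb{C}^n$ are vectors of type \<^typ>\<open>complex^'n\<close>, with $n$ the cardinality of
  \<^typ>\<open>'n\<close>; covectors and coefficient vectors of 1-forms have the same type.\<close>

definition covec_app :: "complex^'n \<Rightarrow> complex^'n \<Rightarrow> complex" where
  "covec_app a v = (\<Sum>i\<in>UNIV. a $ i * v $ i)"

text \<open>Complex differentiability: the Frechet derivative exists and is complex linear.\<close>

definition holo_fun_on :: "(complex^'n) set \<Rightarrow> (complex^'n \<Rightarrow> complex) \<Rightarrow> bool" where
  "holo_fun_on U g \<longleftrightarrow> open U \<and> (\<forall>z\<in>U. \<exists>a. (g has_derivative covec_app a) (at z))"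

definition holo_map_on :: "(complex^'n) set \<Rightarrow> (complex^'n \<Rightarrow> complex^'m) \<Rightarrow> bool" where
  "holo_map_on U g \<longleftrightarrow> (\<forall>i. holo_fun_on U (\<lambda>z. g z $ i))"

definition biholomorphic_betw ::
    "(complex^'n \<Rightarrow> complex^'n) \<Rightarrow> (complex^'n) set \<Rightarrow> (complex^'n) set \<Rightarrow> bool" where
  "biholomorphic_betw g V V' \<longleftrightarrow>
     bij_betw g V V' \<and> holo_map_on V g \<and> holo_map_on V' (inv_into V g)"

definition cpartial :: "'n \<Rightarrow> (complex^'n \<Rightarrow> complex) \<Rightarrow> complex^'n \<Rightarrow> complex" where
  "cpartial i g z = deriv (\<lambda>t. g (z + t *s axis i 1)) 0"

text \<open>Coefficients of $dh$, of $d\omega$ (on $dz_i\wedge dz_j$), and of the wedge products of a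
  covector with a covector and with an alternating 2-form.\<close>

definition cgrad :: "(complex^'n \<Rightarrow> complex) \<Rightarrow> complex^'n \<Rightarrow> complex^'n" where
  "cgrad h z = (\<chi> i. cpartial i h z)"

definition ext_deriv :: "(complex^'n \<Rightarrow> complex^'n) \<Rightarrow> complex^'n \<Rightarrow> 'n \<Rightarrow> 'n \<Rightarrow> complex" where
  "ext_deriv \<omega> z i j = cpartial i (\<lambda>w. \<omega> w $ j) z - cpartial j (\<lambda>w. \<omega> w $ i) z"

definition wedge_1_1 :: "complex^'n \<Rightarrow> complex^'n \<Rightarrow> 'n \<Rightarrow> 'n \<Rightarrow> complex" where
  "wedge_1_1 \<alpha> \<beta> i j = \<alpha> $ i * \<beta> $ j - \<alpha> $ j * \<beta> $ i"

definition wedge_1_2 :: "complex^'n \<Rightarrow> ('n \<Rightarrow> 'n \<Rightarrow> complex) \<Rightarrow> 'n \<Rightarrow> 'n \<Rightarrow> 'n \<Rightarrow> complex" where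
  "wedge_1_2 \<alpha> \<beta> i j k = \<alpha> $ i * \<beta> j k + \<alpha> $ j * \<beta> k i + \<alpha> $ k * \<beta> i j"

definition integrable_on_set :: "(complex^'n) set \<Rightarrow> (complex^'n \<Rightarrow> complex^'n) \<Rightarrow> bool" where
  "integrable_on_set U \<omega> \<longleftrightarrow>
     (\<forall>z\<in>U. \<forall>i j k. wedge_1_2 (\<omega> z) (ext_deriv \<omega> z) i j k = 0)"

section \<open>The classical Hopf manifold\<close>

text \<open>The Hopf manifold is the set of orbits of the group generated by $z\mapsto\mu z$ on
  $W=\mathbb{C}^n\setminus\{0\}$, with the quotient topology.\<close>

abbreviation punctured :: "(complex^'n) set" where
  "punctured \<equiv> UNIV - {0}"

definition hopf_proj :: "complex \<Rightarrow> complex^'n \<Rightarrow> (complex^'n) set" where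
  "hopf_proj \<mu> z = {(\<mu> powi k) *s z | k. True}"

definition hopf :: "complex \<Rightarrow> (complex^'n) set set" where
  "hopf \<mu> = hopf_proj \<mu> ` punctured"

definition hopf_preimage :: "complex \<Rightarrow> (complex^'n) set set \<Rightarrow> (complex^'n) set" where
  "hopf_preimage \<mu> A = {z \<in> punctured. hopf_proj \<mu> z \<in> A}"

definition hopf_topology :: "complex \<Rightarrow> (complex^'n) set topology" where
  "hopf_topology \<mu> = topology (\<lambda>U. U \<subseteq> hopf \<mu> \<and> open (hopf_preimage \<mu> U))"

lemma openin_hopf_topology:
  fixes U :: "(complex^'n) set set"
  shows "openin (hopf_topology \<mu>) U \<longleftrightarrow> U \<subseteq> hopf \<mu> \<and> open (hopf_preimage \<mu> U)"
proof -
  have "istopology (\<lambda>U. U \<subseteq> hopf \<mu> \<and> open (hopf_preimage \<mu> U :: (complex^'n) set))"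
    unfolding istopology_def
  proof (intro conjI allI impI)
    fix S T :: "(complex^'n) set set"
    assume *: "S \<subseteq> hopf \<mu> \<and> open (hopf_preimage \<mu> S)" "T \<subseteq> hopf \<mu> \<and> open (hopf_preimage \<mu> T)"
    have "hopf_preimage \<mu> (S \<inter> T) = hopf_preimage \<mu> S \<inter> hopf_preimage \<mu> T"
      by (auto simp: hopf_preimage_def)
    then show "S \<inter> T \<subseteq> hopf \<mu>" "open (hopf_preimage \<mu> (S \<inter> T))"
      using * by auto
  next
    fix \<K> :: "(complex^'n) set set set"
    assume *: "\<forall>K\<in>\<K>. K \<subseteq> hopf \<mu> \<and> open (hopf_preimage \<mu> K)"
    have "hopf_preimage \<mu> (\<Union>\<K>) = (\<Union>K\<in>\<K>. hopf_preimage \<mu> K)"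
      by (auto simp: hopf_preimage_def)
    then show "\<Union>\<K> \<subseteq> hopf \<mu>" "open (hopf_preimage \<mu> (\<Union>\<K>))"
      using * by auto
  qed
  then show ?thesis
    by (simp add: hopf_topology_def topology_inverse')
qed

lemma topspace_hopf_topology: "topspace (hopf_topology \<mu>) = (hopf \<mu> :: (complex^'n) set set)"
proof -
  have "hopf_preimage \<mu> (hopf \<mu>) = (punctured :: (complex^'n) set)"
    by (auto simp: hopf_preimage_def hopf_def)
  moreover have "open (punctured :: (complex^'n) set)"
    by (simp add: open_delete)
  ultimately have "openin (hopf_topology \<mu>) (hopf \<mu> :: (complex^'n) set set)"
    by (simp add: openin_hopf_topology)
  then show ?thesis
    by (metis openin_hopf_topology openin_subset openin_topspace subset_antisym)
qed

text \<open>The complex structure is the one making the projection from $W$ locally biholomorphic.\<close>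

definition hopf_holo_on ::
    "complex \<Rightarrow> (complex^'n) set set \<Rightarrow> ((complex^'n) set \<Rightarrow> complex) \<Rightarrow> bool" where
  "hopf_holo_on \<mu> U g \<longleftrightarrow>
     openin (hopf_topology \<mu>) U \<and> holo_fun_on (hopf_preimage \<mu> U) (g \<circ> hopf_proj \<mu>)"

definition hopf_chart ::
    "complex \<Rightarrow> (complex^'n) set set \<Rightarrow> ((complex^'n) set \<Rightarrow> complex^'n) \<Rightarrow> bool" where
  "hopf_chart \<mu> U \<phi> \<longleftrightarrow>
     openin (hopf_topology \<mu>) U \<and> inj_on \<phi> U \<and>
     (\<forall>z\<in>hopf_preimage \<mu> U. \<exists>V. z \<in> V \<and> V \<subseteq> hopf_preimage \<mu> U \<and>
        biholomorphic_betw (\<phi> \<circ> hopf_proj \<mu>) V ((\<phi> \<circ> hopf_proj \<mu>) ` V))"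

section \<open>Analytic subsets and hypersurfaces\<close>

definition analytic_subset :: "complex \<Rightarrow> (complex^'n) set set \<Rightarrow> bool" where
  "analytic_subset \<mu> A \<longleftrightarrow>
     closedin (hopf_topology \<mu>) A \<and>
     (\<forall>x\<in>hopf \<mu>. \<exists>U G. openin (hopf_topology \<mu>) U \<and> x \<in> U \<and> finite G \<and>
        (\<forall>g\<in>G. hopf_holo_on \<mu> U g) \<and> A \<inter> U = {y\<in>U. \<forall>g\<in>G. g y = 0})"

text \<open>Points near which the set is a complex submanifold of dimension $k$.\<close>

definition regular_point :: "complex \<Rightarrow> (complex^'n) set set \<Rightarrow> nat \<Rightarrow> (complex^'n) set \<Rightarrow> bool" where
  "regular_point \<mu> A k x \<longleftrightarrow> x \<in> A \<and>
     (\<exists>U \<phi> I. hopf_chart \<mu> U \<phi> \<and> x \<in> U \<and> card I + k = CARD('n) \<and>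
        \<phi> ` (A \<inter> U) = {w \<in> \<phi> ` U. \<forall>i\<in>I. w $ i = 0})"

text \<open>The dimension of an analytic set at one of its points is the largest dimension of the
  set at regular points arbitrarily close to it.  Regular points being dense in an analytic set,
  the maximum is over a nonempty set.\<close>

definition analytic_dim :: "complex \<Rightarrow> (complex^'n) set set \<Rightarrow> (complex^'n) set \<Rightarrow> nat" where
  "analytic_dim \<mu> A x =
     Max {k. \<forall>U. openin (hopf_topology \<mu>) U \<and> x \<in> U \<longrightarrow> (\<exists>y\<in>U. regular_point \<mu> A k y)}"

definition analytic_hypersurface :: "complex \<Rightarrow> (complex^'n) set set \<Rightarrow> bool" where
  "analytic_hypersurface \<mu> H \<longleftrightarrow>
     H \<noteq> {} \<and> analytic_subset \<mu> H \<and> (\<forall>x\<in>H. analytic_dim \<mu> H x + 1 = CARD('n))"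

section \<open>Line bundles and codimension-one foliations\<close>

text \<open>Elements of the tangent bundle of the Hopf manifold, which is the quotient of
  $W\times\mathbb{C}^n$ by $(z,v)\mapsto(\mu z,\mu v)$, and of the line bundle $L_b$.\<close>

definition tangent_class :: "complex \<Rightarrow> complex^'n \<Rightarrow> complex^'n \<Rightarrow> ((complex^'n) \<times> (complex^'n)) set" where
  "tangent_class \<mu> z v = {((\<mu> powi k) *s z, (\<mu> powi k) *s v) | k. True}"

definition line_class :: "complex \<Rightarrow> complex \<Rightarrow> complex^'n \<Rightarrow> complex \<Rightarrow> ((complex^'n) \<times> complex) set" where
  "line_class \<mu> b z c = {((\<mu> powi k) *s z, (b powi k) * c) | k. True}"

text \<open>A holomorphic section $s$ of $\Omega^1_X\otimes L_b$ is a holomorphic bundle map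
  $TX\to L_b$. Its pullback to $W$ is the holomorphic 1-form $\omega$ with
  $s[z,v]=[z,\omega_z(v)]$; well-definedness of $s$ on classes amounts to
  $f^*\omega=b\,\omega$ for $f(z)=\mu z$.\<close>

definition section_with_pullback ::
    "complex \<Rightarrow> complex \<Rightarrow> (((complex^'n) \<times> (complex^'n)) set \<Rightarrow> ((complex^'n) \<times> complex) set) \<Rightarrow>
     (complex^'n \<Rightarrow> complex^'n) \<Rightarrow> bool" where
  "section_with_pullback \<mu> b s \<omega> \<longleftrightarrow>
     holo_map_on punctured \<omega> \<and>
     (\<forall>z\<in>punctured. \<forall>v. s (tangent_class \<mu> z v) = line_class \<mu> b z (covec_app (\<omega> z) v))"

definition codim_one_foliation ::
    "complex \<Rightarrow> complex \<Rightarrow> (((complex^'n) \<times> (complex^'n)) set \<Rightarrow> ((complex^'n) \<times> complex) set) \<Rightarrow>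
     (complex^'n \<Rightarrow> complex^'n) \<Rightarrow> bool" where
  "codim_one_foliation \<mu> b s \<omega> \<longleftrightarrow>
     b \<noteq> 0 \<and> section_with_pullback \<mu> b s \<omega> \<and>
     (\<exists>z\<in>punctured. \<omega> z \<noteq> 0) \<and> integrable_on_set punctured \<omega>"

text \<open>A reduced equation of a set $Z$ in $U$ has $Z\cap U$ as zero set and generates the ideal of
  germs vanishing on $Z$ at every point of $U$.\<close>

definition reduced_equation ::
    "(complex^'n) set \<Rightarrow> (complex^'n) set \<Rightarrow> (complex^'n \<Rightarrow> complex) \<Rightarrow> bool" where
  "reduced_equation Z U h \<longleftrightarrow>
     holo_fun_on U h \<and> Z \<inter> U = {z\<in>U. h z = 0} \<and>
     (\<forall>p\<in>U. \<forall>V g. p \<in> V \<and> V \<subseteq> U \<and> holo_fun_on V g \<and> (\<forall>z\<in>Z \<inter> V. g z = 0) \<longrightarrow>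
        (\<exists>V' q. p \<in> V' \<and> V' \<subseteq> V \<and> holo_fun_on V' q \<and> (\<forall>z\<in>V'. g z = q z * h z)))"

definition invariant_hypersurface ::
    "complex \<Rightarrow> (complex^'n \<Rightarrow> complex^'n) \<Rightarrow> (complex^'n) set set \<Rightarrow> bool" where
  "invariant_hypersurface \<mu> \<omega> H \<longleftrightarrow>
     analytic_hypersurface \<mu> H \<and>
     (\<forall>U h. U \<subseteq> punctured \<and> reduced_equation (hopf_preimage \<mu> H) U h \<longrightarrow>
        (\<forall>z\<in>U. h z = 0 \<longrightarrow> (\<forall>i j. wedge_1_1 (\<omega> z) (cgrad h z) i j = 0)))"

section \<open>One-dimensional foliations by elliptic curves\<close>

text \<open>A (nonsingular) one-dimensional foliation, given by its set of leaves: a partition into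
  path-connected sets which in suitable charts onto the unit polydisc have the discs
  parallel to a coordinate axis as their local path components.\<close>

definition one_dim_foliation :: "complex \<Rightarrow> (complex^'n) set set set \<Rightarrow> bool" where
  "one_dim_foliation \<mu> \<F> \<longleftrightarrow>
     \<Union>\<F> = hopf \<mu> \<and> disjoint \<F> \<and> {} \<notin> \<F> \<and>
     (\<forall>L\<in>\<F>. path_connectedin (hopf_topology \<mu>) L) \<and>
     (\<forall>x\<in>hopf \<mu>. \<exists>U \<phi> i. hopf_chart \<mu> U \<phi> \<and> x \<in> U \<and>
        \<phi> ` U = {w. \<forall>j. norm (w $ j) < 1} \<and>
        (\<forall>L\<in>\<F>. \<forall>C\<in>path_components_of (subtopology (hopf_topology \<mu>) (L \<inter> U)).
           \<exists>c. C = {y\<in>U. \<forall>j. j \<noteq> i \<longrightarrow> \<phi> y $ j = c $ j}))"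

text \<open>A compact connected one-dimensional complex submanifold of genus one, i.e.
  homeomorphic to the torus.  (A compact leaf of a foliation is embedded, so its leaf topology
  is the subspace topology.)\<close>

definition elliptic_curve :: "complex \<Rightarrow> (complex^'n) set set \<Rightarrow> bool" where
  "elliptic_curve \<mu> L \<longleftrightarrow>
     compactin (hopf_topology \<mu>) L \<and> connectedin (hopf_topology \<mu>) L \<and>
     (\<forall>x\<in>L. regular_point \<mu> L 1 x) \<and>
     subtopology (hopf_topology \<mu>) L homeomorphic_space
       prod_topology (top_of_set (sphere (0::complex) 1)) (top_of_set (sphere (0::complex) 1))"

text \<open>The form restricts to zero on a complex curve $L$ if its pullback by every holomorphic map
  from an open subset of $\mathbb{C}$ into the preimage of $L$ is zero.\<close>

definition form_vanishes_on ::
    "complex \<Rightarrow> (complex^'n \<Rightarrow> complex^'n) \<Rightarrow> (complex^'n) set set \<Rightarrow> bool" where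
  "form_vanishes_on \<mu> \<omega> L \<longleftrightarrow>
     (\<forall>S \<gamma>. open S \<and> (\<forall>i. (\<lambda>t. \<gamma> t $ i) holomorphic_on S) \<and> \<gamma> ` S \<subseteq> hopf_preimage \<mu> L \<longrightarrow>
        (\<forall>t\<in>S. covec_app (\<omega> (\<gamma> t)) (\<chi> i. deriv (\<lambda>u. \<gamma> u $ i) t) = 0))"

definition elliptic_subfoliation ::
    "complex \<Rightarrow> (complex^'n \<Rightarrow> complex^'n) \<Rightarrow> (complex^'n) set set set \<Rightarrow> bool" where
  "elliptic_subfoliation \<mu> \<omega> \<F> \<longleftrightarrow>
     one_dim_foliation \<mu> \<F> \<and> (\<forall>L\<in>\<F>. elliptic_curve \<mu> L \<and> form_vanishes_on \<mu> \<omega> L)"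

end

theory Submission
  imports Defs "HOL-Complex_Analysis.Conformal_Mappings"
begin

text \<open>
  Pull the foliation back to a holomorphic 1-form \<open>\<omega>\<close> on \<open>W\<close>, the complement of the origin, and
  contract it with the radial vector field \<open>R\<close>: let \<open>P z = \<Sum>i. z\<^sub>i * \<omega>\<^sub>i z\<close>
  (\<open>radial_contraction\<close>).  The two alternatives of the theorem are the cases \<open>P = 0\<close> and
  \<open>P \<noteq> 0\<close>.

  If \<open>P\<close> vanishes identically, then \<open>\<omega>\<close> is zero along every complex line through the origin.  The
  punctured lines project to elliptic curves \<open>\<complex>\<^sup>* / \<mu>\<^sup>\<int>\<close> in the Hopf manifold, and these curves are
  the leaves of a nonsingular foliation, in affine charts of projective space times a
  coordinate on the line (\<open>radial_elliptic_subfoliation\<close>).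

  If \<open>P\<close> does not vanish identically, the invariant hypersurface is \<open>{P = 0}\<close>.  The coefficients of
  \<open>\<omega>\<close> satisfy \<open>\<omega> (\<mu> z) = (b / \<mu>) \<omega> z\<close>; on each punctured line this forces a single monomial,
  so \<open>\<omega>\<close> is homogeneous of some integer degree \<open>d\<close> (\<open>semi_invariant_imp_homogeneous\<close>).
  A homogeneous function of negative degree tends to zero at infinity along an affine line missing
  the origin, hence is zero by Liouville (\<open>negative_degree_imp_zero\<close>).  So \<open>d \<ge> 0\<close>, and \<open>P\<close>,
  of degree \<open>d + 1 > 0\<close>, must have a zero, as otherwise \<open>1 / P\<close> would be zero.
  Contracting \<open>\<omega> \<and> d\<omega> = 0\<close> with \<open>R\<close> and using Euler's relation gives
  \<open>P d\<omega> = dP \<and> \<omega>\<close>: the function \<open>P\<close> is an integrating factor (\<open>integrating_factor_identity\<close>).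

  To see that \<open>{P = 0}\<close> is an invariant hypersurface it is enough to look at points \<open>q\<close> of
  least multiplicity of \<open>P\<close>, since there is one in every open set that meets \<open>{P = 0}\<close>.
  If the multiplicity at \<open>q\<close> is \<open>m\<close>, some derivative \<open>\<rho>\<close> of \<open>P\<close> of order \<open>m - 1\<close> vanishes on all
  zeros of \<open>P\<close> near \<open>q\<close> and has \<open>d\<rho> \<noteq> 0\<close> at \<open>q\<close>; by the maximum principle for \<open>1 / P\<close>, the sets
  \<open>{P = 0}\<close> and \<open>{\<rho> = 0}\<close> then agree near \<open>q\<close> (\<open>straightening_of_zero_set\<close>).  So \<open>q\<close> is a regular
  point of dimension \<open>n - 1\<close>.  Applying the same derivative to \<open>P d\<omega> = dP \<and> \<omega>\<close> leaves
  \<open>d\<rho> \<and> \<omega> = 0\<close> at \<open>q\<close> (\<open>gradient_parallel_to_form\<close>), and any \<open>h\<close> that vanishes on \<open>{P = 0}\<close>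
  has \<open>dh\<close> proportional to \<open>d\<rho>\<close> there.  By density and continuity \<open>dh \<and> \<omega> = 0\<close> on all of
  \<open>{P = 0}\<close> (\<open>zero_locus_invariant\<close>).
\<close>

section \<open>Holomorphic functions of several variables\<close>

text \<open>The derivative is taken along an arbitrary vector rather than a coordinate axis, so that one-variable theory can be applied on every complex line.\<close>

definition dir_deriv :: "complex^'n \<Rightarrow> (complex^'n \<Rightarrow> complex) \<Rightarrow> complex^'n \<Rightarrow> complex" where
  "dir_deriv v g z = deriv (\<lambda>t. g (z + t *s v)) 0"

lemma cpartial_eq_dir_deriv: "cpartial i = dir_deriv (axis i 1)"
  by (intro ext) (simp add: cpartial_def dir_deriv_def)

lemma covec_app_scale: "covec_app a (c *s v) = c * covec_app a v"
  by (simp add: covec_app_def sum_distrib_left algebra_simps)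

lemma covec_app_add: "covec_app a (v + w) = covec_app a v + covec_app a w"
  by (simp add: covec_app_def sum.distrib algebra_simps)

lemma covec_app_axis [simp]: "covec_app a (axis i 1) = a $ i"
  by (simp add: covec_app_def axis_def if_distrib cong: if_cong)

lemma norm_vector_scale: "norm (c *s (v::complex^'n)) = norm c * norm v"
  by (simp add: norm_vec_def norm_mult L2_set_right_distrib)

lemma bounded_linear_scale_left: "bounded_linear (\<lambda>c. c *s (v::complex^'n))"
  by (rule bounded_linear_intro[where K = "norm v"])
     (auto simp: norm_vector_scale vec_eq_iff algebra_simps)

lemma continuous_on_vector_scale [continuous_intros]:
  assumes "continuous_on S f" "continuous_on S (g :: _ \<Rightarrow> complex^'n)"
  shows "continuous_on S (\<lambda>x. f x *s g x)"
proof -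
  have "continuous_on S (\<lambda>x. \<chi> i. f x * g x $ i)"
    by (intro continuous_intros assms)
  then show ?thesis
    by (simp add: vector_scalar_mult_def)
qed

lemma has_derivative_vec_componentwise:
  fixes f :: "'a::real_normed_vector \<Rightarrow> complex^'n"
  shows "(f has_derivative f') (at a within S) \<longleftrightarrow>
    (\<forall>i. ((\<lambda>x. f x $ i) has_derivative (\<lambda>x. f' x $ i)) (at a within S))" (is "?L \<longleftrightarrow> ?R")
proof
  assume ?L
  then show ?R
    using bounded_linear.has_derivative[OF bounded_linear_vec_nth] by blast
next
  assume R: ?R
  show ?L
    unfolding has_derivative_componentwise_within[of f]
  proof
    fix b :: "complex^'n" assume "b \<in> Basis"
    then obtain i u where b: "b = axis i u"
      by (auto simp: Basis_vec_def)
    have "((\<lambda>x. f x $ i \<bullet> u) has_derivative (\<lambda>x. f' x $ i \<bullet> u)) (at a within S)"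
      using R bounded_linear.has_derivative[OF bounded_linear_inner_left] by blast
    then show "((\<lambda>x. f x \<bullet> b) has_derivative (\<lambda>x. f' x \<bullet> b)) (at a within S)"
      by (simp add: b inner_axis)
  qed
qed

text \<open>Complex linearity is what distinguishes a holomorphic function from a differentiable one; through this lemma the usual differentiation rules for real derivatives transfer to \<open>holo_fun_on\<close>.\<close>

lemma complex_linear_eq_covec_app:
  fixes f' :: "complex^'n \<Rightarrow> complex"
  assumes "bounded_linear f'" "\<And>c v. f' (c *s v) = c * f' v"
  shows "f' = covec_app (\<chi> i. f' (axis i 1))"
proof
  fix v :: "complex^'n"
  have "f' v = f' (\<Sum>i\<in>UNIV. (v $ i) *s axis i 1)"
    by (simp add: basis_expansion)
  also have "\<dots> = (\<Sum>i\<in>UNIV. (v $ i) * f' (axis i 1))"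
    by (simp add: linear_sum[OF bounded_linear.linear[OF assms(1)]] assms(2))
  finally show "f' v = covec_app (\<chi> i. f' (axis i 1)) v"
    by (simp add: covec_app_def mult.commute)
qed

lemma holo_fun_onI:
  assumes "open U"
    and "\<And>z. z \<in> U \<Longrightarrow> \<exists>f'. (g has_derivative f') (at z) \<and> (\<forall>c v. f' (c *s v) = c * f' v)"
  shows "holo_fun_on U g"
  unfolding holo_fun_on_def
  using assms complex_linear_eq_covec_app has_derivative_bounded_linear by metis

lemma holo_line_has_field_derivative:
  assumes "(g has_derivative covec_app a) (at (z + t *s v))"
  shows "((\<lambda>t. g (z + t *s v)) has_field_derivative covec_app a v) (at t)"
proof -
  have "((\<lambda>t. z + t *s v) has_derivative (\<lambda>t. t *s v)) (at t)"
    using bounded_linear.has_derivative[OF bounded_linear_scale_left has_derivative_ident]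
    by (auto intro!: derivative_eq_intros)
  from has_derivative_compose[OF this assms]
  show ?thesis
    by (simp add: has_field_derivative_def covec_app_scale mult.commute[of _ "covec_app a v"])
qed

lemma holo_has_derivative:
  assumes "holo_fun_on U g" "z \<in> U"
  shows "(g has_derivative covec_app (cgrad g z)) (at z)"
proof -
  obtain a where a: "(g has_derivative covec_app a) (at z)"
    using assms by (auto simp: holo_fun_on_def)
  have "cpartial i g z = a $ i" for i
    unfolding cpartial_def
    using DERIV_imp_deriv[OF holo_line_has_field_derivative[of g a z 0 "axis i 1"]] a by simp
  then have "cgrad g z = a"
    by (simp add: cgrad_def vec_eq_iff)
  with a show ?thesis
    by simp
qed

lemma holo_line_deriv:
  assumes "holo_fun_on U g" "z + t *s v \<in> U"
  shows "((\<lambda>t. g (z + t *s v)) has_field_derivative dir_deriv v g (z + t *s v)) (at t)"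
    and "dir_deriv v g (z + t *s v) = covec_app (cgrad g (z + t *s v)) v"
proof -
  have D: "(g has_derivative covec_app (cgrad g (z + t *s v))) (at (z + t *s v))"
    by (rule holo_has_derivative[OF assms])
  have "((\<lambda>t'. g ((z + t *s v) + t' *s v)) has_field_derivative covec_app (cgrad g (z + t *s v)) v) (at 0)"
    by (rule holo_line_has_field_derivative) (use D in simp)
  then show *: "dir_deriv v g (z + t *s v) = covec_app (cgrad g (z + t *s v)) v"
    by (simp add: dir_deriv_def DERIV_imp_deriv)
  show "((\<lambda>t. g (z + t *s v)) has_field_derivative dir_deriv v g (z + t *s v)) (at t)"
    unfolding * by (rule holo_line_has_field_derivative[OF D])
qed

lemma dir_deriv_eq_covec_app:
  assumes "holo_fun_on U g" "z \<in> U"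
  shows "dir_deriv v g z = covec_app (cgrad g z) v"
  using holo_line_deriv(2)[of U g z 0 v] assms by simp

lemma holo_has_derivative_dir_deriv:
  assumes "holo_fun_on U g" "z \<in> U"
  shows "(g has_derivative (\<lambda>v. dir_deriv v g z)) (at z)"
  using holo_has_derivative[OF assms] by (simp add: dir_deriv_eq_covec_app[OF assms] fun_eq_iff)

lemma dir_deriv_unique:
  assumes "holo_fun_on U g" "z \<in> U" "(g has_derivative g') (at z)"
  shows "dir_deriv v g z = g' v"
  using has_derivative_unique[OF holo_has_derivative_dir_deriv[OF assms(1,2)] assms(3)]
  by (simp add: fun_eq_iff)

lemma holo_open: "holo_fun_on U g \<Longrightarrow> open U"
  by (simp add: holo_fun_on_def)

lemma holo_continuous: "holo_fun_on U g \<Longrightarrow> continuous_on U g"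
  by (meson continuous_at_imp_continuous_on has_derivative_continuous holo_has_derivative)

lemma holo_subset: "holo_fun_on U g \<Longrightarrow> open V \<Longrightarrow> V \<subseteq> U \<Longrightarrow> holo_fun_on V g"
  by (auto simp: holo_fun_on_def)

lemma holo_cong:
  assumes "holo_fun_on U g" "\<And>z. z \<in> U \<Longrightarrow> g z = h z"
  shows "holo_fun_on U h"
  unfolding holo_fun_on_def
proof (intro conjI ballI)
  fix z assume "z \<in> U"
  with assms obtain a where "(g has_derivative covec_app a) (at z)"
    by (auto simp: holo_fun_on_def)
  then have "(h has_derivative covec_app a) (at z)"
    by (rule has_derivative_transform_within_open[OF _ holo_open[OF assms(1)] \<open>z \<in> U\<close>])
      (use assms in auto)
  then show "\<exists>a. (h has_derivative covec_app a) (at z)" ..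
qed (use assms in \<open>simp add: holo_open\<close>)

lemma holo_local:
  assumes "open U" "\<And>z. z \<in> U \<Longrightarrow> \<exists>V. z \<in> V \<and> holo_fun_on V g"
  shows "holo_fun_on U g"
  using assms unfolding holo_fun_on_def by blast

lemma holo_const: "open U \<Longrightarrow> holo_fun_on U (\<lambda>z. c)"
  by (rule holo_fun_onI) (auto intro!: exI[of _ "\<lambda>_. 0"])

lemma holo_nth: "open U \<Longrightarrow> holo_fun_on U (\<lambda>z. z $ i)"
  by (rule holo_fun_onI)
     (auto intro!: exI[of _ "\<lambda>v. v $ i"] bounded_linear_imp_has_derivative bounded_linear_vec_nth)

lemma holo_add:
  assumes "holo_fun_on U g" "holo_fun_on U h"
  shows "holo_fun_on U (\<lambda>z. g z + h z)"
proof (rule holo_fun_onI[OF holo_open[OF assms(1)]])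
  fix z assume "z \<in> U"
  then show "\<exists>f'. ((\<lambda>z. g z + h z) has_derivative f') (at z) \<and> (\<forall>c v. f' (c *s v) = c * f' v)"
    by (intro exI conjI, rule has_derivative_add[OF holo_has_derivative[OF assms(1)] holo_has_derivative[OF assms(2)]])
      (auto simp: covec_app_scale algebra_simps)
qed

lemma holo_mult:
  assumes "holo_fun_on U g" "holo_fun_on U h"
  shows "holo_fun_on U (\<lambda>z. g z * h z)"
proof (rule holo_fun_onI[OF holo_open[OF assms(1)]])
  fix z assume "z \<in> U"
  then show "\<exists>f'. ((\<lambda>z. g z * h z) has_derivative f') (at z) \<and> (\<forall>c v. f' (c *s v) = c * f' v)"
    by (intro exI conjI, rule has_derivative_mult[OF holo_has_derivative[OF assms(1)] holo_has_derivative[OF assms(2)]])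
      (auto simp: covec_app_scale algebra_simps)
qed

lemma holo_sum:
  assumes "open U" "\<And>i. i \<in> I \<Longrightarrow> holo_fun_on U (g i)"
  shows "holo_fun_on U (\<lambda>z. \<Sum>i\<in>I. g i z)"
  using assms(2)
  by (induction I rule: infinite_finite_induct) (auto intro: holo_const holo_add assms(1))

lemma holo_inverse:
  assumes "holo_fun_on U g" "\<And>z. z \<in> U \<Longrightarrow> g z \<noteq> 0"
  shows "holo_fun_on U (\<lambda>z. inverse (g z))"
proof (rule holo_fun_onI[OF holo_open[OF assms(1)]])
  fix z assume "z \<in> U"
  then show "\<exists>f'. ((\<lambda>z. inverse (g z)) has_derivative f') (at z) \<and> (\<forall>c v. f' (c *s v) = c * f' v)"
    by (intro exI conjI, rule Deriv.has_derivative_inverse[OF assms(2) holo_has_derivative[OF assms(1)]])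
      (auto simp: covec_app_scale algebra_simps)
qed

lemma holo_map_has_derivative:
  assumes "holo_map_on U \<Phi>" "z \<in> U"
  shows "(\<Phi> has_derivative (\<lambda>v. \<chi> i. dir_deriv v (\<lambda>z. \<Phi> z $ i) z)) (at z)"
  unfolding has_derivative_vec_componentwise
  using assms by (auto simp: holo_map_on_def intro: holo_has_derivative_dir_deriv)

lemma dir_deriv_scale:
  assumes "holo_fun_on U g" "z \<in> U"
  shows "dir_deriv (c *s v) g z = c * dir_deriv v g z"
  by (simp add: dir_deriv_eq_covec_app[OF assms] covec_app_scale)

lemma dir_deriv_sum_axis:
  assumes "holo_fun_on U g" "z \<in> U"
  shows "dir_deriv v g z = (\<Sum>i\<in>UNIV. v $ i * cpartial i g z)"
  by (simp add: dir_deriv_eq_covec_app[OF assms] covec_app_def cgrad_def mult.commute)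

lemma holo_map_open: "holo_map_on U \<Phi> \<Longrightarrow> open U"
  unfolding holo_map_on_def using holo_open by blast

lemma holo_map_continuous: "holo_map_on U \<Phi> \<Longrightarrow> continuous_on U \<Phi>"
  by (meson continuous_at_imp_continuous_on has_derivative_continuous holo_map_has_derivative)

lemma holo_compose:
  assumes "holo_map_on U \<Phi>" "holo_fun_on V g" "\<Phi> ` U \<subseteq> V"
  shows "holo_fun_on U (\<lambda>z. g (\<Phi> z))"
proof (rule holo_fun_onI[OF holo_map_open[OF assms(1)]])
  fix z assume z: "z \<in> U"
  have D: "(\<Phi> has_derivative (\<lambda>v. \<chi> i. dir_deriv v (\<lambda>z. \<Phi> z $ i) z)) (at z)" (is "(_ has_derivative ?D) _")
    by (rule holo_map_has_derivative[OF assms(1) z])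
  have *: "?D (c *s v) = c *s ?D v" for c v
    using assms(1) z by (simp add: vec_eq_iff holo_map_on_def) (metis dir_deriv_scale)
  have "(g has_derivative covec_app (cgrad g (\<Phi> z))) (at (\<Phi> z))"
    using assms z by (intro holo_has_derivative) auto
  from has_derivative_compose[OF D this]
  show "\<exists>f'. ((\<lambda>z. g (\<Phi> z)) has_derivative f') (at z) \<and> (\<forall>c v. f' (c *s v) = c * f' v)"
    by (intro exI conjI) (assumption, simp only: * covec_app_scale, simp)
qed

lemma holo_map_compose:
  assumes "holo_map_on U \<Phi>" "holo_map_on V \<Psi>" "\<Phi> ` U \<subseteq> V"
  shows "holo_map_on U (\<lambda>z. \<Psi> (\<Phi> z))"
  unfolding holo_map_on_def
proof
  fix i
  have "holo_fun_on V (\<lambda>z. \<Psi> z $ i)"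
    using assms(2) by (simp add: holo_map_on_def)
  from holo_compose[OF assms(1) this assms(3)]
  show "holo_fun_on U (\<lambda>z. \<Psi> (\<Phi> z) $ i)" .
qed

lemma holo_map_scale: "open U \<Longrightarrow> holo_map_on U (\<lambda>z. c *s z)"
  by (auto simp: holo_map_on_def intro!: holo_mult holo_const holo_nth)

lemma open_line_preimage:
  assumes "open U"
  shows "open {t. z + t *s (v::complex^'n) \<in> U}"
proof -
  have "open ((\<lambda>t. z + t *s v) -` U)"
    by (rule open_vimage[OF assms]) (auto intro!: continuous_intros)
  then show ?thesis
    by (simp add: vimage_def)
qed

lemma holo_line_holomorphic:
  assumes "holo_fun_on U g" "\<And>t. t \<in> S \<Longrightarrow> z + t *s v \<in> U"
  shows "(\<lambda>t. g (z + t *s v)) holomorphic_on S"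
proof -
  have "(\<lambda>t. g (z + t *s v)) holomorphic_on {t. z + t *s v \<in> U}"
    by (subst holomorphic_on_open[OF open_line_preimage[OF holo_open[OF assms(1)]]])
      (use holo_line_deriv(1)[OF assms(1)] in blast)
  then show ?thesis
    by (rule holomorphic_on_subset) (use assms in auto)
qed

lemma dir_deriv_cong:
  assumes "open U" "z \<in> U" "\<And>w. w \<in> U \<Longrightarrow> g w = h w"
  shows "dir_deriv v g z = dir_deriv v h z"
  unfolding dir_deriv_def
proof (rule deriv_cong_ev)
  have "eventually (\<lambda>t. z + t *s v \<in> U) (nhds 0)"
    using open_line_preimage[OF assms(1), of z v] assms(2) eventually_nhds_in_open by fastforce
  then show "eventually (\<lambda>t. g (z + t *s v) = h (z + t *s v)) (nhds 0)"
    by eventually_elim (use assms in auto)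
qed auto

lemma dir_deriv_add:
  assumes "holo_fun_on U g" "holo_fun_on U h" "z \<in> U"
  shows "dir_deriv v (\<lambda>z. g z + h z) z = dir_deriv v g z + dir_deriv v h z"
  by (rule dir_deriv_unique[OF holo_add[OF assms(1,2)] assms(3)
      has_derivative_add[OF holo_has_derivative_dir_deriv[OF assms(1,3)] holo_has_derivative_dir_deriv[OF assms(2,3)]]])

lemma dir_deriv_mult:
  assumes "holo_fun_on U g" "holo_fun_on U h" "z \<in> U"
  shows "dir_deriv v (\<lambda>z. g z * h z) z = dir_deriv v g z * h z + g z * dir_deriv v h z"
  using dir_deriv_unique[OF holo_mult[OF assms(1,2)] assms(3)
      has_derivative_mult[OF holo_has_derivative_dir_deriv[OF assms(1,3)] holo_has_derivative_dir_deriv[OF assms(2,3)]], of v]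
  by simp

lemma dir_deriv_sum:
  assumes "open U" "\<And>i. i \<in> I \<Longrightarrow> holo_fun_on U (g i)" "z \<in> U" "finite I"
  shows "dir_deriv v (\<lambda>z. \<Sum>i\<in>I. g i z) z = (\<Sum>i\<in>I. dir_deriv v (g i) z)"
  using assms(4,2)
proof (induction I rule: finite_induct)
  case empty
  then show ?case by (simp add: dir_deriv_def)
next
  case (insert i I)
  then show ?case
    using dir_deriv_add[OF insert(4)[of i] holo_sum[OF assms(1), of I g] assms(3), of v]
    by auto
qed

lemma dir_deriv_nth: "dir_deriv v (\<lambda>z. z $ i) z = v $ i"
  by (rule dir_deriv_unique[OF holo_nth[OF open_UNIV] UNIV_I])
    (auto intro!: bounded_linear_imp_has_derivative bounded_linear_vec_nth)

section \<open>Derivatives of holomorphic functions\<close>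

definition circle_point :: "real \<Rightarrow> real \<Rightarrow> complex" where
  "circle_point r \<theta> = of_real r * exp (2 * of_real pi * \<i> * of_real \<theta>)"

lemma circle_point_nonzero: "r > 0 \<Longrightarrow> circle_point r \<theta> \<noteq> 0"
  by (simp add: circle_point_def)

lemma norm_circle_point: "r > 0 \<Longrightarrow> norm (circle_point r \<theta>) = r"
  by (simp add: circle_point_def norm_mult)

lemma continuous_on_circle_point [continuous_intros]:
  "continuous_on S f \<Longrightarrow> continuous_on S (\<lambda>x. circle_point r (f x))"
  unfolding circle_point_def by (intro continuous_intros)

text \<open>Cauchy's formula for the derivative, as an integral over a fixed real interval so that the parametric integral theorems apply.\<close>

lemma deriv_eq_circle_mean:
  assumes "f holomorphic_on ball 0 R" "0 < r" "r < R"
  shows "deriv f 0 = integral (cbox 0 1) (\<lambda>\<theta>. f (circle_point r \<theta>) / circle_point r \<theta>)"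
proof -
  have sub: "cball 0 r \<subseteq> ball (0::complex) R"
    using assms by auto
  have "contour_integral (circlepath 0 r) (\<lambda>u. f u / (u - 0)^2) = (2 * pi * \<i>) * deriv f 0"
  proof (rule Cauchy_contour_integral_circlepath_2)
    show "continuous_on (cball 0 r) f" "f holomorphic_on ball 0 r"
      using holomorphic_on_subset[OF assms(1) sub] ball_subset_cball[of 0 r]
      by (auto intro!: holomorphic_on_imp_continuous_on intro: holomorphic_on_subset)
  qed (use assms in auto)
  moreover have "contour_integral (circlepath 0 r) (\<lambda>u. f u / (u - 0)^2) =
      integral {0..1} (\<lambda>\<theta>. (2 * pi * \<i>) * (f (circle_point r \<theta>) / circle_point r \<theta>))"
    unfolding contour_integral_integral
  proof (rule integral_cong)
    fix \<theta> :: real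
    have cp: "circlepath 0 r \<theta> = circle_point r \<theta>"
      by (simp add: circlepath circle_point_def mult.assoc)
    have "vector_derivative (circlepath 0 r) (at \<theta>) = 2 * pi * \<i> * circle_point r \<theta>"
      by (simp add: vector_derivative_circlepath circle_point_def mult_ac)
    then show "f (circlepath 0 r \<theta>) / (circlepath 0 r \<theta> - 0)\<^sup>2 * vector_derivative (circlepath 0 r) (at \<theta>) =
        2 * pi * \<i> * (f (circle_point r \<theta>) / circle_point r \<theta>)"
      using circle_point_nonzero[OF assms(2), of \<theta>] by (simp add: cp power2_eq_square)
  qed
  ultimately have "(2 * pi * \<i>) * deriv f 0 = (2 * pi * \<i>) *
      integral {0..1} (\<lambda>\<theta>. f (circle_point r \<theta>) / circle_point r \<theta>)"
    by (simp only: integral_mult_right)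
  then show ?thesis
    by simp
qed

text \<open>One radius serves all base points near \<open>z0\<close> and all functions on \<open>U\<close>; this uniformity allows differentiation under the integral, and using the same formula for \<open>g\<close> and for its derivatives.\<close>

lemma dir_deriv_circle_mean:
  fixes z0 v :: "complex^'n"
  assumes "open U" "z0 \<in> U"
  obtains R r where "0 < R" "0 < r" "ball z0 R \<subseteq> U"
    "\<forall>z\<in>ball z0 R. \<forall>\<theta>. z + circle_point r \<theta> *s v \<in> U"
    "\<forall>g. holo_fun_on U g \<longrightarrow> (\<forall>z\<in>ball z0 R.
      dir_deriv v g z = integral (cbox 0 1) (\<lambda>\<theta>. g (z + circle_point r \<theta> *s v) / circle_point r \<theta>))"
proof -
  obtain \<epsilon> where \<epsilon>: "\<epsilon> > 0" "ball z0 \<epsilon> \<subseteq> U"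
    using assms openE by blast
  define R where "R = \<epsilon> / 2"
  define r where "r = R / (2 * (norm v + 1))"
  have pos: "R > 0" "r > 0"
    using \<epsilon> by (auto simp: R_def r_def add_nonneg_pos)
  have r2: "2 * r * norm v < R"
  proof -
    have "norm v + 1 \<noteq> 0"
      using norm_ge_zero[of v] by linarith
    moreover have "2 * r * norm v + 2 * r = r * (2 * (norm v + 1))"
      by (simp add: algebra_simps)
    ultimately have "2 * r * norm v + 2 * r = R"
      by (simp add: r_def)
    with pos show ?thesis
      by linarith
  qed
  have inU: "z + t *s v \<in> U" if "z \<in> ball z0 R" "norm t < 2 * r" for z t
  proof -
    have "norm (t *s v) \<le> 2 * r * norm v"
      using that by (simp add: norm_vector_scale mult_right_mono)
    then have "dist z0 (z + t *s v) < R + R"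
      using that r2 dist_triangle[of z0 "z + t *s v" z] by (simp add: dist_norm)
    then show ?thesis
      using \<epsilon> by (auto simp: R_def)
  qed
  show thesis
  proof (rule that[OF pos])
    show "ball z0 R \<subseteq> U"
      using inU[of _ 0] pos by auto
    show "\<forall>z\<in>ball z0 R. \<forall>\<theta>. z + circle_point r \<theta> *s v \<in> U"
      using inU pos by (simp add: norm_circle_point)
    have "dir_deriv v g z = integral (cbox 0 1) (\<lambda>\<theta>. g (z + circle_point r \<theta> *s v) / circle_point r \<theta>)"
      if "holo_fun_on U g" "z \<in> ball z0 R" for g z
      unfolding dir_deriv_def
      by (rule deriv_eq_circle_mean[of _ "2 * r"], rule holo_line_holomorphic[OF that(1)])
        (use inU that pos in auto)
    then show "\<forall>g. holo_fun_on U g \<longrightarrow> (\<forall>z\<in>ball z0 R.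
      dir_deriv v g z = integral (cbox 0 1) (\<lambda>\<theta>. g (z + circle_point r \<theta> *s v) / circle_point r \<theta>))"
      by blast
  qed
qed

lemma continuous_on_circle_integrand:
  assumes "continuous_on U g" "0 < r" "\<And>z \<theta>. z \<in> B \<Longrightarrow> z + circle_point r \<theta> *s v \<in> U"
  shows "continuous_on (B \<times> cbox 0 1)
    (\<lambda>(z, \<theta>). g (z + circle_point r \<theta> *s v) / circle_point r \<theta>)"
  unfolding case_prod_unfold
  by (intro continuous_intros continuous_on_compose2[OF assms(1)])
    (use assms circle_point_nonzero in auto)

lemma continuous_on_dir_deriv:
  assumes g: "holo_fun_on U g"
  shows "continuous_on U (dir_deriv v g)"
proof (rule continuous_at_imp_continuous_on, rule ballI)
  fix z0 assume "z0 \<in> U"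
  then obtain R r where R: "0 < R" "0 < r" "ball z0 R \<subseteq> U"
    and R_in: "\<forall>z\<in>ball z0 R. \<forall>\<theta>. z + circle_point r \<theta> *s v \<in> U"
    and R_mean: "\<forall>g. holo_fun_on U g \<longrightarrow> (\<forall>z\<in>ball z0 R.
      dir_deriv v g z = integral (cbox 0 1) (\<lambda>\<theta>. g (z + circle_point r \<theta> *s v) / circle_point r \<theta>))"
    by (rule dir_deriv_circle_mean[OF holo_open[OF g], where v = v])
  have "continuous_on (ball z0 R)
      (\<lambda>z. integral (cbox 0 1) (\<lambda>\<theta>. g (z + circle_point r \<theta> *s v) / circle_point r \<theta>))"
    by (rule integral_continuous_on_param, rule continuous_on_circle_integrand[OF holo_continuous[OF g] R(2) R_in[rule_format]])
  then have "continuous_on (ball z0 R) (dir_deriv v g)"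
    by (rule continuous_on_eq) (simp add: R_mean[rule_format, OF g])
  then show "isCont (dir_deriv v g) z0"
    using R(1) by (simp add: continuous_on_eq_continuous_at)
qed

text \<open>Differentiate the circle mean under the integral sign. Continuity of the first derivatives, which this requires, comes from the same integral formula.\<close>

lemma dir_deriv_has_derivative:
  fixes v :: "complex^'n"
  assumes g: "holo_fun_on U g" and z0: "z0 \<in> U"
  obtains r where "0 < r" "(dir_deriv v g has_derivative
      (\<lambda>w. integral (cbox 0 1) (\<lambda>\<theta>. dir_deriv w g (z0 + circle_point r \<theta> *s v) / circle_point r \<theta>))) (at z0)"
    "\<forall>\<theta>. z0 + circle_point r \<theta> *s v \<in> U"
    "\<forall>h. holo_fun_on U h \<longrightarrow>
      dir_deriv v h z0 = integral (cbox 0 1) (\<lambda>\<theta>. h (z0 + circle_point r \<theta> *s v) / circle_point r \<theta>)"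
proof -
  obtain R r where R: "0 < R" "0 < r" "ball z0 R \<subseteq> U"
    and R_in: "\<forall>z\<in>ball z0 R. \<forall>\<theta>. z + circle_point r \<theta> *s v \<in> U"
    and R_mean: "\<forall>g. holo_fun_on U g \<longrightarrow> (\<forall>z\<in>ball z0 R.
      dir_deriv v g z = integral (cbox 0 1) (\<lambda>\<theta>. g (z + circle_point r \<theta> *s v) / circle_point r \<theta>))"
    by (rule dir_deriv_circle_mean[OF holo_open[OF g] z0, where v = v])
  define D where "D z \<theta> = Blinfun (\<lambda>w. dir_deriv w g (z + circle_point r \<theta> *s v) / circle_point r \<theta>)" for z \<theta>
  have der: "((\<lambda>z. g (z + circle_point r \<theta> *s v) / circle_point r \<theta>) has_derivative
      (\<lambda>w. dir_deriv w g (z + circle_point r \<theta> *s v) / circle_point r \<theta>)) (at z)" if "z \<in> ball z0 R" for z \<theta>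
  proof -
    have "((\<lambda>z. z + circle_point r \<theta> *s v) has_derivative (\<lambda>w. w)) (at z)"
      by (auto intro!: derivative_eq_intros)
    from has_derivative_compose[OF this holo_has_derivative_dir_deriv[OF g R_in[rule_format, OF that]]]
    have "((\<lambda>z. g (z + circle_point r \<theta> *s v)) has_derivative
      (\<lambda>w. dir_deriv w g (z + circle_point r \<theta> *s v))) (at z)" .
    from bounded_linear.has_derivative[OF bounded_linear_divide this] show ?thesis .
  qed
  have app: "blinfun_apply (D z \<theta>) w = dir_deriv w g (z + circle_point r \<theta> *s v) / circle_point r \<theta>"
    if "z \<in> ball z0 R" for z \<theta> w
    unfolding D_def by (simp add: bounded_linear_Blinfun_apply[OF has_derivative_bounded_linear[OF der[OF that]]])
  have contD: "continuous_on (ball z0 R \<times> cbox 0 1) (\<lambda>(z, \<theta>). D z \<theta>)"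
  proof (rule continuous_on_blinfun_componentwise)
    fix b :: "complex^'n"
    have "continuous_on (ball z0 R \<times> cbox 0 1)
      (\<lambda>(z, \<theta>). dir_deriv b g (z + circle_point r \<theta> *s v) / circle_point r \<theta>)"
      by (rule continuous_on_circle_integrand[OF continuous_on_dir_deriv[OF g] R(2) R_in[rule_format]])
    then show "continuous_on (ball z0 R \<times> cbox 0 1) (\<lambda>x. blinfun_apply (case x of (z, \<theta>) \<Rightarrow> D z \<theta>) b)"
      by (rule continuous_on_eq) (auto simp: app)
  qed
  have slice: "continuous_on (cbox 0 1) (\<lambda>\<theta>. F z \<theta>)"
    if "continuous_on (ball z0 R \<times> cbox 0 1) (\<lambda>(z, \<theta>). F z \<theta>)" "z \<in> ball z0 R"
    for F :: "complex^'n \<Rightarrow> real \<Rightarrow> 'x::topological_space" and z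
  proof -
    have "continuous_on (cbox 0 1) (\<lambda>\<theta>::real. (z, \<theta>))"
      by (intro continuous_intros)
    from continuous_on_compose2[OF that(1) this] that(2) show ?thesis
      by (simp add: image_subset_iff)
  qed
  have z0': "z0 \<in> ball z0 R"
    using R by simp
  have "((\<lambda>z. integral (cbox 0 1) (\<lambda>\<theta>. g (z + circle_point r \<theta> *s v) / circle_point r \<theta>))
      has_derivative integral (cbox 0 1) (D z0)) (at z0 within ball z0 R)"
  proof (rule leibniz_rule[OF _ _ contD z0' convex_ball])
    show "((\<lambda>z. g (z + circle_point r \<theta> *s v) / circle_point r \<theta>) has_derivative blinfun_apply (D z \<theta>))
         (at z within ball z0 R)" if "z \<in> ball z0 R" for z \<theta>
      unfolding ext[OF app[OF that]] by (rule has_derivative_at_withinI[OF der[OF that]])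
    show "(\<lambda>\<theta>. g (z + circle_point r \<theta> *s v) / circle_point r \<theta>) integrable_on cbox 0 1" if "z \<in> ball z0 R" for z
      by (rule integrable_continuous, rule slice[OF continuous_on_circle_integrand[OF holo_continuous[OF g] R(2) R_in[rule_format]] that])
  qed
  then have "(dir_deriv v g has_derivative integral (cbox 0 1) (D z0)) (at z0 within ball z0 R)"
    by (rule has_derivative_transform[OF z0', rotated]) (use R_mean[rule_format, OF g] in auto)
  then have *: "(dir_deriv v g has_derivative integral (cbox 0 1) (D z0)) (at z0)"
    using R(1) by (simp add: at_within_open[OF z0' open_ball])
  have I: "blinfun_apply (integral (cbox 0 1) (D z0)) w =
     integral (cbox 0 1) (\<lambda>\<theta>. dir_deriv w g (z0 + circle_point r \<theta> *s v) / circle_point r \<theta>)" for w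
    by (subst blinfun_apply_integral[OF integrable_continuous[OF slice[OF contD z0']]]) (simp add: app[OF z0'])
  from * have **: "(dir_deriv v g has_derivative
      (\<lambda>w. integral (cbox 0 1) (\<lambda>\<theta>. dir_deriv w g (z0 + circle_point r \<theta> *s v) / circle_point r \<theta>))) (at z0)"
    unfolding ext[OF I] .
  show thesis
    by (rule that[OF R(2) **]) (use R_in R_mean z0' in auto)
qed

lemma holo_dir_deriv:
  assumes g: "holo_fun_on U g"
  shows "holo_fun_on U (dir_deriv v g)"
proof (rule holo_fun_onI[OF holo_open[OF g]])
  fix z assume z: "z \<in> U"
  obtain r where r0: "0 < r" and r: "(dir_deriv v g has_derivative
      (\<lambda>w. integral (cbox 0 1) (\<lambda>\<theta>. dir_deriv w g (z + circle_point r \<theta> *s v) / circle_point r \<theta>))) (at z)"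
    "\<forall>\<theta>. z + circle_point r \<theta> *s v \<in> U"
    "\<forall>h. holo_fun_on U h \<longrightarrow>
      dir_deriv v h z = integral (cbox 0 1) (\<lambda>\<theta>. h (z + circle_point r \<theta> *s v) / circle_point r \<theta>)"
    by (rule dir_deriv_has_derivative[OF g z, where v = v])
  have "integral (cbox 0 1) (\<lambda>\<theta>. dir_deriv (c *s w) g (z + circle_point r \<theta> *s v) / circle_point r \<theta>) =
      c * integral (cbox 0 1) (\<lambda>\<theta>. dir_deriv w g (z + circle_point r \<theta> *s v) / circle_point r \<theta>)" for c w
    by (simp add: dir_deriv_scale[OF g r(2)[rule_format]] flip: integral_mult_right)
  with r(1) show "\<exists>f'. (dir_deriv v g has_derivative f') (at z) \<and> (\<forall>c v. f' (c *s v) = c * f' v)"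
    by blast
qed

text \<open>Both sides are the circle mean in direction \<open>v\<close> of the derivative in direction \<open>w\<close>.\<close>

lemma dir_deriv_commute:
  assumes g: "holo_fun_on U g" and z: "z \<in> U"
  shows "dir_deriv w (dir_deriv v g) z = dir_deriv v (dir_deriv w g) z"
proof -
  obtain r where r0: "0 < r" and r: "(dir_deriv v g has_derivative
      (\<lambda>w. integral (cbox 0 1) (\<lambda>\<theta>. dir_deriv w g (z + circle_point r \<theta> *s v) / circle_point r \<theta>))) (at z)"
    "\<forall>\<theta>. z + circle_point r \<theta> *s v \<in> U"
    "\<forall>h. holo_fun_on U h \<longrightarrow>
      dir_deriv v h z = integral (cbox 0 1) (\<lambda>\<theta>. h (z + circle_point r \<theta> *s v) / circle_point r \<theta>)"
    by (rule dir_deriv_has_derivative[OF g z, where v = v])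
  show ?thesis
    using dir_deriv_unique[OF holo_dir_deriv[OF g] z r(1)] r(3)[rule_format, OF holo_dir_deriv[OF g]] by simp
qed

section \<open>Homogeneity\<close>

text \<open>Dividing by a power of the variable normalises the multiplier to \<open>norm \<mu> < norm \<gamma> \<le> 1\<close>. The quotient is then bounded
  near \<open>0\<close> and extends to an entire function \<open>G\<close>, whose derivative satisfies \<open>G' \<tau> = (\<mu> / \<gamma>)^n * G' (\<mu>^n * \<tau>)\<close>
  and so is zero. In effect only one term of the Laurent series is compatible with the multiplier.\<close>

lemma semi_invariant_imp_monomial:
  fixes \<mu> \<beta> :: complex
  assumes \<mu>: "0 < norm \<mu>" "norm \<mu> < 1" and \<beta>: "\<beta> \<noteq> 0"
    and hol: "h holomorphic_on - {0}"
    and inv: "\<And>\<tau>. \<tau> \<noteq> 0 \<Longrightarrow> h (\<mu> * \<tau>) = \<beta> * h \<tau>"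
    and nz: "\<exists>\<tau>. \<tau> \<noteq> 0 \<and> h \<tau> \<noteq> 0"
  shows "\<exists>k::int. \<mu> powi k = \<beta> \<and> (\<forall>\<tau>. \<tau> \<noteq> 0 \<longrightarrow> h \<tau> = \<tau> powi k * h 1)"
proof -
  define m where "m = norm \<mu>"
  have m: "0 < m" "m < 1" and [simp]: "\<mu> \<noteq> 0"
    using \<mu> by (auto simp: m_def)
  \<comment> \<open>This \<open>k\<close> gives \<open>norm \<mu> < norm (\<beta> / \<mu> powi k) \<le> 1\<close>.\<close>
  define k where "k = \<lfloor>ln (norm \<beta>) / ln m\<rfloor>"
  define \<gamma> where "\<gamma> = \<beta> / \<mu> powi k"
  define g where "g \<tau> = h \<tau> / \<tau> powi k" for \<tau>
  have lnm: "ln m < 0"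
    using m by simp
  have "of_int k \<le> ln (norm \<beta>) / ln m" "ln (norm \<beta>) / ln m < of_int k + 1"
    unfolding k_def by linarith+
  then have k: "ln (norm \<beta>) \<le> of_int k * ln m" "(of_int k + 1) * ln m < ln (norm \<beta>)"
    using lnm by (auto simp: field_simps)
  have ln\<gamma>: "ln (norm \<gamma>) = ln (norm \<beta>) - of_int k * ln m"
    using \<beta> m by (simp add: \<gamma>_def norm_divide norm_power_int ln_div m_def[symmetric] flip: powr_real_of_int')
  have \<gamma>0: "\<gamma> \<noteq> 0"
    using \<beta> by (simp add: \<gamma>_def)
  have "ln (norm \<gamma>) \<le> ln 1" "ln m < ln (norm \<gamma>)"
    using k ln\<gamma> by (auto simp: algebra_simps)
  then have \<gamma>: "norm \<gamma> \<le> 1" "m < norm \<gamma>"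
    using \<gamma>0 m by (auto simp del: ln_one)
  have g_inv: "g (\<mu> * \<tau>) = \<gamma> * g \<tau>" if "\<tau> \<noteq> 0" for \<tau>
    using inv[OF that] by (simp add: g_def \<gamma>_def power_int_mult_distrib)
  have g_hol: "g holomorphic_on - {0}"
    unfolding g_def by (intro holomorphic_intros hol) auto
  have "compact (g ` (cball 0 1 - ball 0 m))"
    using m by (intro compact_continuous_image holomorphic_on_imp_continuous_on
        holomorphic_on_subset[OF g_hol] compact_diff) auto
  then obtain B where B: "\<And>\<tau>. \<lbrakk>norm \<tau> \<le> 1; m \<le> norm \<tau>\<rbrakk> \<Longrightarrow> norm (g \<tau>) \<le> B"
    by (fastforce simp: bounded_iff dest!: compact_imp_bounded)
  \<comment> \<open>Dividing by \<open>\<mu>\<close> moves a point towards the annulus and does not decrease the modulus of \<open>g\<close>.\<close>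
  have B': "norm (g \<tau>) \<le> B" if "norm \<tau> \<le> 1" "m ^ Suc n \<le> norm \<tau>" for n \<tau>
    using that
  proof (induction n arbitrary: \<tau>)
    case 0
    then show ?case using B by simp
  next
    case (Suc n)
    show ?case
    proof (cases "m \<le> norm \<tau>")
      case True
      then show ?thesis using B Suc by blast
    next
      case False
      have "norm (g (\<tau> / \<mu>)) \<le> B"
        using Suc(3) m False by (intro Suc.IH) (auto simp: norm_divide m_def[symmetric] field_simps)
      moreover have "\<tau> \<noteq> 0"
        using Suc(3) m by (metis norm_zero not_less zero_less_power)
      then have "norm (g \<tau>) = norm \<gamma> * norm (g (\<tau> / \<mu>))"
        using g_inv[of "\<tau> / \<mu>"] by (simp add: norm_mult)
      moreover have "norm \<gamma> * norm (g (\<tau> / \<mu>)) \<le> norm (g (\<tau> / \<mu>))"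
        using \<gamma> by (simp add: mult_left_le_one_le)
      ultimately show ?thesis by linarith
    qed
  qed
  have "norm (g \<tau>) \<le> B" if "\<tau> \<noteq> 0" "norm \<tau> \<le> 1" for \<tau>
  proof -
    obtain n where "m ^ n < norm \<tau>"
      using real_arch_pow_inv[of "norm \<tau>" m] \<open>\<tau> \<noteq> 0\<close> m by auto
    then have "m ^ Suc n \<le> norm \<tau>"
      using m by (metis less_eq_real_def mult_left_le_one_le order_trans power_Suc zero_le_power)
    with B' that show ?thesis by blast
  qed
  then have "\<forall>\<^sub>F \<tau> in at 0. norm (g \<tau>) \<le> B"
    unfolding eventually_at by (intro exI[of _ 1]) auto
  then obtain G where G: "G holomorphic_on UNIV" "\<And>\<tau>. \<tau> \<noteq> 0 \<Longrightarrow> G \<tau> = g \<tau>"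
    using holomorphic_on_extend_bounded[of g UNIV 0] g_hol by (auto simp: Compl_eq_Diff_UNIV)
  have G_inv: "G (\<mu> * \<tau>) = \<gamma> * G \<tau>" if "\<tau> \<noteq> 0" for \<tau>
    using G g_inv that by simp
  have dG: "(G has_field_derivative deriv G \<tau>) (at \<tau>)" for \<tau>
    using G(1) holomorphic_derivI by blast
  have dG_inv: "deriv G \<tau> = (\<mu> / \<gamma>) * deriv G (\<mu> * \<tau>)" if "\<tau> \<noteq> 0" for \<tau>
  proof -
    have "((\<lambda>t. G (\<mu> * t)) has_field_derivative deriv G (\<mu> * \<tau>) * \<mu>) (at \<tau>)"
      by (rule DERIV_chain'[OF _ dG]) (auto intro!: derivative_eq_intros)
    moreover have "((\<lambda>t. G (\<mu> * t)) has_field_derivative \<gamma> * deriv G \<tau>) (at \<tau>)"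
      using that G_inv
      by (intro has_field_derivative_transform_within_open[OF DERIV_cmult[OF dG] open_Compl[of "{0}"]]) auto
    ultimately have "deriv G (\<mu> * \<tau>) * \<mu> = \<gamma> * deriv G \<tau>"
      by (rule DERIV_unique)
    then show ?thesis
      using \<gamma>0 by (simp add: field_simps)
  qed
  have dG_n: "deriv G \<tau> = (\<mu> / \<gamma>) ^ n * deriv G (\<mu> ^ n * \<tau>)" if "\<tau> \<noteq> 0" for \<tau> n
  proof (induction n)
    case (Suc n)
    then show ?case
      using dG_inv[of "\<mu> ^ n * \<tau>"] that by (simp add: mult_ac)
  qed simp
  have dG0: "deriv G \<tau> = 0" if "\<tau> \<noteq> 0" for \<tau>
  proof -
    have "(\<lambda>n. \<mu> ^ n * \<tau>) \<longlonglongrightarrow> 0 * \<tau>"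
      by (intro tendsto_intros LIMSEQ_power_zero \<mu>)
    moreover have "isCont (deriv G) 0"
      using holomorphic_deriv[OF G(1)] holomorphic_on_imp_continuous_on continuous_on_eq_continuous_at
      by blast
    ultimately have "(\<lambda>n. deriv G (\<mu> ^ n * \<tau>)) \<longlonglongrightarrow> deriv G 0"
      using isCont_tendsto_compose by fastforce
    moreover have "(\<lambda>n. (\<mu> / \<gamma>) ^ n) \<longlonglongrightarrow> 0"
      using \<gamma> m by (intro LIMSEQ_power_zero) (simp add: norm_divide m_def[symmetric] divide_less_eq)
    ultimately have "(\<lambda>n. (\<mu> / \<gamma>) ^ n * deriv G (\<mu> ^ n * \<tau>)) \<longlonglongrightarrow> 0 * deriv G 0"
      by (rule tendsto_mult[rotated])
    then have "(\<lambda>n::nat. deriv G \<tau>) \<longlonglongrightarrow> 0"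
      using dG_n[OF that] by simp
    then show ?thesis
      by (simp add: LIMSEQ_const_iff)
  qed
  obtain c where c: "\<And>\<tau>. G \<tau> = c"
  proof (rule DERIV_zero_connected_constant[of UNIV "{0}" G])
    show "continuous_on UNIV G"
      by (rule holomorphic_on_imp_continuous_on[OF G(1)])
    show "\<forall>x\<in>UNIV - {0}. (G has_field_derivative 0) (at x)"
      using dG dG0 by (metis Diff_iff insertI1)
  qed (use that in auto)
  have h_eq: "h \<tau> = \<tau> powi k * c" if "\<tau> \<noteq> 0" for \<tau>
    using G(2)[OF that] c[of \<tau>] that by (simp add: g_def field_simps)
  have "c \<noteq> 0"
    using nz h_eq by force
  then have "\<gamma> = 1"
    using G_inv[of 1] c by simp
  then have "\<mu> powi k = \<beta>"
    by (simp add: \<gamma>_def)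
  then show ?thesis
    using h_eq by (intro exI[of _ k]) auto
qed

definition homogeneous_on_punctured :: "int \<Rightarrow> (complex^'n \<Rightarrow> complex) \<Rightarrow> bool" where
  "homogeneous_on_punctured e g \<longleftrightarrow>
    (\<forall>z \<tau>. z \<noteq> 0 \<longrightarrow> \<tau> \<noteq> 0 \<longrightarrow> g (\<tau> *s z) = \<tau> powi e * g z)"

lemma powi_norm_inj:
  assumes "0 < norm \<mu>" "norm (\<mu>::complex) < 1" "\<mu> powi k = \<mu> powi l"
  shows "k = l"
proof -
  have "norm \<mu> powi k = norm \<mu> powi l"
    using assms(3) by (metis norm_power_int)
  then have "norm \<mu> powr real_of_int k = norm \<mu> powr real_of_int l"
    using assms by (simp add: powr_real_of_int')
  then show ?thesis
    using assms powr_inj[of "norm \<mu>"] by simp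
qed

lemma open_punctured: "open (punctured :: (complex^'n) set)"
  by (simp add: open_delete)

text \<open>The degree is the same for all components and all lines because \<open>\<mu> powi k = \<beta>\<close> determines \<open>k\<close>.\<close>

lemma semi_invariant_imp_homogeneous:
  fixes \<omega> :: "complex^'n \<Rightarrow> complex^'n"
  assumes \<mu>: "0 < norm \<mu>" "norm \<mu> < 1" and \<beta>: "\<beta> \<noteq> 0"
    and hol: "holo_map_on punctured \<omega>"
    and inv: "\<And>z. z \<noteq> 0 \<Longrightarrow> \<omega> (\<mu> *s z) = \<beta> *s \<omega> z"
    and nz: "\<exists>z. z \<noteq> 0 \<and> \<omega> z \<noteq> 0"
  shows "\<exists>d. \<forall>i. homogeneous_on_punctured d (\<lambda>z. \<omega> z $ i)"
proof -
  have mono: "\<exists>k::int. \<mu> powi k = \<beta> \<and> (\<forall>\<tau>. \<tau> \<noteq> 0 \<longrightarrow> \<omega> (\<tau> *s z) $ i = \<tau> powi k * \<omega> z $ i)"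
    if z: "z \<noteq> 0" "\<omega> z $ i \<noteq> 0" for z i
  proof -
    have "\<exists>k::int. \<mu> powi k = \<beta> \<and> (\<forall>\<tau>. \<tau> \<noteq> 0 \<longrightarrow> \<omega> (\<tau> *s z) $ i = \<tau> powi k * \<omega> (1 *s z) $ i)"
    proof (rule semi_invariant_imp_monomial[OF \<mu> \<beta>])
      show "(\<lambda>\<tau>. \<omega> (\<tau> *s z) $ i) holomorphic_on - {0}"
        using holo_line_holomorphic[of punctured "\<lambda>z. \<omega> z $ i" "-{0}" 0 z] hol z
        by (simp add: holo_map_on_def)
      show "\<omega> ((\<mu> * \<tau>) *s z) $ i = \<beta> * \<omega> (\<tau> *s z) $ i" if "\<tau> \<noteq> 0" for \<tau>
        using inv[of "\<tau> *s z"] that z by (simp add: vector_smult_assoc)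
      show "\<exists>\<tau>. \<tau> \<noteq> 0 \<and> \<omega> (\<tau> *s z) $ i \<noteq> 0"
        using z by (intro exI[of _ 1]) simp
    qed
    then show ?thesis by simp
  qed
  obtain z0 i0 where "z0 \<noteq> 0" "\<omega> z0 $ i0 \<noteq> 0"
    using nz by (auto simp: vec_eq_iff)
  from mono[OF this] obtain d where d: "\<mu> powi d = \<beta>"
    by blast
  have "\<omega> (\<tau> *s z) $ i = \<tau> powi d * \<omega> z $ i" if "z \<noteq> 0" "\<tau> \<noteq> 0" for z \<tau> i
  proof (cases "\<omega> z $ i = 0")
    case False
    then show ?thesis
      using mono[OF that(1) False] powi_norm_inj[OF \<mu>, of _ d] d that by metis
  next
    case True
    show ?thesis
    proof (rule ccontr)
      assume "\<omega> (\<tau> *s z) $ i \<noteq> \<tau> powi d * \<omega> z $ i"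
      with True have "\<omega> (\<tau> *s z) $ i \<noteq> 0" "\<tau> *s z \<noteq> 0"
        using that by auto
      from mono[OF this(2,1)] obtain k :: int where
        "\<And>t. t \<noteq> 0 \<Longrightarrow> \<omega> (t *s (\<tau> *s z)) $ i = t powi k * \<omega> (\<tau> *s z) $ i"
        by blast
      from this[of "inverse \<tau>"] that True \<open>\<omega> (\<tau> *s z) $ i \<noteq> 0\<close> show False
        by (simp add: vector_smult_assoc)
    qed
  qed
  then show ?thesis
    by (auto simp: homogeneous_on_punctured_def)
qed

lemma two_indices:
  assumes "CARD('n) \<ge> 2"
  obtains i :: "'n" where "i \<noteq> j"
proof -
  have "UNIV \<noteq> {j}"
  proof
    assume "UNIV = {j}"
    then have "CARD('n) = card {j}"
      by (rule arg_cong)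
    with assms show False by simp
  qed
  then show thesis
    using that by blast
qed

text \<open>Restrict \<open>g\<close> to an affine line \<open>z + t *s v\<close> that misses the origin, which is possible in dimension at least two.
  By homogeneity \<open>g (z + t *s v) = t powi e * g (v + z / t)\<close> tends to \<open>0\<close>, and Liouville's theorem applies.\<close>

lemma negative_degree_imp_zero:
  fixes g :: "complex^'n \<Rightarrow> complex"
  assumes n: "CARD('n) \<ge> 2" and g: "holo_fun_on punctured g"
    and hom: "homogeneous_on_punctured e g" and e: "e < 0" and z: "z \<noteq> 0"
  shows "g z = 0"
proof -
  obtain j where j: "z $ j \<noteq> 0"
    using z by (auto simp: vec_eq_iff)
  obtain i where ij: "i \<noteq> j"
    using two_indices[OF n, of j] by metis
  \<comment> \<open>Moving in a coordinate direction other than \<open>j\<close> keeps the nonzero coordinate \<open>z $ j\<close>, so the line misses the origin.\<close>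
  define v :: "complex^'n" where "v = axis i 1"
  have v: "v \<noteq> 0"
    by (simp add: v_def axis_eq_0_iff)
  have nz: "z + t *s v \<noteq> 0" for t
  proof
    assume "z + t *s v = 0"
    then have "(z + t *s v) $ j = 0"
      by simp
    with j ij show False
      by (simp add: v_def axis_def)
  qed
  have hol: "(\<lambda>t. g (z + t *s v)) holomorphic_on UNIV"
    by (rule holo_line_holomorphic[OF g]) (use nz in auto)
  have "((\<lambda>t. v + inverse t *s z) \<longlongrightarrow> v + 0 *s z) at_infinity"
  proof -
    have "isCont (\<lambda>t. v + t *s z) 0"
      by (rule continuous_on_interior[of UNIV]) (auto intro!: continuous_intros)
    from isCont_tendsto_compose[OF this tendsto_inverse_0] show ?thesis .
  qed
  then have "((\<lambda>t. g (v + inverse t *s z)) \<longlongrightarrow> g v) at_infinity"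
    using isCont_tendsto_compose[of v g] holo_continuous[OF g] v
    by (simp add: continuous_on_eq_continuous_at open_punctured)
  moreover have "((\<lambda>t::complex. t powi e) \<longlongrightarrow> 0) at_infinity"
  proof -
    have "((\<lambda>t::complex. inverse t ^ nat (- e)) \<longlongrightarrow> 0 ^ nat (- e)) at_infinity"
      by (intro tendsto_intros tendsto_inverse_0)
    moreover have "(0::complex) ^ nat (- e) = 0"
      using e by simp
    ultimately show ?thesis
      using e by (simp add: power_int_def)
  qed
  ultimately have lim: "((\<lambda>t. t powi e * g (v + inverse t *s z)) \<longlongrightarrow> 0 * g v) at_infinity"
    by (rule tendsto_mult[rotated])
  have "((\<lambda>t. g (z + t *s v)) \<longlongrightarrow> 0) at_infinity"
  proof (rule Lim_transform_eventually)
    show "((\<lambda>t. t powi e * g (v + inverse t *s z)) \<longlongrightarrow> 0) at_infinity"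
      using lim by simp
    have "t powi e * g (v + inverse t *s z) = g (z + t *s v)" if "t \<noteq> 0" for t
    proof -
      have eq: "z + t *s v = t *s (v + inverse t *s z)"
        using that by (simp add: vec_eq_iff field_simps)
      then have "v + inverse t *s z \<noteq> 0"
        using nz[of t] by (metis vector_mul_eq_0)
      then show ?thesis
        using hom that unfolding eq homogeneous_on_punctured_def by metis
    qed
    then show "\<forall>\<^sub>F t in at_infinity. t powi e * g (v + inverse t *s z) = g (z + t *s v)"
      using eventually_not_equal_at_infinity[of 0] by (rule eventually_mono[rotated]) auto
  qed
  from Liouville_weak_0[OF hol this, of 0] show ?thesis
    by simp
qed

text \<open>The identity theorem on the affine line joining \<open>q\<close> and \<open>w\<close>; homogeneity handles the points whose joining line with \<open>q\<close> contains the origin.\<close>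

lemma homogeneous_identity:
  fixes g :: "complex^'n \<Rightarrow> complex"
  assumes g: "holo_fun_on punctured g" and hom: "homogeneous_on_punctured e g"
    and U: "open U" "q \<in> U" "U \<subseteq> punctured" and zero: "\<And>z. z \<in> U \<Longrightarrow> g z = 0"
    and w: "w \<noteq> 0"
  shows "g w = 0"
proof (cases "\<exists>c. w = c *s q")
  case True
  then obtain c where "w = c *s q" "c \<noteq> 0"
    using w by auto
  with hom zero[OF U(2)] U show ?thesis
    by (auto simp: homogeneous_on_punctured_def)
next
  case False
  have q: "q \<noteq> 0"
    using U by auto
  have nz: "q + t *s (w - q) \<noteq> 0" for t
  proof
    assume *: "q + t *s (w - q) = 0"
    then have "t \<noteq> 0"
      using q by auto
    have "w = ((t - 1) / t) *s q"
      using * \<open>t \<noteq> 0\<close> by (simp add: vec_eq_iff field_simps)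
    with False show False by blast
  qed
  have "g (q + 1 *s (w - q)) = 0"
  proof (rule analytic_continuation_open[where f = "\<lambda>t. g (q + t *s (w - q))" and g = "\<lambda>_. 0" and s' = UNIV])
    show "open {t. q + t *s (w - q) \<in> U}"
      by (rule open_line_preimage[OF U(1)])
    show "{t. q + t *s (w - q) \<in> U} \<noteq> {}"
      using U(2) by (auto intro!: exI[of _ 0])
    show "(\<lambda>t. g (q + t *s (w - q))) holomorphic_on UNIV"
      by (rule holo_line_holomorphic[OF g]) (use nz in auto)
  qed (use zero in auto)
  then show ?thesis
    by simp
qed

definition radial_contraction :: "(complex^'n \<Rightarrow> complex^'n) \<Rightarrow> complex^'n \<Rightarrow> complex" where
  "radial_contraction \<omega> z = covec_app (\<omega> z) z"

lemma holo_radial_contraction: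
  assumes "holo_map_on U \<omega>"
  shows "holo_fun_on U (radial_contraction \<omega>)"
proof -
  have "holo_fun_on U (\<lambda>z. \<Sum>i\<in>UNIV. \<omega> z $ i * z $ i)"
    by (intro holo_sum holo_mult holo_nth holo_map_open[OF assms])
      (use assms in \<open>auto simp: holo_map_on_def\<close>)
  then show ?thesis
    by (simp add: radial_contraction_def[abs_def] covec_app_def)
qed

lemma homogeneous_radial_contraction:
  fixes \<omega> :: "complex^'n \<Rightarrow> complex^'n"
  assumes "\<And>i. homogeneous_on_punctured d (\<lambda>z. \<omega> z $ i)"
  shows "homogeneous_on_punctured (d + 1) (radial_contraction \<omega>)"
  using assms
  by (auto simp: homogeneous_on_punctured_def radial_contraction_def covec_app_def sum_distrib_left
      power_int_add mult_ac intro!: sum.cong)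

lemma euler_homogeneous:
  assumes "homogeneous_on_punctured d g" "holo_fun_on punctured g" "z \<noteq> 0"
  shows "(\<Sum>i\<in>UNIV. z $ i * cpartial i g z) = of_int d * g z"
proof -
  have "dir_deriv z g z = of_int d * g z"
    unfolding dir_deriv_def
  proof (rule DERIV_imp_deriv)
    have D: "((\<lambda>t. (1 + t) powi d * g z) has_field_derivative of_int d * g z) (at 0)"
      by (auto intro!: derivative_eq_intros)
    have E: "(1 + t) powi d * g z = g (z + t *s z)" if "t \<in> ball 0 1" for t
    proof -
      have "1 + t \<noteq> 0"
        using that by (metis add_eq_0_iff dist_0_norm mem_ball norm_minus_cancel norm_one less_irrefl)
      moreover have "z + t *s z = (1 + t) *s z"
        by (simp add: vec_eq_iff algebra_simps)
      ultimately show ?thesis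
        using assms(1,3) unfolding homogeneous_on_punctured_def by metis
    qed
    show "((\<lambda>t. g (z + t *s z)) has_field_derivative of_int d * g z) (at 0)"
      by (rule has_field_derivative_transform_within_open[OF D open_ball[of 0 1]]) (use E in auto)
  qed
  with dir_deriv_sum_axis[OF assms(2), of z z] assms(3) show ?thesis
    by simp
qed

text \<open>Contract \<open>\<omega> \<and> d\<omega> = 0\<close> with the radial field. The contraction of \<open>d\<omega>\<close> is \<open>(d + 1) \<omega> - dP\<close> by Euler's
  relation, and the multiple of \<open>\<omega>\<close> drops out after taking the wedge product with \<open>\<omega>\<close>.\<close>

lemma integrating_factor_identity:
  fixes \<omega> :: "complex^'n \<Rightarrow> complex^'n"
  assumes hol: "holo_map_on punctured \<omega>"
    and hom: "\<And>i. homogeneous_on_punctured d (\<lambda>z. \<omega> z $ i)"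
    and int: "integrable_on_set punctured \<omega>" and z: "z \<noteq> 0"
  shows "radial_contraction \<omega> z * ext_deriv \<omega> z j k =
    \<omega> z $ k * cpartial j (radial_contraction \<omega>) z - \<omega> z $ j * cpartial k (radial_contraction \<omega>) z"
proof -
  define A where "A i j = cpartial i (\<lambda>w. \<omega> w $ j) z" for i j
  have holi: "holo_fun_on punctured (\<lambda>w. \<omega> w $ i)" for i
    using hol by (simp add: holo_map_on_def)
  have zp: "z \<in> punctured"
    using z by simp
  have euler: "(\<Sum>i\<in>UNIV. z $ i * A i j) = of_int d * \<omega> z $ j" for j
    unfolding A_def by (rule euler_homogeneous[OF hom holi z])
  have dP: "cpartial k (radial_contraction \<omega>) z = \<omega> z $ k + (\<Sum>i\<in>UNIV. z $ i * A k i)" for k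
  proof -
    have "cpartial k (radial_contraction \<omega>) z =
        dir_deriv (axis k 1) (\<lambda>z. \<Sum>i\<in>UNIV. \<omega> z $ i * z $ i) z"
      by (simp add: cpartial_eq_dir_deriv radial_contraction_def[abs_def] covec_app_def)
    also have "\<dots> = (\<Sum>i\<in>UNIV. dir_deriv (axis k 1) (\<lambda>z. \<omega> z $ i * z $ i) z)"
      by (rule dir_deriv_sum[OF open_punctured holo_mult[OF holi holo_nth[OF open_punctured]] zp]) simp
    also have "\<dots> = (\<Sum>i\<in>UNIV. A k i * z $ i + \<omega> z $ i * axis k 1 $ i)"
      unfolding A_def cpartial_eq_dir_deriv
      by (simp add: dir_deriv_mult[OF holi holo_nth[OF open_punctured] zp] dir_deriv_nth)
    also have "\<dots> = (\<Sum>i\<in>UNIV. A k i * z $ i) + (\<Sum>i\<in>UNIV. \<omega> z $ i * axis k 1 $ i)"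
      by (rule sum.distrib)
    also have "(\<Sum>i\<in>UNIV. \<omega> z $ i * axis k 1 $ i) = \<omega> z $ k"
      using covec_app_axis[of "\<omega> z" k] by (simp only: covec_app_def)
    also have "(\<Sum>i\<in>UNIV. A k i * z $ i) + \<omega> z $ k = \<omega> z $ k + (\<Sum>i\<in>UNIV. z $ i * A k i)"
      by (simp add: mult.commute)
    finally show ?thesis .
  qed
  have "0 = (\<Sum>i\<in>UNIV. z $ i * wedge_1_2 (\<omega> z) (ext_deriv \<omega> z) i j k)"
    using int zp by (simp add: integrable_on_set_def)
  also have "\<dots> = (\<Sum>i\<in>UNIV. (\<omega> z $ i * z $ i) * ext_deriv \<omega> z j k
      + \<omega> z $ j * (z $ i * A k i) - \<omega> z $ j * (z $ i * A i k)
      + \<omega> z $ k * (z $ i * A i j) - \<omega> z $ k * (z $ i * A j i))"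
    by (intro sum.cong) (auto simp: wedge_1_2_def ext_deriv_def A_def algebra_simps)
  also have "\<dots> = radial_contraction \<omega> z * ext_deriv \<omega> z j k
      + \<omega> z $ j * (\<Sum>i\<in>UNIV. z $ i * A k i) - \<omega> z $ j * (\<Sum>i\<in>UNIV. z $ i * A i k)
      + \<omega> z $ k * (\<Sum>i\<in>UNIV. z $ i * A i j) - \<omega> z $ k * (\<Sum>i\<in>UNIV. z $ i * A j i)"
    by (simp only: sum.distrib sum_subtractf sum_distrib_left sum_distrib_right radial_contraction_def covec_app_def)
  finally show ?thesis
    unfolding euler dP by (simp add: algebra_simps)
qed

text \<open>The vectors \<open>(z, v)\<close> and \<open>(\<mu> z, \<mu> v)\<close> represent the same tangent vector of the quotient; as \<open>\<mu>\<close> is not a root of unity, the representatives of the value over \<open>z\<close> and over \<open>\<mu> z\<close> differ by exactly one factor \<open>b\<close>.\<close>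

lemma section_semi_invariant:
  fixes \<omega> :: "complex^'n \<Rightarrow> complex^'n"
  assumes \<mu>: "0 < norm \<mu>" "norm \<mu> < 1" and sec: "section_with_pullback \<mu> b s \<omega>" and z: "z \<noteq> 0"
  shows "\<omega> (\<mu> *s z) = (b / \<mu>) *s \<omega> z"
proof -
  have \<mu>0: "\<mu> \<noteq> 0"
    using \<mu> by auto
  have "\<omega> (\<mu> *s z) $ i = (b / \<mu>) * \<omega> z $ i" for i
  proof -
    define v :: "complex^'n" where "v = axis i 1"
    have "tangent_class \<mu> (\<mu> *s z) (\<mu> *s v) = tangent_class \<mu> z v"
    proof -
      have shift: "(\<mu> powi k) *s (\<mu> *s x) = (\<mu> powi (k + 1)) *s (x::complex^'n)" for k x
        using \<mu>0 by (simp add: power_int_add vector_smult_assoc)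
      have "tangent_class \<mu> (\<mu> *s z) (\<mu> *s v) = {((\<mu> powi (k + 1)) *s z, (\<mu> powi (k + 1)) *s v) | k. True}"
        unfolding tangent_class_def shift ..
      also have "\<dots> = tangent_class \<mu> z v"
        unfolding tangent_class_def by (metis (no_types, opaque_lifting) diff_add_cancel)
      finally show ?thesis .
    qed
    then have "line_class \<mu> b (\<mu> *s z) (covec_app (\<omega> (\<mu> *s z)) (\<mu> *s v)) = line_class \<mu> b z (covec_app (\<omega> z) v)"
      using sec z \<mu>0 unfolding section_with_pullback_def
      by (metis DiffI UNIV_I singletonD vector_mul_eq_0)
    moreover have "(\<mu> *s z, covec_app (\<omega> (\<mu> *s z)) (\<mu> *s v)) \<in> line_class \<mu> b (\<mu> *s z) (covec_app (\<omega> (\<mu> *s z)) (\<mu> *s v))"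
      unfolding line_class_def by (rule CollectI, rule exI[of _ 0]) simp
    ultimately obtain k :: int where k: "\<mu> *s z = (\<mu> powi k) *s z"
      "covec_app (\<omega> (\<mu> *s z)) (\<mu> *s v) = (b powi k) * covec_app (\<omega> z) v"
      unfolding line_class_def by auto
    from k(1) z have "\<mu> powi k = \<mu> powi 1"
      by (auto simp: vec_eq_iff)
    then have "k = 1"
      by (rule powi_norm_inj[OF \<mu>])
    with k(2) \<mu>0 show ?thesis
      by (simp add: covec_app_scale v_def field_simps)
  qed
  then show ?thesis
    by (simp add: vec_eq_iff)
qed

section \<open>Points of least multiplicity on a zero set\<close>

definition iter_deriv :: "(complex^'n) list \<Rightarrow> (complex^'n \<Rightarrow> complex) \<Rightarrow> complex^'n \<Rightarrow> complex" where
  "iter_deriv l g = foldr dir_deriv l g"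

lemma iter_deriv_simps [simp]:
  "iter_deriv [] g = g"
  "iter_deriv (v # l) g = dir_deriv v (iter_deriv l g)"
  "iter_deriv (l @ [v]) g = iter_deriv l (dir_deriv v g)"
  by (simp_all add: iter_deriv_def)

lemma holo_iter_deriv: "holo_fun_on U g \<Longrightarrow> holo_fun_on U (iter_deriv l g)"
  by (induction l) (auto intro: holo_dir_deriv)

lemma iter_deriv_cong:
  assumes "open U" "\<And>z. z \<in> U \<Longrightarrow> g z = h z"
  shows "z \<in> U \<Longrightarrow> iter_deriv l g z = iter_deriv l h z"
  by (induction l arbitrary: z) (auto intro: dir_deriv_cong[OF assms(1)] simp: assms(2))

lemma iter_deriv_add:
  assumes "holo_fun_on U g" "holo_fun_on U h"
  shows "z \<in> U \<Longrightarrow> iter_deriv l (\<lambda>z. g z + h z) z = iter_deriv l g z + iter_deriv l h z"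
proof (induction l arbitrary: z)
  case (Cons v l)
  have "dir_deriv v (iter_deriv l (\<lambda>z. g z + h z)) z =
      dir_deriv v (\<lambda>z. iter_deriv l g z + iter_deriv l h z) z"
    by (rule dir_deriv_cong[OF holo_open[OF assms(1)] Cons.prems Cons.IH])
  also have "\<dots> = dir_deriv v (iter_deriv l g) z + dir_deriv v (iter_deriv l h) z"
    by (rule dir_deriv_add[OF holo_iter_deriv[OF assms(1)] holo_iter_deriv[OF assms(2)] Cons.prems])
  finally show ?case
    by simp
qed simp

lemma dir_deriv_iter_deriv_commute:
  assumes "holo_fun_on U g"
  shows "z \<in> U \<Longrightarrow> dir_deriv w (iter_deriv l g) z = iter_deriv l (dir_deriv w g) z"
proof (induction l arbitrary: z)
  case (Cons v l)
  have "dir_deriv w (dir_deriv v (iter_deriv l g)) z = dir_deriv v (dir_deriv w (iter_deriv l g)) z"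
    by (rule dir_deriv_commute[OF holo_iter_deriv[OF assms] Cons.prems])
  also have "\<dots> = dir_deriv v (iter_deriv l (dir_deriv w g)) z"
    by (rule dir_deriv_cong[OF holo_open[OF assms] Cons.prems Cons.IH])
  finally show ?case
    by simp
qed simp

text \<open>In the Leibniz expansion every term except the one with all derivatives on \<open>f\<close> contains a derivative of \<open>f\<close> of smaller order.\<close>

lemma iter_deriv_mult_leading:
  assumes "holo_fun_on U f" "holo_fun_on U g" "q \<in> U"
    and "\<And>l'. length l' < length l \<Longrightarrow> iter_deriv l' f q = 0"
  shows "iter_deriv l (\<lambda>z. f z * g z) q = iter_deriv l f q * g q"
  using assms(1,2,4)
proof (induction l arbitrary: f g rule: rev_induct)
  case (snoc v l)
  note f = snoc.prems(1) and g = snoc.prems(2) and van = snoc.prems(3)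
  have f': "holo_fun_on U (dir_deriv v f)" and g': "holo_fun_on U (dir_deriv v g)"
    using f g by (auto intro: holo_dir_deriv)
  have "iter_deriv (l @ [v]) (\<lambda>z. f z * g z) q =
      iter_deriv l (\<lambda>z. dir_deriv v f z * g z + f z * dir_deriv v g z) q"
    unfolding iter_deriv_simps
    by (rule iter_deriv_cong[OF holo_open[OF f] dir_deriv_mult[OF f g] assms(3)])
  also have "\<dots> = iter_deriv l (\<lambda>z. dir_deriv v f z * g z) q + iter_deriv l (\<lambda>z. f z * dir_deriv v g z) q"
    by (rule iter_deriv_add[OF holo_mult[OF f' g] holo_mult[OF f g'] assms(3)])
  also have "iter_deriv l (\<lambda>z. dir_deriv v f z * g z) q = iter_deriv l (dir_deriv v f) q * g q"
  proof (rule snoc.IH[OF f' g])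
    show "iter_deriv l' (dir_deriv v f) q = 0" if "length l' < length l" for l'
      using van[of "l' @ [v]"] that by simp
  qed
  also have "iter_deriv l (\<lambda>z. f z * dir_deriv v g z) q = iter_deriv l f q * dir_deriv v g q"
    by (rule snoc.IH[OF f g']) (use van in auto)
  also have "iter_deriv l f q = 0"
    using van[of l] by simp
  finally show ?case
    by simp
qed simp

text \<open>On a line from \<open>q\<close> to a nearby point where \<open>g\<close> does not vanish, \<open>g\<close> is a nonzero function of one variable; some derivative of it at \<open>q\<close> is nonzero.\<close>

lemma exists_nonzero_iter_deriv:
  fixes g :: "complex^'n \<Rightarrow> complex"
  assumes g: "holo_fun_on U g" and q: "q \<in> U"
    and nz: "\<And>V. \<lbrakk>open V; V \<noteq> {}; V \<subseteq> U\<rbrakk> \<Longrightarrow> \<exists>z\<in>V. g z \<noteq> 0"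
  shows "\<exists>l. iter_deriv l g q \<noteq> 0"
proof (rule ccontr)
  assume "\<not> ?thesis"
  then have zero: "iter_deriv l g q = 0" for l
    by blast
  obtain r where r: "r > 0" "ball q r \<subseteq> U"
    using holo_open[OF g] q openE by blast
  obtain z where z: "z \<in> ball q r" "g z \<noteq> 0"
    using nz[of "ball q r"] r by auto
  define v where "v = z - q"
  have v: "0 < norm v" "norm v < r"
    using z zero[of "[]"] by (auto simp: v_def dist_norm norm_minus_commute)
  define R where "R = r / norm v"
  have inU: "q + t *s v \<in> U" if "t \<in> ball 0 R" for t
  proof -
    have "q + t *s v \<in> ball q r"
      using that v by (simp add: dist_norm norm_vector_scale R_def field_simps)
    with r show ?thesis by blast
  qed
  have "((deriv ^^ k) (\<lambda>t. g (q + t *s v))) t = iter_deriv (replicate k v) g (q + t *s v)"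
    if "t \<in> ball 0 R" for k t
    using that
  proof (induction k arbitrary: t)
    case (Suc k)
    have "deriv ((deriv ^^ k) (\<lambda>t. g (q + t *s v))) t =
        deriv (\<lambda>t. iter_deriv (replicate k v) g (q + t *s v)) t"
      by (rule deriv_cong_ev) (use Suc eventually_nhds_in_open[of "ball 0 R" t] in \<open>auto elim!: eventually_mono\<close>)
    also have "\<dots> = dir_deriv v (iter_deriv (replicate k v) g) (q + t *s v)"
      by (rule DERIV_imp_deriv, rule holo_line_deriv(1)[OF holo_iter_deriv[OF g] inU[OF Suc.prems]])
    finally show ?case
      by simp
  qed simp
  moreover have "0 \<in> ball 0 R" "1 \<in> ball (0::complex) R"
    using v r by (auto simp: R_def)
  ultimately have "(deriv ^^ k) (\<lambda>t. g (q + t *s v)) 0 = 0" for k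
    using zero by simp
  then have "g (q + 1 *s v) = 0"
    using holomorphic_fun_eq_0_on_ball[OF holo_line_holomorphic[OF g inU, of "ball 0 R"] \<open>1 \<in> ball 0 R\<close>]
    by blast
  with z show False
    by (simp add: v_def)
qed

text \<open>Minimise the order of a nonvanishing derivative over all zeros in \<open>U\<close> and all directions, and strip the outermost
  derivative from an optimal list. By minimality the remaining derivative is zero at every zero of \<open>P\<close> in \<open>U\<close>,
  and its own differential at \<open>q\<close> is nonzero.\<close>

lemma least_multiplicity_point:
  fixes P :: "complex^'n \<Rightarrow> complex"
  assumes P: "holo_fun_on U P" and q0: "q0 \<in> U" "P q0 = 0"
    and nz: "\<And>V. \<lbrakk>open V; V \<noteq> {}; V \<subseteq> U\<rbrakk> \<Longrightarrow> \<exists>z\<in>V. P z \<noteq> 0"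
  obtains q l i where "q \<in> U" "P q = 0" "\<forall>z\<in>U. P z = 0 \<longrightarrow> iter_deriv l P z = 0"
    "\<forall>l'. length l' \<le> length l \<longrightarrow> iter_deriv l' P q = 0" "cpartial i (iter_deriv l P) q \<noteq> 0"
proof -
  define Q where "Q m \<longleftrightarrow> (\<exists>q\<in>U. P q = 0 \<and> (\<exists>l. length l = m \<and> iter_deriv l P q \<noteq> 0))" for m
  define m where "m = (LEAST m. Q m)"
  have "\<exists>m. Q m"
    using exists_nonzero_iter_deriv[OF P q0(1) nz] q0 by (auto simp: Q_def)
  then have "Q m"
    unfolding m_def by (rule LeastI_ex)
  then obtain q l0 where q: "q \<in> U" "P q = 0" and l0: "length l0 = m" "iter_deriv l0 P q \<noteq> 0"
    by (auto simp: Q_def)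
  have less: "iter_deriv l' P z = 0" if "z \<in> U" "P z = 0" "length l' < m" for l' z
    using not_less_Least[of "length l'" Q] that by (auto simp: Q_def m_def)
  obtain v l where l: "l0 = v # l"
    using l0 q by (cases l0) auto
  have "dir_deriv v (iter_deriv l P) q \<noteq> 0"
    using l0 l by simp
  then obtain i where i: "cpartial i (iter_deriv l P) q \<noteq> 0"
    using dir_deriv_sum_axis[OF holo_iter_deriv[OF P] q(1)] by (metis (mono_tags, lifting) mult_zero_right sum.neutral)
  show thesis
    by (rule that[OF q _ _ i]) (use less q l l0 in auto)
qed

section \<open>Straightening a smooth zero set\<close>

definition replace_coord :: "'n \<Rightarrow> (complex^'n \<Rightarrow> complex) \<Rightarrow> complex^'n \<Rightarrow> complex^'n" where
  "replace_coord i \<rho> z = (\<chi> j. if j = i then \<rho> z else z $ j)"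

text \<open>The map \<open>replace_coord i \<rho>\<close> is a holomorphic coordinate system on \<open>N\<close> with a ball as image and inverse \<open>g\<close>, in which \<open>{\<rho> = 0}\<close> is the hyperplane \<open>w $ i = 0\<close>.\<close>

definition straightening ::
    "(complex^'n \<Rightarrow> complex) \<Rightarrow> 'n \<Rightarrow> complex^'n \<Rightarrow> (complex^'n) set \<Rightarrow> real \<Rightarrow> (complex^'n \<Rightarrow> complex^'n) \<Rightarrow> bool" where
  "straightening \<rho> i q N \<epsilon> g \<longleftrightarrow>
     open N \<and> q \<in> N \<and> 0 < \<epsilon> \<and> holo_fun_on N \<rho> \<and> holo_map_on (ball (replace_coord i \<rho> q) \<epsilon>) g \<and>
     (\<forall>z\<in>N. replace_coord i \<rho> z \<in> ball (replace_coord i \<rho> q) \<epsilon> \<and> g (replace_coord i \<rho> z) = z) \<and>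
     (\<forall>w\<in>ball (replace_coord i \<rho> q) \<epsilon>. g w \<in> N \<and> replace_coord i \<rho> (g w) = w)"

lemma replace_coord_nth: "replace_coord i \<rho> z $ i = \<rho> z"
  by (simp add: replace_coord_def)

lemma holo_replace_coord:
  assumes "holo_fun_on U \<rho>"
  shows "holo_map_on U (replace_coord i \<rho>)"
  unfolding holo_map_on_def
proof
  fix j
  show "holo_fun_on U (\<lambda>z. replace_coord i \<rho> z $ j)"
    using assms holo_nth[OF holo_open[OF assms], of j] by (cases "j = i") (auto simp: replace_coord_def)
qed

lemma straightening_shrink:
  assumes st: "straightening \<rho> i q N \<epsilon> g" and "0 < \<epsilon>'" "\<epsilon>' \<le> \<epsilon>"
  shows "straightening \<rho> i q {z \<in> N. replace_coord i \<rho> z \<in> ball (replace_coord i \<rho> q) \<epsilon>'} \<epsilon>' g"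
proof -
  have sub: "ball (replace_coord i \<rho> q) \<epsilon>' \<subseteq> ball (replace_coord i \<rho> q) \<epsilon>"
    using assms by auto
  have "open (N \<inter> replace_coord i \<rho> -` ball (replace_coord i \<rho> q) \<epsilon>')"
    using st by (intro continuous_open_preimage holo_map_continuous[OF holo_replace_coord])
      (auto simp: straightening_def)
  moreover have "N \<inter> replace_coord i \<rho> -` ball (replace_coord i \<rho> q) \<epsilon>' =
      {z \<in> N. replace_coord i \<rho> z \<in> ball (replace_coord i \<rho> q) \<epsilon>'}"
    by auto
  ultimately have op: "open {z \<in> N. replace_coord i \<rho> z \<in> ball (replace_coord i \<rho> q) \<epsilon>'}"
    by simp
  have "holo_map_on (ball (replace_coord i \<rho> q) \<epsilon>') g"
    using st sub holo_subset unfolding straightening_def holo_map_on_def by (meson open_ball)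
  then show ?thesis
    using st sub op assms(2) holo_subset[OF _ op, of N \<rho>]
    unfolding straightening_def by (simp add: subset_iff)
qed

lemma inv_complex_linear:
  fixes L :: "complex^'n \<Rightarrow> complex^'n"
  assumes "bij L" "\<And>c v. L (c *s v) = c *s L v"
  shows "inv L (c *s w) = c *s inv L w"
  using assms by (metis bij_inv_eq_iff)

text \<open>The inverse function theorem; the inverse map is holomorphic because the inverse of a complex linear map is complex linear.\<close>

lemma exists_straightening:
  fixes \<rho> :: "complex^'n \<Rightarrow> complex"
  assumes \<rho>: "holo_fun_on U \<rho>" and q: "q \<in> U" and i: "cpartial i \<rho> q \<noteq> 0"
  obtains N \<epsilon> g where "N \<subseteq> U" "straightening \<rho> i q N \<epsilon> g"
proof -
  define \<Phi> where "\<Phi> = replace_coord i \<rho>"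
  define L where "L x v = (\<chi> j. if j = i then dir_deriv v \<rho> x else v $ j)" for x and v :: "complex^'n"
  have der: "(\<Phi> has_derivative L x) (at x)" if "x \<in> U" for x
    unfolding has_derivative_vec_componentwise
  proof
    fix j
    show "((\<lambda>z. \<Phi> z $ j) has_derivative (\<lambda>v. L x v $ j)) (at x)"
      using holo_has_derivative_dir_deriv[OF \<rho> that] bounded_linear_imp_has_derivative[OF bounded_linear_vec_nth]
      by (cases "j = i") (simp_all add: \<Phi>_def replace_coord_def L_def)
  qed
  have bl: "bounded_linear (L x)" if "x \<in> U" for x
    using der[OF that] has_derivative_bounded_linear by blast
  define f' where "f' x = Blinfun (L x)" for x
  have f': "blinfun_apply (f' x) = L x" if "x \<in> U" for x
    unfolding f'_def by (rule bounded_linear_Blinfun_apply[OF bl[OF that]])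
  have L_scale: "L x (c *s v) = c *s L x v" if "x \<in> U" for x c v
    by (simp add: L_def vec_eq_iff dir_deriv_scale[OF \<rho> that])
  have contf': "continuous_on U f'"
  proof (rule continuous_on_blinfun_componentwise)
    fix b :: "complex^'n"
    have "continuous_on U (\<lambda>x. L x b)"
      unfolding L_def
    proof (rule continuous_on_vec_lambda)
      fix j
      show "continuous_on U (\<lambda>x. if j = i then dir_deriv b \<rho> x else b $ j)"
        using continuous_on_dir_deriv[OF \<rho>] by (cases "j = i") auto
    qed
    then show "continuous_on U (\<lambda>x. blinfun_apply (f' x) b)"
      by (rule continuous_on_eq) (simp add: f')
  qed
  \<comment> \<open>A vector in the kernel is a multiple of the \<open>i\<close>-th basis vector, on which \<open>L q\<close> is multiplication by the partial derivative.\<close>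
  have "inj (L q)"
  proof (subst linear_injective_0[OF bounded_linear.linear[OF bl[OF q]]], intro allI impI)
    fix v assume "L q v = 0"
    then have v: "dir_deriv v \<rho> q = 0" "\<And>j. j \<noteq> i \<Longrightarrow> v $ j = 0"
      by (auto simp: L_def vec_eq_iff split: if_splits)
    then have "v = (v $ i) *s axis i 1"
      by (auto simp: vec_eq_iff axis_def)
    then have "dir_deriv v \<rho> q = (v $ i) * cpartial i \<rho> q"
      using dir_deriv_scale[OF \<rho> q] by (metis cpartial_eq_dir_deriv)
    with v i have "v $ i = 0"
      by simp
    with v(2) have "v $ j = 0" for j
      by (cases "j = i") auto
    then show "v = 0"
      by (simp add: vec_eq_iff)
  qed
  then obtain h where h: "linear h" "h \<circ> L q = id"
    using linear_injective_left_inverse[OF bounded_linear.linear[OF bl[OF q]]] by blast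
  have hL: "h (L q v) = v" for v
    using h(2) by (metis comp_apply id_apply)
  have app_h: "blinfun_apply (Blinfun h) = h"
    using h(1) by (simp add: bounded_linear_Blinfun_apply linear_conv_bounded_linear)
  have inv: "Blinfun h o\<^sub>L f' q = id_blinfun"
    by (rule blinfun_eqI) (simp add: app_h f'[OF q] hL)
  have der': "(\<Phi> has_derivative blinfun_apply (f' x)) (at x)" if "x \<in> U" for x
    unfolding f'[OF that] by (rule der[OF that])
  have "\<exists>U' V g g'. open U' \<and> U' \<subseteq> U \<and> q \<in> U' \<and> open V \<and> \<Phi> q \<in> V \<and> homeomorphism U' V \<Phi> g \<and>
      (\<forall>y\<in>V. (g has_derivative g' y) (at y)) \<and> (\<forall>y\<in>V. g' y = inv (blinfun_apply (f' (g y)))) \<and>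
      (\<forall>y\<in>V. bij (blinfun_apply (f' (g y))))"
    by (rule inverse_function_theorem[OF holo_open[OF \<rho>] der' contf' q inv]) blast+
  then obtain U' V g g' where U': "open U'" "U' \<subseteq> U" "q \<in> U'" and V: "open V" "\<Phi> q \<in> V"
    and hom: "homeomorphism U' V \<Phi> g"
    and g': "\<forall>y\<in>V. (g has_derivative (g' y)) (at y)"
      "\<forall>y\<in>V. g' y = inv (blinfun_apply (f' (g y)))"
      "\<forall>y\<in>V. bij (blinfun_apply (f' (g y)))"
    by (elim exE conjE) (rule that)
  have gU': "g y \<in> U'" if "y \<in> V" for y
    using hom that by (auto simp: homeomorphism_def)
  have hg: "holo_map_on V g"
    unfolding holo_map_on_def
  proof
    fix j
    show "holo_fun_on V (\<lambda>z. g z $ j)"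
    proof (rule holo_fun_onI[OF V(1)])
      fix y assume y: "y \<in> V"
      have gy: "g y \<in> U"
        using gU'[OF y] U' by blast
      have "((\<lambda>z. g z $ j) has_derivative (\<lambda>v. g' y v $ j)) (at y)"
        using g'(1)[rule_format, OF y] unfolding has_derivative_vec_componentwise by blast
      moreover have "g' y (c *s v) = c *s g' y v" for c v
        using inv_complex_linear[of "L (g y)", OF _ L_scale[OF gy]] g'(2,3)[rule_format, OF y]
        unfolding f'[OF gy] by simp
      ultimately show "\<exists>f'. ((\<lambda>z. g z $ j) has_derivative f') (at y) \<and> (\<forall>c v. f' (c *s v) = c * f' v)"
        by (intro exI conjI) auto
    qed
  qed
  obtain \<epsilon> where \<epsilon>: "\<epsilon> > 0" "ball (\<Phi> q) \<epsilon> \<subseteq> V"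
    using V openE by blast
  define N where "N = U' \<inter> \<Phi> -` ball (\<Phi> q) \<epsilon>"
  have "open N"
    unfolding N_def using hom
    by (intro continuous_open_preimage U'(1) open_ball) (auto simp: homeomorphism_def)
  moreover have "N \<subseteq> U"
    using U' by (auto simp: N_def)
  moreover have "holo_map_on (ball (\<Phi> q) \<epsilon>) g"
    using hg \<epsilon> holo_subset unfolding holo_map_on_def by (meson open_ball)
  moreover have "holo_fun_on N \<rho>"
    by (rule holo_subset[OF \<rho> \<open>open N\<close> \<open>N \<subseteq> U\<close>])
  moreover have "q \<in> N"
    using U' \<epsilon> by (simp add: N_def)
  moreover have "\<forall>z\<in>N. \<Phi> z \<in> ball (\<Phi> q) \<epsilon> \<and> g (\<Phi> z) = z"
    using hom by (simp add: N_def homeomorphism_def)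
  moreover have "\<forall>w\<in>ball (\<Phi> q) \<epsilon>. g w \<in> N \<and> \<Phi> (g w) = w"
  proof
    fix w assume w: "w \<in> ball (\<Phi> q) \<epsilon>"
    then have "w \<in> V"
      using \<epsilon> by blast
    then have "\<Phi> (g w) = w"
      using hom by (simp add: homeomorphism_def)
    with w gU'[OF \<open>w \<in> V\<close>] show "g w \<in> N \<and> \<Phi> (g w) = w"
      by (simp add: N_def)
  qed
  ultimately have "straightening \<rho> i q N \<epsilon> g"
    using \<epsilon>(1) by (simp only: straightening_def \<Phi>_def[symmetric])
  with \<open>N \<subseteq> U\<close> show thesis
    by (rule that)
qed

text \<open>If \<open>F\<close> were nonzero at a point \<open>w\<close> of the hyperplane close to \<open>w0\<close>, then \<open>1 / F\<close> would be holomorphic on the disc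
  through \<open>w\<close> transversal to the hyperplane. The boundaries of these discs lie in a compact set on which \<open>F\<close> is
  bounded away from zero, so the maximum principle bounds \<open>F w\<close> away from zero, whereas \<open>F\<close> is small near \<open>w0\<close>.\<close>

lemma zero_on_hyperplane_of_zeros_within:
  fixes F :: "complex^'n \<Rightarrow> complex" and w0 :: "complex^'n"
  assumes F: "holo_fun_on (ball w0 \<epsilon>) F" and \<epsilon>: "0 < \<epsilon>" and w0: "w0 $ i = 0" "F w0 = 0"
    and nz: "\<And>w. \<lbrakk>w \<in> ball w0 \<epsilon>; w $ i \<noteq> 0\<rbrakk> \<Longrightarrow> F w \<noteq> 0"
  obtains \<delta> where "0 < \<delta>" "\<delta> \<le> \<epsilon>" "\<forall>w\<in>ball w0 \<delta>. w $ i = 0 \<longrightarrow> F w = 0"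
proof -
  define e where "e = \<epsilon> / 3"
  define a :: "complex^'n" where "a = axis i 1"
  have e: "0 < e" "2 * e < \<epsilon>"
    using \<epsilon> by (auto simp: e_def)
  have inb: "w + t *s a \<in> ball w0 \<epsilon>" if "w \<in> cball w0 e" "norm t \<le> e" for w t
  proof -
    have "dist w0 (w + t *s a) \<le> dist w0 w + norm (t *s a)"
      using dist_triangle[of w0 "w + t *s a" w] by (simp add: dist_norm)
    also have "\<dots> \<le> e + e"
      using that by (intro add_mono) (auto simp: norm_vector_scale a_def norm_axis_1)
    finally show ?thesis
      using e by simp
  qed
  define K where "K = sphere (0::complex) e \<times> (cball w0 e \<inter> {w. w $ i = 0})"
  have "closed {w::complex^'n. w $ i = 0}"
    by (intro closed_Collect_eq continuous_intros)
  then have "compact K"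
    unfolding K_def by (intro compact_Times compact_sphere compact_Int_closed compact_cball)
  moreover have contK: "continuous_on K (\<lambda>(t, w). norm (F (w + t *s a)))"
    unfolding case_prod_unfold
    by (intro continuous_intros continuous_on_compose2[OF holo_continuous[OF F]])
      (use inb in \<open>auto simp: K_def\<close>)
  moreover have "(of_real e, w0) \<in> K"
    using e w0 by (simp add: K_def)
  ultimately obtain k where k: "k \<in> K"
    "\<forall>x\<in>K. (case k of (t, w) \<Rightarrow> norm (F (w + t *s a))) \<le> (case x of (t, w) \<Rightarrow> norm (F (w + t *s a)))"
    using continuous_attains_inf[of K] by blast
  define c where "c = (case k of (t, w) \<Rightarrow> norm (F (w + t *s a)))"
  have "c > 0"
    using k(1) e nz inb by (auto simp: c_def K_def a_def axis_def split: prod.splits)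
  have c_le: "c \<le> norm (F (w + t *s a))" if "norm t = e" "w \<in> cball w0 e" "w $ i = 0" for t w
    using k(2) that by (auto simp: c_def K_def)
  have "isCont F w0"
    using holo_continuous[OF F] \<epsilon> by (simp add: continuous_on_eq_continuous_at)
  then obtain d where d: "d > 0" "\<And>w. dist w w0 < d \<Longrightarrow> norm (F w) < c"
    using \<open>c > 0\<close> w0 unfolding continuous_at_eps_delta by (metis dist_0_norm dist_commute)
  show thesis
  proof (rule that[of "min d e"])
    show "0 < min d e" "min d e \<le> \<epsilon>"
      using d e by auto
    show "\<forall>w\<in>ball w0 (min d e). w $ i = 0 \<longrightarrow> F w = 0"
    proof (intro ballI impI, rule ccontr)
      fix w assume w: "w \<in> ball w0 (min d e)" "w $ i = 0" and Fw: "F w \<noteq> 0"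
      have Fnz: "F (w + t *s a) \<noteq> 0" if "t \<in> cball 0 e" for t
        using nz[OF inb, of w t] that w Fw by (cases "t = 0") (auto simp: a_def axis_def)
      have hol: "(\<lambda>t. F (w + t *s a)) holomorphic_on cball 0 e"
        by (rule holo_line_holomorphic[OF F]) (use inb w in auto)
      have inv_hol: "(\<lambda>t. inverse (F (w + t *s a))) holomorphic_on cball 0 e"
        using hol Fnz by (intro holomorphic_intros) auto
      have "norm (inverse (F (w + 0 *s a))) \<le> inverse c"
      proof (rule maximum_modulus_frontier[where S = "cball 0 e" and f = "\<lambda>t. inverse (F (w + t *s a))"])
        show "(\<lambda>t. inverse (F (w + t *s a))) holomorphic_on interior (cball 0 e)"
          using inv_hol holomorphic_on_subset interior_subset by blast
        show "continuous_on (closure (cball 0 e)) (\<lambda>t. inverse (F (w + t *s a)))"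
          using inv_hol holomorphic_on_imp_continuous_on by simp
        show "norm (inverse (F (w + t *s a))) \<le> inverse c" if "t \<in> frontier (cball 0 e)" for t
        proof -
          have "norm t = e"
            using that e by (simp add: frontier_cball)
          from c_le[OF this, of w] w have "c \<le> norm (F (w + t *s a))"
            by simp
          then show ?thesis
            using \<open>c > 0\<close> by (simp add: norm_inverse le_imp_inverse_le)
        qed
      qed (use e in auto)
      then have "c \<le> norm (F w)"
        using \<open>c > 0\<close> Fw by (simp add: norm_inverse)
      with d(2)[of w] w show False
        by (simp add: dist_commute)
    qed
  qed
qed

text \<open>The inclusion \<open>{P = 0} \<subseteq> {\<rho> = 0}\<close> into a smooth hypersurface becomes an equality near \<open>q\<close>, as the zero set of one function cannot be smaller than a hypersurface.\<close>

lemma straightening_of_zero_set: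
  fixes P \<rho> :: "complex^'n \<Rightarrow> complex"
  assumes P: "holo_fun_on U P" and \<rho>: "holo_fun_on U \<rho>" and q: "q \<in> U" "P q = 0"
    and sub: "\<forall>z\<in>U. P z = 0 \<longrightarrow> \<rho> z = 0" and i: "cpartial i \<rho> q \<noteq> 0"
  obtains N \<epsilon> g where "N \<subseteq> U" "straightening \<rho> i q N \<epsilon> g" "\<forall>z\<in>N. P z = 0 \<longleftrightarrow> \<rho> z = 0"
proof -
  obtain N \<epsilon> g where N: "N \<subseteq> U" "straightening \<rho> i q N \<epsilon> g"
    by (rule exists_straightening[OF \<rho> q(1) i])
  define w0 where "w0 = replace_coord i \<rho> q"
  note st = N(2)[unfolded straightening_def, folded w0_def]
  have F: "holo_fun_on (ball w0 \<epsilon>) (\<lambda>w. P (g w))"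
    by (rule holo_compose[OF _ P]) (use st N in auto)
  have coord: "w $ i = \<rho> (g w)" if "w \<in> ball w0 \<epsilon>" for w
  proof -
    have "replace_coord i \<rho> (g w) = w"
      using st that by blast
    then show ?thesis
      using replace_coord_nth[of i \<rho> "g w"] by simp
  qed
  have gw0: "g w0 = q" "w0 \<in> ball w0 \<epsilon>"
    using st by (auto simp: w0_def)
  obtain \<delta> where \<delta>: "0 < \<delta>" "\<delta> \<le> \<epsilon>" "\<forall>w\<in>ball w0 \<delta>. w $ i = 0 \<longrightarrow> P (g w) = 0"
  proof (rule zero_on_hyperplane_of_zeros_within[OF F])
    show "w0 $ i = 0" "P (g w0) = 0"
      using coord[OF gw0(2)] gw0 q sub by auto
    show "P (g w) \<noteq> 0" if "w \<in> ball w0 \<epsilon>" "w $ i \<noteq> 0" for w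
    proof -
      have "g w \<in> U"
        using that(1) st N(1) by blast
      with that(2) coord[OF that(1)] sub show ?thesis
        by auto
    qed
  qed (use st in auto)
  show thesis
  proof (rule that[OF _ straightening_shrink[OF N(2) \<delta>(1,2)]])
    show "\<forall>z\<in>{z \<in> N. replace_coord i \<rho> z \<in> ball (replace_coord i \<rho> q) \<delta>}. P z = 0 \<longleftrightarrow> \<rho> z = 0"
    proof (intro ballI iffI)
      fix z assume z: "z \<in> {z \<in> N. replace_coord i \<rho> z \<in> ball (replace_coord i \<rho> q) \<delta>}"
      { assume "P z = 0" then show "\<rho> z = 0"
          using z sub N by auto }
      assume "\<rho> z = 0"
      then have "replace_coord i \<rho> z $ i = 0"
        by (simp add: replace_coord_def)
      then have "P (g (replace_coord i \<rho> z)) = 0"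
        using \<delta>(3) z by (simp add: w0_def)
      moreover have "g (replace_coord i \<rho> z) = z"
        using st z by blast
      ultimately show "P z = 0"
        by simp
    qed
  qed (use N in auto)
qed

text \<open>In the straightening coordinates \<open>h\<close> vanishes on a hyperplane, hence so do its derivatives along that hyperplane.\<close>

lemma gradient_of_function_vanishing_on_smooth_zero_set:
  fixes h \<rho> :: "complex^'n \<Rightarrow> complex"
  assumes st: "straightening \<rho> i q N \<epsilon> g" and \<rho>q: "\<rho> q = 0" and h: "holo_fun_on N h"
    and van: "\<forall>z\<in>N. \<rho> z = 0 \<longrightarrow> h z = 0" and v: "dir_deriv v \<rho> q = 0"
  shows "dir_deriv v h q = 0"
proof -
  define w0 where "w0 = replace_coord i \<rho> q"
  note st' = st[unfolded straightening_def, folded w0_def]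
  have q: "q \<in> N" and \<rho>: "holo_fun_on N \<rho>"
    using st' by auto
  have gw0: "w0 \<in> ball w0 \<epsilon>"
    using st' by auto
  have F: "holo_fun_on (ball w0 \<epsilon>) (\<lambda>w. h (g w))"
    by (rule holo_compose[OF _ h]) (use st' in auto)
  define u where "u = (\<chi> j. dir_deriv v (\<lambda>z. replace_coord i \<rho> z $ j) q)"
  have ui: "u $ i = 0"
    using v by (simp add: u_def replace_coord_def)
  have w0i: "w0 $ i = 0"
    using \<rho>q by (simp add: w0_def replace_coord_def)
  have zero: "h (g w) = 0" if "w \<in> ball w0 \<epsilon>" "w $ i = 0" for w
  proof -
    have "\<rho> (g w) = replace_coord i \<rho> (g w) $ i"
      by (simp add: replace_coord_def)
    also have "\<dots> = 0"
      using st' that by simp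
    finally show ?thesis
      using van st' that by blast
  qed
  have "dir_deriv u (\<lambda>w. h (g w)) w0 = 0"
    unfolding dir_deriv_def
  proof (rule DERIV_imp_deriv)
    have op: "open {t. w0 + t *s u \<in> ball w0 \<epsilon>}" and "0 \<in> {t. w0 + t *s u \<in> ball w0 \<epsilon>}"
      using gw0 open_line_preimage[OF open_ball] by auto
    then show "((\<lambda>t. h (g (w0 + t *s u))) has_field_derivative 0) (at 0)"
      by (intro has_field_derivative_transform_within_open[OF DERIV_const, where S = "{t. w0 + t *s u \<in> ball w0 \<epsilon>}"])
        (use zero ui w0i in auto)
  qed
  moreover have "dir_deriv v h q = dir_deriv u (\<lambda>w. h (g w)) w0"
  proof -
    have "((\<lambda>z. h (g (replace_coord i \<rho> z))) has_derivative
        (\<lambda>v. dir_deriv (\<chi> j. dir_deriv v (\<lambda>z. replace_coord i \<rho> z $ j) q) (\<lambda>w. h (g w)) w0)) (at q)"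
      using has_derivative_compose[OF holo_map_has_derivative[OF holo_replace_coord[OF \<rho>] q]
          holo_has_derivative_dir_deriv[OF F gw0, unfolded w0_def]]
      by (simp add: w0_def)
    then have D: "(h has_derivative
        (\<lambda>v. dir_deriv (\<chi> j. dir_deriv v (\<lambda>z. replace_coord i \<rho> z $ j) q) (\<lambda>w. h (g w)) w0)) (at q)"
      by (rule has_derivative_transform_within_open[OF _ holo_open[OF \<rho>] q]) (use st' in auto)
    show ?thesis
      unfolding u_def by (rule dir_deriv_unique[OF h q D])
  qed
  ultimately show ?thesis
    by simp
qed

section \<open>Charts of the Hopf manifold\<close>

text \<open>On such sets the projection to the Hopf manifold is injective, so that they serve as domains of charts.\<close>

definition wandering :: "complex \<Rightarrow> (complex^'n) set \<Rightarrow> bool" where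
  "wandering \<mu> N \<longleftrightarrow> open N \<and> N \<subseteq> punctured \<and> (\<forall>z\<in>N. \<forall>k. (\<mu> powi k) *s z \<in> N \<longrightarrow> k = 0)"

lemma Collect_shift_int: "{f (j + k) | j. True} = {f j | j::int. True}"
proof (intro equalityI subsetI)
  fix x assume "x \<in> {f j | j. True}"
  then obtain j where "x = f ((j - k) + k)"
    by auto
  then show "x \<in> {f (j + k) | j. True}"
    by blast
qed blast

lemma hopf_proj_powi:
  assumes "\<mu> \<noteq> 0"
  shows "hopf_proj \<mu> ((\<mu> powi k) *s z) = hopf_proj \<mu> z"
proof -
  have "(\<mu> powi j) *s ((\<mu> powi k) *s z) = (\<mu> powi (j + k)) *s z" for j
    using assms by (simp add: power_int_add vector_smult_assoc)
  then have "hopf_proj \<mu> ((\<mu> powi k) *s z) = {(\<mu> powi (j + k)) *s z | j. True}"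
    by (simp only: hopf_proj_def)
  also have "\<dots> = hopf_proj \<mu> z"
    unfolding hopf_proj_def by (rule Collect_shift_int)
  finally show ?thesis .
qed

lemma mem_hopf_proj_self: "z \<in> hopf_proj \<mu> z"
  unfolding hopf_proj_def by (rule CollectI, rule exI[of _ 0]) simp

lemma hopf_proj_eqD:
  assumes "hopf_proj \<mu> w = hopf_proj \<mu> z"
  obtains k where "w = (\<mu> powi k) *s z"
proof -
  have "w \<in> hopf_proj \<mu> z"
    using mem_hopf_proj_self[of w \<mu>] assms by simp
  then show thesis
    using that by (auto simp: hopf_proj_def)
qed

lemma wandering_subset: "wandering \<mu> N \<Longrightarrow> open V \<Longrightarrow> V \<subseteq> N \<Longrightarrow> wandering \<mu> V"
  unfolding wandering_def by (meson subset_iff order_trans)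

text \<open>A function that scales like a norm distinguishes a point from its translates once its values on \<open>N\<close> lie in an interval \<open>(a, b)\<close> with \<open>norm \<mu> * b \<le> a\<close>. Besides the norm this is used for the modulus of one coordinate.\<close>

lemma wanderingI:
  assumes \<mu>: "0 < norm \<mu>" "norm \<mu> < 1" and N: "open N" "N \<subseteq> punctured"
    and f: "\<And>z c. f (c *s z) = norm c * f z" and ab: "norm \<mu> * b \<le> a"
    and range: "\<And>z. z \<in> N \<Longrightarrow> 0 < f z \<and> a < f z \<and> f z < (b::real)"
  shows "wandering \<mu> N"
  unfolding wandering_def
proof (intro conjI N ballI allI impI)
  fix z k assume z: "z \<in> N" "(\<mu> powi k) *s z \<in> N"
  have le: "norm \<mu> powi k \<le> norm \<mu>" if "k \<ge> 1" for k :: int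
    using power_int_decreasing[of 1 k "norm \<mu>"] that \<mu> by simp
  have no: "\<not> 1 \<le> k" if "x \<in> N" "y \<in> N" "f y = norm \<mu> powi k * f x" for x y and k :: int
  proof
    assume "1 \<le> k"
    then have "f y \<le> norm \<mu> * f x"
      using le[of k] range[OF that(1)] that(3) by (simp add: mult_right_mono)
    also have "\<dots> < norm \<mu> * b"
      using range[OF that(1)] \<mu> by simp
    finally show False
      using range[OF that(2)] ab by simp
  qed
  have fz: "f ((\<mu> powi k) *s z) = norm \<mu> powi k * f z"
    by (simp add: f norm_power_int)
  then have "f z = norm \<mu> powi (- k) * f ((\<mu> powi k) *s z)"
    using \<mu> by (simp add: power_int_minus)
  from no[OF z fz] no[OF z(2,1) this] show "k = 0"
    by linarith
qed

lemma exists_wandering: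
  assumes \<mu>: "0 < norm \<mu>" "norm \<mu> < 1" and z: "z \<noteq> (0::complex^'n)"
  obtains N where "wandering \<mu> N" "z \<in> N"
proof -
  \<comment> \<open>The norms in \<open>N\<close> range between \<open>s * norm z\<close> and \<open>norm z / s\<close>, whose ratio is exactly \<open>norm \<mu>\<close>.\<close>
  define s where "s = sqrt (norm \<mu>)"
  have s: "0 < s" "s < 1" "s * s = norm \<mu>"
    using \<mu> by (auto simp: s_def)
  define N where "N = {x::complex^'n. s * norm z < norm x \<and> norm x < norm z / s}"
  have "open N"
    unfolding N_def by (intro open_Collect_conj open_Collect_less continuous_intros)
  have pos: "0 < norm x" if "x \<in> N" for x
  proof -
    have "0 < s * norm z"
      using s(1) z by simp
    also have "s * norm z < norm x"
      using that by (simp add: N_def)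
    finally show ?thesis .
  qed
  then have "N \<subseteq> punctured"
    by fastforce
  with \<open>open N\<close> have "wandering \<mu> N"
  proof (intro wanderingI[OF \<mu>, where f = norm and a = "s * norm z" and b = "norm z / s"])
    show "norm \<mu> * (norm z / s) \<le> s * norm z"
      using s(1) by (simp add: s(3)[symmetric])
    show "0 < norm x \<and> s * norm z < norm x \<and> norm x < norm z / s" if "x \<in> N" for x
      using pos[OF that] that by (simp add: N_def)
  qed (simp_all add: norm_vector_scale)
  moreover have "z \<in> N"
  proof -
    have "s * norm z < 1 * norm z"
      using s z by (intro mult_strict_right_mono) auto
    then show ?thesis
      using s(1) by (simp add: N_def pos_less_divide_eq mult.commute)
  qed
  ultimately show thesis
    by (rule that)
qed

lemma inj_on_hopf_proj:
  assumes "\<mu> \<noteq> 0" "wandering \<mu> N"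
  shows "inj_on (hopf_proj \<mu>) N"
proof
  fix w z assume wz: "w \<in> N" "z \<in> N" "hopf_proj \<mu> w = hopf_proj \<mu> z"
  from wz(3) obtain k where k: "w = (\<mu> powi k) *s z"
    by (rule hopf_proj_eqD)
  with assms(2) wz have "k = 0"
    unfolding wandering_def by blast
  with k show "w = z"
    by simp
qed

definition hopf_lift :: "complex \<Rightarrow> (complex^'n) set \<Rightarrow> (complex^'n) set \<Rightarrow> complex^'n" where
  "hopf_lift \<mu> N = inv_into N (hopf_proj \<mu>)"

lemma hopf_lift_proj:
  assumes "\<mu> \<noteq> 0" "wandering \<mu> N" "z \<in> N"
  shows "hopf_lift \<mu> N (hopf_proj \<mu> z) = z"
  unfolding hopf_lift_def using inj_on_hopf_proj[OF assms(1,2)] assms(3) by simp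

lemma hopf_preimage_image:
  assumes "\<mu> \<noteq> 0" "N \<subseteq> punctured"
  shows "hopf_preimage \<mu> (hopf_proj \<mu> ` N) = (\<Union>k. {z. (\<mu> powi k) *s z \<in> N})"
proof (intro equalityI subsetI)
  fix z assume "z \<in> hopf_preimage \<mu> (hopf_proj \<mu> ` N)"
  then obtain w where w: "w \<in> N" "hopf_proj \<mu> w = hopf_proj \<mu> z"
    by (auto simp: hopf_preimage_def)
  from hopf_proj_eqD[OF w(2)] w(1) show "z \<in> (\<Union>k. {z. (\<mu> powi k) *s z \<in> N})"
    by auto
next
  fix z assume "z \<in> (\<Union>k. {z. (\<mu> powi k) *s z \<in> N})"
  then obtain k where k: "(\<mu> powi k) *s z \<in> N"
    by auto
  then have "z \<noteq> 0"
    using assms(2) by auto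
  then show "z \<in> hopf_preimage \<mu> (hopf_proj \<mu> ` N)"
    using imageI[OF k, of "hopf_proj \<mu>"] hopf_proj_powi[OF assms(1), of k z]
    by (simp add: hopf_preimage_def)
qed

lemma open_scale_preimage: "open N \<Longrightarrow> open {z::complex^'n. c *s z \<in> N}"
proof -
  assume "open N"
  then have "open ((\<lambda>z. c *s z) -` N)"
    by (rule open_vimage) (intro continuous_intros)
  then show ?thesis
    by (simp add: vimage_def)
qed

lemma openin_hopf_image:
  assumes "\<mu> \<noteq> 0" "open N" "N \<subseteq> punctured"
  shows "openin (hopf_topology \<mu>) (hopf_proj \<mu> ` N)"
  unfolding openin_hopf_topology hopf_preimage_image[OF assms(1,3)]
  using assms by (auto simp: hopf_def intro!: open_scale_preimage)

lemma hopf_lift_scale: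
  assumes "\<mu> \<noteq> 0" "wandering \<mu> N" "(\<mu> powi k) *s z \<in> N"
  shows "hopf_lift \<mu> N (hopf_proj \<mu> z) = (\<mu> powi k) *s z"
  using hopf_lift_proj[OF assms] unfolding hopf_proj_powi[OF assms(1)] .

lemma hopf_holo_on_lift:
  assumes \<mu>: "\<mu> \<noteq> 0" and N: "wandering \<mu> N" and F: "holo_fun_on N F"
  shows "hopf_holo_on \<mu> (hopf_proj \<mu> ` N) (\<lambda>x. F (hopf_lift \<mu> N x))"
proof -
  have Np: "open N" "N \<subseteq> punctured"
    using N by (auto simp: wandering_def)
  have "holo_fun_on (hopf_preimage \<mu> (hopf_proj \<mu> ` N)) ((\<lambda>x. F (hopf_lift \<mu> N x)) \<circ> hopf_proj \<mu>)"
    unfolding hopf_preimage_image[OF \<mu> Np(2)]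
  proof (rule holo_local)
    show "open (\<Union>k. {z. (\<mu> powi k) *s z \<in> N})"
      by (intro open_UN ballI open_scale_preimage Np)
    fix z assume "z \<in> (\<Union>k. {z. (\<mu> powi k) *s z \<in> N})"
    then obtain k where k: "(\<mu> powi k) *s z \<in> N"
      by auto
    have "holo_fun_on {z. (\<mu> powi k) *s z \<in> N} (\<lambda>z. F ((\<mu> powi k) *s z))"
      by (rule holo_compose[OF holo_map_scale[OF open_scale_preimage[OF Np(1)]] F]) auto
    then have "holo_fun_on {z. (\<mu> powi k) *s z \<in> N} ((\<lambda>x. F (hopf_lift \<mu> N x)) \<circ> hopf_proj \<mu>)"
    proof (rule holo_cong)
      fix x assume "x \<in> {z. (\<mu> powi k) *s z \<in> N}"
      then have "(\<mu> powi k) *s x \<in> N"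
        by simp
      from hopf_lift_scale[OF \<mu> N this]
      show "F ((\<mu> powi k) *s x) = ((\<lambda>x. F (hopf_lift \<mu> N x)) \<circ> hopf_proj \<mu>) x"
        by simp
    qed
    with k show "\<exists>V. z \<in> V \<and> holo_fun_on V ((\<lambda>x. F (hopf_lift \<mu> N x)) \<circ> hopf_proj \<mu>)"
      by (intro exI[of _ "{z. (\<mu> powi k) *s z \<in> N}"]) simp
  qed
  then show ?thesis
    unfolding hopf_holo_on_def using openin_hopf_image[OF \<mu> Np] by blast
qed

lemma holo_map_cong:
  fixes g h :: "complex^'n \<Rightarrow> complex^'m"
  assumes g: "holo_map_on U g" and eq: "\<And>z. z \<in> U \<Longrightarrow> g z = h z"
  shows "holo_map_on U h"
  unfolding holo_map_on_def
proof
  fix i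
  have gi: "holo_fun_on U (\<lambda>z. g z $ i)"
    using g unfolding holo_map_on_def by blast
  show "holo_fun_on U (\<lambda>z. h z $ i)"
  proof (rule holo_cong[OF gi])
    fix z assume "z \<in> U"
    from eq[OF this] show "g z $ i = h z $ i"
      by (rule arg_cong)
  qed
qed

text \<open>The requirement on a chart concerns all points over its domain; near a point of the translate of \<open>N\<close> by \<open>\<mu> powi (-k)\<close> the chart is \<open>\<Phi>\<close> composed with multiplication by \<open>\<mu> powi k\<close>.\<close>

lemma hopf_chart_lift:
  fixes \<Phi> g :: "complex^'n \<Rightarrow> complex^'n"
  assumes \<mu>: "\<mu> \<noteq> 0" and N: "wandering \<mu> N"
    and \<Phi>: "holo_map_on N \<Phi>" and g: "holo_map_on V g"
    and img: "\<Phi> ` N = V" and inv: "\<And>z. z \<in> N \<Longrightarrow> g (\<Phi> z) = z"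
  shows "hopf_chart \<mu> (hopf_proj \<mu> ` N) (\<lambda>x. \<Phi> (hopf_lift \<mu> N x))"
proof -
  have Np: "open N" "N \<subseteq> punctured"
    using N by (auto simp: wandering_def)
  have inj: "inj_on \<Phi> N"
    by (rule inj_on_inverseI[of _ g]) (rule inv)
  define \<phi> where "\<phi> = (\<lambda>x. \<Phi> (hopf_lift \<mu> N x))"
  have \<phi>: "\<phi> (hopf_proj \<mu> z) = \<Phi> ((\<mu> powi k) *s z)" if "(\<mu> powi k) *s z \<in> N" for k z
    unfolding \<phi>_def hopf_lift_scale[OF \<mu> N that] ..
  have "inj_on \<phi> (hopf_proj \<mu> ` N)"
  proof
    fix x y assume "x \<in> hopf_proj \<mu> ` N" "y \<in> hopf_proj \<mu> ` N" and xy: "\<phi> x = \<phi> y"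
    then obtain z w where z: "z \<in> N" "x = hopf_proj \<mu> z" and w: "w \<in> N" "y = hopf_proj \<mu> w"
      by blast
    have "\<Phi> z = \<Phi> w"
      using xy z w by (simp add: \<phi>_def hopf_lift_proj[OF \<mu> N])
    with inj z w show "x = y"
      by (simp add: inj_on_eq_iff)
  qed
  moreover have "\<exists>W. z \<in> W \<and> W \<subseteq> hopf_preimage \<mu> (hopf_proj \<mu> ` N) \<and>
      biholomorphic_betw (\<phi> \<circ> hopf_proj \<mu>) W ((\<phi> \<circ> hopf_proj \<mu>) ` W)"
    if z: "z \<in> hopf_preimage \<mu> (hopf_proj \<mu> ` N)" for z
  proof -
    obtain k where k: "(\<mu> powi k) *s z \<in> N"
      using z unfolding hopf_preimage_image[OF \<mu> Np(2)] by auto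
    define W where "W = {z. (\<mu> powi k) *s z \<in> N}"
    define \<psi> where "\<psi> = \<phi> \<circ> hopf_proj \<mu>"
    have \<psi>: "\<psi> x = \<Phi> ((\<mu> powi k) *s x)" if "x \<in> W" for x
      using \<phi>[of k x] that by (simp add: \<psi>_def W_def)
    have inv\<psi>: "(\<mu> powi (-k)) *s g (\<psi> x) = x" if "x \<in> W" for x
    proof -
      have "g (\<psi> x) = (\<mu> powi k) *s x"
        unfolding \<psi>[OF that] by (rule inv) (use that in \<open>simp add: W_def\<close>)
      then show ?thesis
        using \<mu> by (simp add: power_int_minus vector_smult_assoc)
    qed
    have injW: "inj_on \<psi> W"
      by (rule inj_on_inverseI[of _ "\<lambda>y. (\<mu> powi (-k)) *s g y"]) (rule inv\<psi>)
    have imgW: "\<psi> ` W = V"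
    proof -
      have "(\<lambda>x. (\<mu> powi k) *s x) ` W = N"
      proof (intro equalityI subsetI)
        fix y assume "y \<in> N"
        then show "y \<in> (\<lambda>x. (\<mu> powi k) *s x) ` W"
          using \<mu> by (intro image_eqI[of _ _ "(\<mu> powi (-k)) *s y"]) (simp_all add: W_def power_int_minus vector_smult_assoc)
      qed (auto simp: W_def)
      then have "\<Phi> ` (\<lambda>x. (\<mu> powi k) *s x) ` W = V"
        using img by simp
      moreover have "\<psi> ` W = \<Phi> ` (\<lambda>x. (\<mu> powi k) *s x) ` W"
        unfolding image_image by (rule image_cong[OF refl \<psi>])
      ultimately show ?thesis
        by simp
    qed
    have hW: "holo_map_on W (\<lambda>x. (\<mu> powi k) *s x)"
      unfolding W_def by (rule holo_map_scale[OF open_scale_preimage[OF Np(1)]])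
    have "holo_map_on W (\<lambda>x. \<Phi> ((\<mu> powi k) *s x))"
      by (rule holo_map_compose[OF hW \<Phi>]) (auto simp: W_def)
    then have h1: "holo_map_on W \<psi>"
      by (rule holo_map_cong) (simp add: \<psi>)
    have "holo_map_on V (\<lambda>y. (\<mu> powi (-k)) *s g y)"
      by (rule holo_map_compose[OF g holo_map_scale[OF open_UNIV]]) auto
    then have h2: "holo_map_on V (inv_into W \<psi>)"
    proof (rule holo_map_cong)
      fix y assume "y \<in> V"
      then obtain x where x: "x \<in> W" "y = \<psi> x"
        using imgW by auto
      then show "(\<mu> powi (-k)) *s g y = inv_into W \<psi> y"
        using inv\<psi>[OF x(1)] injW by simp
    qed
    have "biholomorphic_betw \<psi> W (\<psi> ` W)"
      unfolding biholomorphic_betw_def imgW using h1 h2 imgW injW by (simp add: bij_betw_def)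
    moreover have "z \<in> W" "W \<subseteq> hopf_preimage \<mu> (hopf_proj \<mu> ` N)"
      using k unfolding W_def hopf_preimage_image[OF \<mu> Np(2)] by (simp, intro UN_upper UNIV_I)
    ultimately show ?thesis
      unfolding \<psi>_def by (intro exI[of _ W] conjI)
  qed
  ultimately have "hopf_chart \<mu> (hopf_proj \<mu> ` N) \<phi>"
    unfolding hopf_chart_def by (intro conjI ballI openin_hopf_image[OF \<mu> Np])
  then show ?thesis
    by (simp add: \<phi>_def)
qed

section \<open>The hypersurface defined by a homogeneous function\<close>

definition zero_locus :: "complex \<Rightarrow> (complex^'n \<Rightarrow> complex) \<Rightarrow> (complex^'n) set set" where
  "zero_locus \<mu> P = hopf_proj \<mu> ` {z \<in> punctured. P z = 0}"

lemma homogeneous_zero_scale: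
  assumes "homogeneous_on_punctured e P" "z \<noteq> 0" "c \<noteq> 0"
  shows "P (c *s z) = 0 \<longleftrightarrow> P z = 0"
  using assms by (simp add: homogeneous_on_punctured_def)

lemma hopf_proj_mem_zero_locus:
  assumes "\<mu> \<noteq> 0" "homogeneous_on_punctured e P" "z \<noteq> 0"
  shows "hopf_proj \<mu> z \<in> zero_locus \<mu> P \<longleftrightarrow> P z = 0"
proof
  assume "hopf_proj \<mu> z \<in> zero_locus \<mu> P"
  then obtain w where w: "w \<noteq> 0" "P w = 0" "hopf_proj \<mu> z = hopf_proj \<mu> w"
    by (auto simp: zero_locus_def)
  from hopf_proj_eqD[OF w(3)] obtain k where "z = (\<mu> powi k) *s w" .
  then show "P z = 0"
    using homogeneous_zero_scale[OF assms(2) w(1)] w(2) assms(1) by simp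
qed (use assms in \<open>auto simp: zero_locus_def\<close>)

lemma hopf_preimage_zero_locus:
  assumes "\<mu> \<noteq> 0" "homogeneous_on_punctured e P"
  shows "hopf_preimage \<mu> (zero_locus \<mu> P) = {z \<in> punctured. P z = 0}"
  using hopf_proj_mem_zero_locus[OF assms] by (auto simp: hopf_preimage_def)

text \<open>As a section of a line bundle, \<open>P\<close> is not a function on the Hopf manifold; on the image of a wandering set it is represented by its values on that set.\<close>

lemma zero_locus_analytic:
  fixes P :: "complex^'n \<Rightarrow> complex"
  assumes \<mu>: "0 < norm \<mu>" "norm \<mu> < 1" and P: "holo_fun_on punctured P"
    and hom: "homogeneous_on_punctured e P"
  shows "analytic_subset \<mu> (zero_locus \<mu> P)"
  unfolding analytic_subset_def
proof (intro conjI ballI)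
  have \<mu>0: "\<mu> \<noteq> 0"
    using \<mu> by auto
  note mem = hopf_proj_mem_zero_locus[OF \<mu>0 hom]
  have "hopf_preimage \<mu> (hopf \<mu> - zero_locus \<mu> P) = {z \<in> punctured. P z \<noteq> 0}"
    using mem by (auto simp: hopf_preimage_def hopf_def)
  also have "\<dots> = punctured \<inter> P -` (- {0})"
    by auto
  finally have "open (hopf_preimage \<mu> (hopf \<mu> - zero_locus \<mu> P))"
    using continuous_open_preimage[OF holo_continuous[OF P] open_punctured, of "- {0}"] by (simp add: open_Compl)
  then show "closedin (hopf_topology \<mu>) (zero_locus \<mu> P)"
    unfolding closedin_def topspace_hopf_topology openin_hopf_topology
    by (auto simp: zero_locus_def hopf_def)
  fix x :: "(complex^'n) set" assume "x \<in> hopf \<mu>"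
  then obtain z where z: "z \<noteq> 0" "x = hopf_proj \<mu> z"
    by (auto simp: hopf_def)
  obtain N where N: "wandering \<mu> N" "z \<in> N"
    by (rule exists_wandering[OF \<mu> z(1)])
  have Np: "open N" "N \<subseteq> punctured"
    using N by (auto simp: wandering_def)
  have "zero_locus \<mu> P \<inter> hopf_proj \<mu> ` N =
      {y \<in> hopf_proj \<mu> ` N. \<forall>g\<in>{\<lambda>x. P (hopf_lift \<mu> N x)}. g y = 0}"
  proof -
    have "x \<noteq> 0" if "x \<in> N" for x
      using Np(2) that by auto
    then show ?thesis
      using mem by (auto simp: hopf_lift_proj[OF \<mu>0 N(1)])
  qed
  moreover have "\<forall>g\<in>{\<lambda>x. P (hopf_lift \<mu> N x)}. hopf_holo_on \<mu> (hopf_proj \<mu> ` N) g"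
    using hopf_holo_on_lift[OF \<mu>0 N(1) holo_subset[OF P Np]] by simp
  ultimately show "\<exists>U G. openin (hopf_topology \<mu>) U \<and> x \<in> U \<and> finite G \<and>
        (\<forall>g\<in>G. hopf_holo_on \<mu> U g) \<and> zero_locus \<mu> P \<inter> U = {y\<in>U. \<forall>g\<in>G. g y = 0}"
    using openin_hopf_image[OF \<mu>0 Np] N(2) z(2)
    by (intro exI[of _ "hopf_proj \<mu> ` N"] exI[of _ "{\<lambda>x. P (hopf_lift \<mu> N x)}"]) auto
qed

lemma regular_point_of_straightening:
  fixes P :: "complex^'n \<Rightarrow> complex"
  assumes \<mu>: "\<mu> \<noteq> 0" and hom: "homogeneous_on_punctured e P"
    and N: "wandering \<mu> N" and st: "straightening \<rho> i q N \<epsilon> g"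
    and eq: "\<forall>z\<in>N. P z = 0 \<longleftrightarrow> \<rho> z = 0" and q: "P q = 0"
  shows "regular_point \<mu> (zero_locus \<mu> P) (CARD('n) - 1) (hopf_proj \<mu> q)"
proof -
  note st' = st[unfolded straightening_def]
  have Np: "N \<subseteq> punctured" and qN: "q \<in> N"
    using N st' by (auto simp: wandering_def)
  note mem = hopf_proj_mem_zero_locus[OF \<mu> hom]
  define \<phi> where "\<phi> = (\<lambda>x. replace_coord i \<rho> (hopf_lift \<mu> N x))"
  have chart: "hopf_chart \<mu> (hopf_proj \<mu> ` N) \<phi>"
    unfolding \<phi>_def
  proof (rule hopf_chart_lift[OF \<mu> N])
    show "holo_map_on N (replace_coord i \<rho>)"
      using st' by (intro holo_replace_coord) blast
    show "holo_map_on (ball (replace_coord i \<rho> q) \<epsilon>) g"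
      using st' by blast
    show "replace_coord i \<rho> ` N = ball (replace_coord i \<rho> q) \<epsilon>"
    proof (intro equalityI subsetI)
      fix w assume "w \<in> ball (replace_coord i \<rho> q) \<epsilon>"
      then have "g w \<in> N" "replace_coord i \<rho> (g w) = w"
        using st' by blast+
      then show "w \<in> replace_coord i \<rho> ` N"
        by (metis image_eqI)
    qed (use st' in blast)
    show "g (replace_coord i \<rho> z) = z" if "z \<in> N" for z
      using st' that by blast
  qed
  have \<phi>: "\<phi> (hopf_proj \<mu> z) = replace_coord i \<rho> z" if "z \<in> N" for z
    using that by (simp add: \<phi>_def hopf_lift_proj[OF \<mu> N])
  have mem': "hopf_proj \<mu> z \<in> zero_locus \<mu> P \<longleftrightarrow> \<phi> (hopf_proj \<mu> z) $ i = 0" if "z \<in> N" for z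
    using that Np eq mem[of z] \<phi>[OF that] by (auto simp: replace_coord_nth)
  have "\<phi> ` (zero_locus \<mu> P \<inter> hopf_proj \<mu> ` N) = {w \<in> \<phi> ` hopf_proj \<mu> ` N. \<forall>j\<in>{i}. w $ j = 0}"
    using mem' by auto
  moreover have "card {i} + (CARD('n) - 1) = CARD('n)"
    using zero_less_card_finite[where 'a = 'n] by simp
  moreover have "hopf_proj \<mu> q \<in> zero_locus \<mu> P"
    using mem[of q] q Np qN by auto
  ultimately show ?thesis
    unfolding regular_point_def using chart qN by blast
qed

text \<open>Regular points of dimension \<open>n - 1\<close> exist arbitrarily close to every point of the locus, namely the points of least
  multiplicity. A regular point of dimension \<open>n\<close> would make \<open>P\<close> vanish on an open set.\<close>

lemma zero_locus_hypersurface: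
  fixes P :: "complex^'n \<Rightarrow> complex"
  assumes \<mu>: "0 < norm \<mu>" "norm \<mu> < 1" and P: "holo_fun_on punctured P"
    and hom: "homogeneous_on_punctured e P"
    and nz: "\<exists>z. z \<noteq> 0 \<and> P z \<noteq> 0" and zero: "\<exists>z. z \<noteq> 0 \<and> P z = 0"
  shows "analytic_hypersurface \<mu> (zero_locus \<mu> P)"
  unfolding analytic_hypersurface_def
proof (intro conjI ballI)
  have \<mu>0: "\<mu> \<noteq> 0"
    using \<mu> by auto
  have dense: "\<exists>z\<in>V. P z \<noteq> 0" if V: "open V" "V \<noteq> {}" "V \<subseteq> punctured" for V
    using homogeneous_identity[OF P hom V(1) _ V(3)] V(2) nz by blast
  show "zero_locus \<mu> P \<noteq> {}"
    using zero by (auto simp: zero_locus_def)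
  show "analytic_subset \<mu> (zero_locus \<mu> P)"
    by (rule zero_locus_analytic[OF \<mu> P hom])
  fix x assume "x \<in> zero_locus \<mu> P"
  then obtain z where z: "z \<noteq> 0" "P z = 0" "x = hopf_proj \<mu> z"
    by (auto simp: zero_locus_def)
  define S where "S = {k. \<forall>U. openin (hopf_topology \<mu>) U \<and> x \<in> U \<longrightarrow>
    (\<exists>y\<in>U. regular_point \<mu> (zero_locus \<mu> P) k y)}"
  have upper: "k \<le> CARD('n) - 1" if "k \<in> S" for k
  proof (rule ccontr)
    assume big: "\<not> k \<le> CARD('n) - 1"
    have "openin (hopf_topology \<mu>) (hopf \<mu> :: (complex^'n) set set)" "x \<in> hopf \<mu>"
      using openin_topspace[of "hopf_topology \<mu>"] z by (auto simp: topspace_hopf_topology hopf_def)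
    with \<open>k \<in> S\<close> have "\<exists>y\<in>hopf \<mu>. regular_point \<mu> (zero_locus \<mu> P) k y"
      unfolding S_def by simp
    then obtain y where "regular_point \<mu> (zero_locus \<mu> P) k y"
      by blast
    then obtain U I and \<phi> :: "(complex^'n) set \<Rightarrow> complex^'n" where y: "y \<in> zero_locus \<mu> P" "y \<in> U"
      and chart: "hopf_chart \<mu> U \<phi>" and I: "card I + k = CARD('n)"
      and \<phi>: "\<phi> ` (zero_locus \<mu> P \<inter> U) = {w \<in> \<phi> ` U. \<forall>i\<in>I. w $ i = 0}"
      unfolding regular_point_def by (elim conjE exE) (rule that)
    have "card I = 0"
      using I big by linarith
    then have "I = {}"
      by simp
    with \<phi> have "\<phi> ` (zero_locus \<mu> P \<inter> U) = \<phi> ` U"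
      by auto
    moreover have "inj_on \<phi> U"
      using chart by (simp add: hopf_chart_def)
    ultimately have UZ: "U \<subseteq> zero_locus \<mu> P"
      by (metis inf_le1 inf_le2 inj_on_image_eq_iff order_refl)
    have "open (hopf_preimage \<mu> U)"
      using chart by (simp add: hopf_chart_def openin_hopf_topology)
    moreover have "hopf_preimage \<mu> U \<noteq> {}"
      using y by (auto simp: hopf_preimage_def zero_locus_def)
    ultimately obtain w where w: "w \<in> hopf_preimage \<mu> U" "P w \<noteq> 0"
      using dense[of "hopf_preimage \<mu> U"] by (auto simp: hopf_preimage_def)
    then show False
      using UZ hopf_proj_mem_zero_locus[OF \<mu>0 hom, of w] by (auto simp: hopf_preimage_def)
  qed
  have "CARD('n) - 1 \<in> S"
    unfolding S_def
  proof (rule CollectI, intro allI impI)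
    fix U assume U: "openin (hopf_topology \<mu>) U \<and> x \<in> U"
    obtain N where N: "wandering \<mu> N" "z \<in> N"
      by (rule exists_wandering[OF \<mu> z(1)])
    define O' where "O' = hopf_preimage \<mu> U \<inter> N"
    have O': "open O'" "O' \<subseteq> punctured" "z \<in> O'" "O' \<subseteq> N" "O' \<subseteq> hopf_preimage \<mu> U"
      using U N z by (auto simp: O'_def openin_hopf_topology wandering_def hopf_preimage_def)
    have PO: "holo_fun_on O' P"
      by (rule holo_subset[OF P O'(1,2)])
    obtain q l i where q: "q \<in> O'" "P q = 0" "\<forall>z\<in>O'. P z = 0 \<longrightarrow> iter_deriv l P z = 0"
      "\<forall>l'. length l' \<le> length l \<longrightarrow> iter_deriv l' P q = 0" "cpartial i (iter_deriv l P) q \<noteq> 0"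
      by (rule least_multiplicity_point[OF PO O'(3) z(2)]) (use dense O' in blast)
    obtain M \<epsilon> g where M: "M \<subseteq> O'" "straightening (iter_deriv l P) i q M \<epsilon> g"
      "\<forall>z\<in>M. P z = 0 \<longleftrightarrow> iter_deriv l P z = 0"
      by (rule straightening_of_zero_set[OF PO holo_iter_deriv[OF PO] q(1,2,3,5)])
    have "open M"
      using M(2) by (simp add: straightening_def)
    then have "wandering \<mu> M"
      using wandering_subset[OF N(1)] M(1) O' by blast
    from regular_point_of_straightening[OF \<mu>0 hom this M(2,3) q(2)]
    show "\<exists>y\<in>U. regular_point \<mu> (zero_locus \<mu> P) (CARD('n) - 1) y"
      using q(1) O'(5) by (auto simp: hopf_preimage_def)
  qed
  moreover have "finite S"
    using upper by (auto intro: finite_subset[of S "{..CARD('n) - 1}"])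
  ultimately have "analytic_dim \<mu> (zero_locus \<mu> P) x = CARD('n) - 1"
    unfolding analytic_dim_def S_def[symmetric] using upper by (intro Max_eqI) auto
  then show "analytic_dim \<mu> (zero_locus \<mu> P) x + 1 = CARD('n)"
    using zero_less_card_finite[where 'a = 'n] by simp
qed

section \<open>Invariance\<close>

lemma cgrad_nth: "cgrad h z $ i = cpartial i h z"
  by (simp add: cgrad_def)

text \<open>Apply the derivative \<open>iter_deriv l\<close> to the components of \<open>P d\<omega> = dP \<and> \<omega>\<close>. All derivatives of \<open>P\<close> up to the order of
  \<open>l\<close> vanish at \<open>q\<close>, so the left side disappears, and on the right side only the terms survive in which all
  derivatives fall on \<open>dP\<close>.\<close>

lemma gradient_parallel_to_form:
  fixes \<omega> :: "complex^'n \<Rightarrow> complex^'n"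
  defines "P \<equiv> radial_contraction \<omega>"
  assumes hol: "holo_map_on punctured \<omega>"
    and hom: "\<And>i. homogeneous_on_punctured d (\<lambda>z. \<omega> z $ i)"
    and int: "integrable_on_set punctured \<omega>" and q: "q \<noteq> 0"
    and van: "\<forall>l'. length l' \<le> length l \<longrightarrow> iter_deriv l' P q = 0"
  shows "cpartial j (iter_deriv l P) q * \<omega> q $ k = cpartial k (iter_deriv l P) q * \<omega> q $ j"
proof -
  have P: "holo_fun_on punctured P"
    unfolding P_def by (rule holo_radial_contraction[OF hol])
  have hi: "holo_fun_on punctured (\<lambda>z. \<omega> z $ i)" for i
    using hol by (simp add: holo_map_on_def)
  have qp: "q \<in> punctured"
    using q by simp
  have dP: "holo_fun_on punctured (cpartial i P)" for i
    unfolding cpartial_eq_dir_deriv by (rule holo_dir_deriv[OF P])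
  have \<Omega>: "holo_fun_on punctured (\<lambda>z. ext_deriv \<omega> z j k)"
  proof -
    have "holo_fun_on punctured (\<lambda>z. cpartial j (\<lambda>w. \<omega> w $ k) z + (- 1) * cpartial k (\<lambda>w. \<omega> w $ j) z)"
      unfolding cpartial_eq_dir_deriv
      by (intro holo_add holo_mult holo_const holo_dir_deriv hi open_punctured)
    then show ?thesis
      by (simp add: ext_deriv_def)
  qed
  have lead: "iter_deriv l (\<lambda>z. cpartial i P z * \<omega> z $ m) q = cpartial i (iter_deriv l P) q * \<omega> q $ m" for i m
  proof -
    have "iter_deriv l (\<lambda>z. cpartial i P z * \<omega> z $ m) q = iter_deriv l (cpartial i P) q * \<omega> q $ m"
    proof (rule iter_deriv_mult_leading[OF dP hi qp])
      show "iter_deriv l' (cpartial i P) q = 0" if "length l' < length l" for l'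
        using van[rule_format, of "l' @ [axis i 1]"] that by (simp add: cpartial_eq_dir_deriv)
    qed
    then show ?thesis
      by (simp add: cpartial_eq_dir_deriv dir_deriv_iter_deriv_commute[OF P qp])
  qed
  have "iter_deriv l (\<lambda>z. cpartial j P z * \<omega> z $ k) q =
      iter_deriv l (\<lambda>z. P z * ext_deriv \<omega> z j k + cpartial k P z * \<omega> z $ j) q"
  proof (rule iter_deriv_cong[OF open_punctured _ qp])
    fix z :: "complex^'n" assume "z \<in> punctured"
    then show "cpartial j P z * \<omega> z $ k = P z * ext_deriv \<omega> z j k + cpartial k P z * \<omega> z $ j"
      unfolding P_def using integrating_factor_identity[OF hol hom int, of z j k] by simp
  qed
  also have "\<dots> = iter_deriv l (\<lambda>z. P z * ext_deriv \<omega> z j k) q + iter_deriv l (\<lambda>z. cpartial k P z * \<omega> z $ j) q"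
    by (rule iter_deriv_add[OF holo_mult[OF P \<Omega>] holo_mult[OF dP hi] qp])
  also have "iter_deriv l (\<lambda>z. P z * ext_deriv \<omega> z j k) q = iter_deriv l P q * ext_deriv \<omega> q j k"
    by (rule iter_deriv_mult_leading[OF P \<Omega> qp]) (use van in auto)
  also have "iter_deriv l P q = 0"
    using van by blast
  finally show ?thesis
    unfolding lead by simp
qed

text \<open>Two linear forms, one of which vanishes on the kernel of the other: the vector below combines two basis vectors into an element of the kernel.\<close>

lemma gradient_proportional:
  fixes h \<rho> :: "complex^'n \<Rightarrow> complex"
  assumes \<rho>: "holo_fun_on N \<rho>" and h: "holo_fun_on N h" and q: "q \<in> N"
    and i: "cpartial i \<rho> q \<noteq> 0"
    and ker: "\<And>v. dir_deriv v \<rho> q = 0 \<Longrightarrow> dir_deriv v h q = 0"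
  shows "cpartial j h q = (cpartial i h q / cpartial i \<rho> q) * cpartial j \<rho> q"
proof -
  define c where "c = cpartial j \<rho> q / cpartial i \<rho> q"
  define v :: "complex^'n" where "v = axis j 1 + (- c) *s axis i 1"
  have D: "dir_deriv v f q = cpartial j f q - c * cpartial i f q" if "holo_fun_on N f" for f
    unfolding v_def dir_deriv_eq_covec_app[OF that q] covec_app_add covec_app_scale covec_app_axis cgrad_nth
    by simp
  have "dir_deriv v \<rho> q = 0"
    using i by (simp add: D[OF \<rho>] c_def)
  then have "dir_deriv v h q = 0"
    by (rule ker)
  then show ?thesis
    by (simp add: D[OF h] c_def)
qed

text \<open>If \<open>dh \<and> \<omega>\<close> were nonzero at a zero of \<open>h\<close>, it would be nonzero on a neighbourhood, and this contains a point
  \<open>q\<close> of least multiplicity. There both \<open>\<omega>\<close> and \<open>dh\<close> are multiples of \<open>d\<rho>\<close>.\<close>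

lemma zero_locus_invariant:
  fixes \<omega> :: "complex^'n \<Rightarrow> complex^'n"
  defines "P \<equiv> radial_contraction \<omega>"
  assumes \<mu>: "0 < norm \<mu>" "norm \<mu> < 1"
    and hol: "holo_map_on punctured \<omega>"
    and hom: "\<And>i. homogeneous_on_punctured d (\<lambda>z. \<omega> z $ i)"
    and int: "integrable_on_set punctured \<omega>"
    and nz: "\<exists>z. z \<noteq> 0 \<and> P z \<noteq> 0" and zero: "\<exists>z. z \<noteq> 0 \<and> P z = 0"
  shows "invariant_hypersurface \<mu> \<omega> (zero_locus \<mu> P)"
  unfolding invariant_hypersurface_def
proof (intro conjI allI impI ballI)
  have \<mu>0: "\<mu> \<noteq> 0"
    using \<mu> by auto
  have P: "holo_fun_on punctured P" and Phom: "homogeneous_on_punctured (d + 1) P"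
    unfolding P_def by (rule holo_radial_contraction[OF hol], rule homogeneous_radial_contraction[OF hom])
  have dense: "\<exists>z\<in>V. P z \<noteq> 0" if V: "open V" "V \<noteq> {}" "V \<subseteq> punctured" for V
    using homogeneous_identity[OF P Phom V(1) _ V(3)] V(2) nz by blast
  show "analytic_hypersurface \<mu> (zero_locus \<mu> P)"
    by (rule zero_locus_hypersurface[OF \<mu> P Phom nz zero])
  fix U h z j k
  assume "U \<subseteq> punctured \<and> reduced_equation (hopf_preimage \<mu> (zero_locus \<mu> P)) U h"
  then have U: "U \<subseteq> punctured" and h: "holo_fun_on U h"
    and Z: "\<And>z. z \<in> U \<Longrightarrow> P z = 0 \<longleftrightarrow> h z = 0"
    by (auto simp: reduced_equation_def hopf_preimage_zero_locus[OF \<mu>0 Phom])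
  assume z: "z \<in> U" "h z = 0"
  show "wedge_1_1 (\<omega> z) (cgrad h z) j k = 0"
  proof (rule ccontr)
    assume nonzero: "wedge_1_1 (\<omega> z) (cgrad h z) j k \<noteq> 0"
    have "holo_fun_on U (\<lambda>z. \<omega> z $ i)" for i
      using hol holo_subset[OF _ holo_open[OF h] U] by (auto simp: holo_map_on_def)
    then have "continuous_on U (\<lambda>z. wedge_1_1 (\<omega> z) (cgrad h z) j k)"
      unfolding wedge_1_1_def cgrad_nth cpartial_eq_dir_deriv
      by (intro continuous_intros holo_continuous holo_dir_deriv[OF h])
    then have "open (U \<inter> (\<lambda>z. wedge_1_1 (\<omega> z) (cgrad h z) j k) -` (- {0}))"
      by (rule continuous_open_preimage[OF _ holo_open[OF h]]) (simp add: open_Compl)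
    moreover define O' where "O' = U \<inter> (\<lambda>z. wedge_1_1 (\<omega> z) (cgrad h z) j k) -` (- {0})"
    ultimately have O': "open O'" "O' \<subseteq> punctured" "z \<in> O'" "O' \<subseteq> U"
      using U z nonzero by auto
    have PO: "holo_fun_on O' P"
      by (rule holo_subset[OF P O'(1,2)])
    have Pz: "P z = 0"
      using Z z by simp
    obtain q l i where q: "q \<in> O'" "P q = 0" "\<forall>z\<in>O'. P z = 0 \<longrightarrow> iter_deriv l P z = 0"
      "\<forall>l'. length l' \<le> length l \<longrightarrow> iter_deriv l' P q = 0" "cpartial i (iter_deriv l P) q \<noteq> 0"
      by (rule least_multiplicity_point[OF PO O'(3) Pz]) (use dense O' in blast)
    define \<rho> where "\<rho> = iter_deriv l P"
    obtain M \<epsilon> g where M: "M \<subseteq> O'" "straightening \<rho> i q M \<epsilon> g"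
      "\<forall>z\<in>M. P z = 0 \<longleftrightarrow> \<rho> z = 0"
      unfolding \<rho>_def by (rule straightening_of_zero_set[OF PO holo_iter_deriv[OF PO] q(1,2,3,5)])
    have M': "open M" "q \<in> M" "holo_fun_on M \<rho>" "M \<subseteq> U"
      using M O' by (auto simp: straightening_def)
    have hM: "holo_fun_on M h"
      by (rule holo_subset[OF h M'(1,4)])
    have \<rho>q: "\<rho> q = 0"
      using q by (simp add: \<rho>_def)
    have ker: "dir_deriv v h q = 0" if "dir_deriv v \<rho> q = 0" for v
      by (rule gradient_of_function_vanishing_on_smooth_zero_set[OF M(2) \<rho>q hM _ that])
        (use M Z M' in blast)
    define c where "c = cpartial i h q / cpartial i \<rho> q"
    have dh: "cpartial m h q = c * cpartial m \<rho> q" for m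
      unfolding c_def by (rule gradient_proportional[OF M'(3) hM M'(2) q(5)[folded \<rho>_def] ker])
    have "q \<noteq> 0"
      using q(1) O'(2) by auto
    from gradient_parallel_to_form[OF hol hom int this q(4)[unfolded P_def], of j k]
    have "cpartial j \<rho> q * \<omega> q $ k = cpartial k \<rho> q * \<omega> q $ j"
      by (simp add: \<rho>_def P_def)
    then have "wedge_1_1 (\<omega> q) (cgrad h q) j k = 0"
      by (simp add: wedge_1_1_def cgrad_nth dh algebra_simps)
    with q(1) show False
      by (simp add: O'_def)
  qed
qed

text \<open>A function \<open>P\<close> without zeros would have an inverse of degree \<open>- (d + 1)\<close>, negative since \<open>d \<ge> 0\<close>.\<close>

lemma radial_contraction_has_zero:
  fixes \<omega> :: "complex^'n \<Rightarrow> complex^'n"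
  assumes n: "CARD('n) \<ge> 2" and hol: "holo_map_on punctured \<omega>"
    and hom: "\<And>i. homogeneous_on_punctured d (\<lambda>z. \<omega> z $ i)"
    and nz: "\<exists>z. z \<noteq> 0 \<and> \<omega> z \<noteq> 0"
  shows "\<exists>z. z \<noteq> 0 \<and> radial_contraction \<omega> z = 0"
proof (rule ccontr)
  assume "\<not> ?thesis"
  then have nowhere: "radial_contraction \<omega> z \<noteq> 0" if "z \<noteq> 0" for z
    using that by blast
  obtain z0 i where z0: "z0 \<noteq> 0" "\<omega> z0 $ i \<noteq> 0"
    using nz by (auto simp: vec_eq_iff)
  have "\<not> d < 0"
    using negative_degree_imp_zero[OF n _ hom[of i] _ z0(1)] hol z0(2) by (auto simp: holo_map_on_def)
  then have neg: "- (d + 1) < 0"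
    by simp
  have inv_hol: "holo_fun_on punctured (\<lambda>z. inverse (radial_contraction \<omega> z))"
    by (rule holo_inverse[OF holo_radial_contraction[OF hol]]) (use nowhere in auto)
  have inv_hom: "homogeneous_on_punctured (- (d + 1)) (\<lambda>z. inverse (radial_contraction \<omega> z))"
    using homogeneous_radial_contraction[OF hom] unfolding homogeneous_on_punctured_def power_int_minus
    by simp
  have "inverse (radial_contraction \<omega> z0) = 0"
    by (rule negative_degree_imp_zero[OF n inv_hol inv_hom neg z0(1)])
  with nowhere[OF z0(1)] show False
    by simp
qed

section \<open>The curves swept out by complex lines\<close>

definition punctured_line :: "complex^'n \<Rightarrow> (complex^'n) set" where
  "punctured_line w = (\<lambda>t. t *s w) ` (- {0})"

definition radial_leaf :: "complex \<Rightarrow> complex^'n \<Rightarrow> (complex^'n) set set" where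
  "radial_leaf \<mu> w = hopf_proj \<mu> ` punctured_line w"

lemma punctured_line_subset: "w \<noteq> 0 \<Longrightarrow> punctured_line w \<subseteq> punctured"
  by (auto simp: punctured_line_def)

lemma mem_punctured_line_iff:
  fixes z w :: "complex^'n"
  assumes "z $ i \<noteq> 0"
  shows "z \<in> punctured_line w \<longleftrightarrow> w $ i \<noteq> 0 \<and> (\<forall>j. z $ j = (w $ j / w $ i) * z $ i)"
proof
  assume "z \<in> punctured_line w"
  then obtain t where "t \<noteq> 0" "z = t *s w"
    by (auto simp: punctured_line_def)
  moreover from this assms have "w $ i \<noteq> 0"
    by simp
  ultimately show "w $ i \<noteq> 0 \<and> (\<forall>j. z $ j = (w $ j / w $ i) * z $ i)"
    by simp
next
  assume *: "w $ i \<noteq> 0 \<and> (\<forall>j. z $ j = (w $ j / w $ i) * z $ i)"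
  have "z = (z $ i / w $ i) *s w"
  proof (rule vec_eq_iff[THEN iffD2], rule allI)
    fix j
    have "z $ j = (w $ j / w $ i) * z $ i"
      using * by blast
    then show "z $ j = ((z $ i / w $ i) *s w) $ j"
      by simp
  qed
  moreover have "z $ i / w $ i \<noteq> 0"
    using conjunct1[OF *] assms by simp
  ultimately show "z \<in> punctured_line w"
    unfolding punctured_line_def by (metis ComplI image_eqI singletonD)
qed

lemma punctured_line_eq:
  assumes "z \<in> punctured_line w"
  shows "punctured_line z = punctured_line w"
proof -
  obtain t where t: "t \<noteq> 0" "z = t *s w"
    using assms by (auto simp: punctured_line_def)
  have "(\<lambda>s. s * t) ` (- {0}) = - {0}"
  proof (intro equalityI subsetI)
    fix s :: complex assume "s \<in> - {0}"
    then show "s \<in> (\<lambda>s. s * t) ` (- {0})"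
      using t(1) by (intro image_eqI[of _ _ "s / t"]) auto
  qed (use t in auto)
  moreover have "punctured_line z = (\<lambda>s. s *s w) ` (\<lambda>s. s * t) ` (- {0})"
    by (simp add: punctured_line_def t(2) image_image vector_smult_assoc)
  ultimately show ?thesis
    by (simp add: punctured_line_def)
qed

lemma hopf_proj_mem_radial_leaf:
  assumes "\<mu> \<noteq> 0"
  shows "hopf_proj \<mu> z \<in> radial_leaf \<mu> w \<longleftrightarrow> z \<in> punctured_line w"
proof
  assume "hopf_proj \<mu> z \<in> radial_leaf \<mu> w"
  then obtain t where t: "t \<noteq> 0" "hopf_proj \<mu> z = hopf_proj \<mu> (t *s w)"
    by (auto simp: radial_leaf_def punctured_line_def)
  from hopf_proj_eqD[OF t(2)] obtain k where "z = (\<mu> powi k) *s (t *s w)" .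
  then have "z = (\<mu> powi k * t) *s w"
    by (simp add: vector_smult_assoc)
  moreover have "\<mu> powi k * t \<noteq> 0"
    using t(1) assms by simp
  ultimately show "z \<in> punctured_line w"
    by (auto simp: punctured_line_def)
qed (simp add: radial_leaf_def)

lemma radial_leaf_eq: "z \<in> punctured_line w \<Longrightarrow> radial_leaf \<mu> z = radial_leaf \<mu> w"
  by (simp add: radial_leaf_def punctured_line_eq)

lemma mem_punctured_line_self: "z \<in> punctured_line z"
  unfolding punctured_line_def by (intro image_eqI[of _ _ 1]) auto

lemma radial_leaf_subset: "w \<noteq> 0 \<Longrightarrow> radial_leaf \<mu> w \<subseteq> hopf \<mu>"
  unfolding radial_leaf_def hopf_def by (intro image_mono punctured_line_subset)

lemma hopf_preimage_radial_leaf: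
  assumes "\<mu> \<noteq> 0" "w \<noteq> 0"
  shows "hopf_preimage \<mu> (radial_leaf \<mu> w) = punctured_line w"
  unfolding hopf_preimage_def hopf_proj_mem_radial_leaf[OF assms(1)]
  using punctured_line_subset[OF assms(2)] by blast

lemma continuous_map_hopf_proj:
  fixes \<gamma> :: "'a::topological_space \<Rightarrow> complex^'n"
  assumes "continuous_on S \<gamma>" "\<gamma> ` S \<subseteq> punctured"
  shows "continuous_map (top_of_set S) (hopf_topology \<mu>) (\<lambda>t. hopf_proj \<mu> (\<gamma> t))"
  unfolding continuous_map_def
proof (intro conjI allI impI)
  show "(\<lambda>t. hopf_proj \<mu> (\<gamma> t)) \<in> topspace (top_of_set S) \<rightarrow> topspace (hopf_topology \<mu>)"
    using assms(2) by (auto simp: topspace_hopf_topology hopf_def)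
  fix U :: "(complex^'n) set set" assume "openin (hopf_topology \<mu>) U"
  then have "openin (top_of_set S) (S \<inter> \<gamma> -` hopf_preimage \<mu> U)"
    by (intro continuous_openin_preimage_gen[OF assms(1)]) (simp add: openin_hopf_topology)
  moreover have "S \<inter> \<gamma> -` hopf_preimage \<mu> U = {t \<in> topspace (top_of_set S). hopf_proj \<mu> (\<gamma> t) \<in> U}"
    using assms(2) by (auto simp: hopf_preimage_def)
  ultimately show "openin (top_of_set S) {t \<in> topspace (top_of_set S). hopf_proj \<mu> (\<gamma> t) \<in> U}"
    by simp
qed

lemma path_connectedin_hopf_image:
  fixes \<gamma> :: "complex \<Rightarrow> complex^'n"
  assumes "continuous_on S \<gamma>" "\<gamma> ` S \<subseteq> punctured" "path_connected S"
  shows "path_connectedin (hopf_topology \<mu>) ((\<lambda>t. hopf_proj \<mu> (\<gamma> t)) ` S)"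
  by (rule path_connectedin_continuous_map_image[OF continuous_map_hopf_proj[OF assms(1,2)]])
    (simp add: path_connectedin_subtopology assms(3))

lemma radial_leaf_image: "radial_leaf \<mu> w = (\<lambda>t. hopf_proj \<mu> (t *s w)) ` (- {0})"
  by (simp add: radial_leaf_def punctured_line_def image_image)

lemma path_connectedin_radial_leaf:
  assumes "w \<noteq> 0"
  shows "path_connectedin (hopf_topology \<mu>) (radial_leaf \<mu> w)"
  unfolding radial_leaf_image
  by (rule path_connectedin_hopf_image)
    (use assms in \<open>auto intro!: continuous_intros path_connected_punctured_universe\<close>)

text \<open>The closed annulus between the radii \<open>norm \<mu>\<close> and \<open>1\<close> meets every orbit of multiplication by \<open>\<mu>\<close> on the nonzero complex numbers.\<close>

lemma floor_log_scaling:
  assumes \<mu>: "0 < norm \<mu>" "norm \<mu> < 1" and t: "t \<noteq> (0::complex)"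
  obtains k where "norm \<mu> \<le> norm ((\<mu> powi k) * t)" "norm ((\<mu> powi k) * t) \<le> 1"
proof -
  define m where "m = norm \<mu>"
  have m: "0 < m" "m < 1"
    using \<mu> by (auto simp: m_def)
  define x where "x = ln (norm t) / ln m"
  define k where "k = - \<lfloor>x\<rfloor>"
  have lnm: "ln m < 0"
    using m by simp
  have x: "ln (norm t) = x * ln m"
    using lnm by (simp add: x_def)
  have N: "norm ((\<mu> powi k) * t) = m powr (x - \<lfloor>x\<rfloor>)"
  proof -
    have "norm t = m powr x"
      using t m exp_ln[of "norm t"] by (simp add: powr_def x)
    moreover have "norm (\<mu> powi k) = m powr of_int k"
      using m by (simp add: norm_power_int m_def[symmetric] powr_real_of_int')
    ultimately have "norm ((\<mu> powi k) * t) = m powr (of_int k + x)"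
      by (simp add: norm_mult powr_add)
    then show ?thesis
      by (simp add: k_def)
  qed
  have "m powr 1 \<le> m powr (x - \<lfloor>x\<rfloor>)"
    using m by (intro powr_mono') linarith+
  moreover have "m powr (x - \<lfloor>x\<rfloor>) \<le> m powr 0"
    using m by (intro powr_mono') linarith+
  ultimately show thesis
    using that[of k] m unfolding N by (simp add: m_def)
qed

text \<open>The leaf is already the image of a compact annulus in the line.\<close>

lemma compactin_radial_leaf:
  assumes \<mu>: "0 < norm \<mu>" "norm \<mu> < 1" and w: "w \<noteq> 0"
  shows "compactin (hopf_topology \<mu>) (radial_leaf \<mu> w)"
proof -
  have \<mu>0: "\<mu> \<noteq> 0"
    using \<mu> by auto
  define A :: "complex set" where "A = cball 0 1 - ball 0 (norm \<mu>)"
  have A0: "0 \<notin> A"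
    using \<mu> by (simp add: A_def)
  have "compact A"
    unfolding A_def by (intro compact_diff) auto
  moreover have "continuous_map (top_of_set A) (hopf_topology \<mu>) (\<lambda>t. hopf_proj \<mu> (t *s w))"
    by (rule continuous_map_hopf_proj) (use w A0 in \<open>auto intro!: continuous_intros\<close>)
  ultimately have "compactin (hopf_topology \<mu>) ((\<lambda>t. hopf_proj \<mu> (t *s w)) ` A)"
    using image_compactin[of "top_of_set A" A] by (simp add: compactin_subtopology)
  moreover have "(\<lambda>t. hopf_proj \<mu> (t *s w)) ` A = radial_leaf \<mu> w"
  proof (intro equalityI subsetI)
    fix y assume "y \<in> radial_leaf \<mu> w"
    then obtain t where t: "t \<noteq> 0" "y = hopf_proj \<mu> (t *s w)"
      by (auto simp: radial_leaf_image)
    obtain k where k: "norm \<mu> \<le> norm ((\<mu> powi k) * t)" "norm ((\<mu> powi k) * t) \<le> 1"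
      by (rule floor_log_scaling[OF \<mu> t(1)])
    have "hopf_proj \<mu> (((\<mu> powi k) * t) *s w) = y"
      unfolding t(2) using hopf_proj_powi[OF \<mu>0, of k "t *s w"] by (simp add: vector_smult_assoc)
    moreover have "(\<mu> powi k) * t \<in> A"
      using k by (simp add: A_def)
    ultimately show "y \<in> (\<lambda>t. hopf_proj \<mu> (t *s w)) ` A"
      by (metis image_eqI)
  qed (use A0 in \<open>auto simp: radial_leaf_image\<close>)
  ultimately show ?thesis
    by simp
qed

section \<open>Affine charts adapted to the lines\<close>

text \<open>Centred at \<open>p\<close>: the quotients \<open>z $ j / z $ i\<close> are the affine coordinates of the line through \<open>z\<close>, and \<open>z $ i\<close>
  is a coordinate along the line. So the lines are the slices parallel to the \<open>i\<close>-th axis.\<close>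

definition affine_chart :: "'n \<Rightarrow> complex^'n \<Rightarrow> real \<Rightarrow> complex^'n \<Rightarrow> complex^'n" where
  "affine_chart i p r z = (\<chi> j. if j = i then (z $ i - p $ i) / of_real r else z $ j / z $ i - p $ j / p $ i)"

definition affine_chart_inv :: "'n \<Rightarrow> complex^'n \<Rightarrow> real \<Rightarrow> complex^'n \<Rightarrow> complex^'n" where
  "affine_chart_inv i p r w =
    (\<chi> j. if j = i then p $ i + of_real r * w $ i else (p $ i + of_real r * w $ i) * (w $ j + p $ j / p $ i))"

definition unit_polydisc :: "(complex^'n) set" where
  "unit_polydisc = {w. \<forall>j. norm (w $ j) < 1}"

definition affine_domain :: "'n \<Rightarrow> complex^'n \<Rightarrow> real \<Rightarrow> (complex^'n) set" where
  "affine_domain i p r = {z. z $ i \<noteq> 0} \<inter> affine_chart i p r -` unit_polydisc"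

lemma open_unit_polydisc: "open (unit_polydisc :: (complex^'n) set)"
proof -
  have eq: "unit_polydisc = (\<Inter>j. {w::complex^'n. norm (w $ j) < 1})"
    by (auto simp: unit_polydisc_def)
  show ?thesis
    unfolding eq by (intro open_INT finite ballI open_Collect_less continuous_intros)
qed

lemma open_coord_nonzero: "open {z::complex^'n. z $ i \<noteq> 0}"
  by (intro open_Collect_neq continuous_intros)

lemma holo_affine_chart: "holo_map_on {z. z $ i \<noteq> 0} (affine_chart i p r)"
  unfolding holo_map_on_def
proof
  fix j
  have "holo_fun_on {z. z $ i \<noteq> 0} (\<lambda>z. inverse (of_real r) * (z $ i + - p $ i))"
    "holo_fun_on {z. z $ i \<noteq> 0} (\<lambda>z. z $ j * inverse (z $ i) + - (p $ j / p $ i))"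
    by (intro holo_add holo_mult holo_const holo_nth holo_inverse open_coord_nonzero; simp)+
  then show "holo_fun_on {z. z $ i \<noteq> 0} (\<lambda>z. affine_chart i p r z $ j)"
    by (cases "j = i") (simp_all add: affine_chart_def field_simps)
qed

lemma holo_affine_chart_inv: "holo_map_on unit_polydisc (affine_chart_inv i p r)"
  unfolding holo_map_on_def
proof
  fix j
  have "holo_fun_on unit_polydisc (\<lambda>w. p $ i + of_real r * w $ i)"
    "holo_fun_on unit_polydisc (\<lambda>w. (p $ i + of_real r * w $ i) * (w $ j + p $ j / p $ i))"
    by (intro holo_add holo_mult holo_const holo_nth open_unit_polydisc)+
  then show "holo_fun_on unit_polydisc (\<lambda>w. affine_chart_inv i p r w $ j)"
    by (cases "j = i") (simp_all add: affine_chart_inv_def)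
qed

lemma affine_chart_inv_chart:
  fixes z p :: "complex^'n"
  assumes "0 < r" "z $ i \<noteq> 0"
  shows "affine_chart_inv i p r (affine_chart i p r z) = z"
  using assms by (simp add: affine_chart_inv_def affine_chart_def vec_eq_iff)

lemma affine_chart_inv_nonzero:
  fixes w p :: "complex^'n"
  assumes "0 < r" "r < norm (p $ i)" "w \<in> unit_polydisc"
  shows "affine_chart_inv i p r w $ i \<noteq> 0"
proof
  assume "affine_chart_inv i p r w $ i = 0"
  then have "norm (p $ i) = norm (of_real r * w $ i)"
    by (simp add: affine_chart_inv_def add_eq_0_iff2)
  also have "\<dots> = r * norm (w $ i)"
    using assms(1) by (simp add: norm_mult)
  also have "\<dots> \<le> r * 1"
    using assms(1,3) by (intro mult_left_mono) (auto simp: unit_polydisc_def less_imp_le)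
  finally show False
    using assms(2) by simp
qed

lemma affine_chart_chart_inv:
  fixes w p :: "complex^'n"
  assumes "0 < r" "r < norm (p $ i)" "w \<in> unit_polydisc"
  shows "affine_chart i p r (affine_chart_inv i p r w) = w"
proof -
  have "p $ i + of_real r * w $ i \<noteq> 0"
    using affine_chart_inv_nonzero[OF assms] by (simp add: affine_chart_inv_def)
  then show ?thesis
    using assms(1) by (simp add: affine_chart_inv_def affine_chart_def vec_eq_iff)
qed

lemma affine_chart_inv_mem:
  fixes w p :: "complex^'n"
  assumes "0 < r" "r < norm (p $ i)" "w \<in> unit_polydisc"
  shows "affine_chart_inv i p r w \<in> affine_domain i p r"
  unfolding affine_domain_def
  using affine_chart_inv_nonzero[OF assms] affine_chart_chart_inv[OF assms] assms(3) by simp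

lemma affine_chart_image:
  fixes p :: "complex^'n"
  assumes "0 < r" "r < norm (p $ i)"
  shows "affine_chart i p r ` affine_domain i p r = unit_polydisc"
proof (intro equalityI subsetI)
  fix w :: "complex^'n" assume "w \<in> unit_polydisc"
  from affine_chart_inv_mem[OF assms this] affine_chart_chart_inv[OF assms this]
  show "w \<in> affine_chart i p r ` affine_domain i p r"
    by (metis image_eqI)
qed (auto simp: affine_domain_def)

text \<open>On the domain \<open>norm (z $ i)\<close> differs from \<open>norm (p $ i)\<close> by less than \<open>r\<close>, and \<open>r\<close> is chosen so small that this interval is disjoint from its multiples by nontrivial powers of \<open>norm \<mu>\<close>.\<close>

lemma wandering_affine_domain:
  fixes p :: "complex^'n"
  assumes \<mu>: "0 < norm \<mu>" "norm \<mu> < 1" and p: "p $ i \<noteq> 0"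
    and r: "r = norm (p $ i) * (1 - norm \<mu>) / 2"
  shows "wandering \<mu> (affine_domain i p r)"
proof (rule wanderingI[OF \<mu>, where f = "\<lambda>z. norm (z $ i)" and a = "norm (p $ i) - r" and b = "norm (p $ i) + r"])
  have r0: "0 < r"
    using \<mu> p by (simp add: r)
  show "open (affine_domain i p r)"
    unfolding affine_domain_def
    by (intro continuous_open_preimage holo_map_continuous holo_affine_chart open_coord_nonzero open_unit_polydisc)
  show "affine_domain i p r \<subseteq> punctured"
    by (auto simp: affine_domain_def)
  have "r * (1 + norm \<mu>) \<le> r * 2"
    using r0 \<mu> by (intro mult_left_mono) auto
  also have "r * 2 = norm (p $ i) * (1 - norm \<mu>)"
    by (simp add: r)
  finally show "norm \<mu> * (norm (p $ i) + r) \<le> norm (p $ i) - r"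
    by (simp add: algebra_simps)
  fix z assume "z \<in> affine_domain i p r"
  then have z: "z $ i \<noteq> 0" "affine_chart i p r z \<in> unit_polydisc"
    by (auto simp: affine_domain_def)
  have "norm (affine_chart i p r z $ i) < 1"
    using z(2) by (simp add: unit_polydisc_def)
  then have "norm (z $ i - p $ i) < r"
    using r0 by (simp add: affine_chart_def norm_divide)
  then have "norm (p $ i) - r < norm (z $ i)" "norm (z $ i) < norm (p $ i) + r"
    using norm_triangle_ineq2[of "p $ i" "z $ i"] norm_triangle_ineq2[of "z $ i" "p $ i"]
    by (auto simp: norm_minus_commute)
  with z(1) show "0 < norm (z $ i) \<and> norm (p $ i) - r < norm (z $ i) \<and> norm (z $ i) < norm (p $ i) + r"
    by simp
qed (simp add: norm_mult)

lemma exists_line_chart: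
  fixes p :: "complex^'n"
  assumes \<mu>: "0 < norm \<mu>" "norm \<mu> < 1" and p: "p $ i \<noteq> 0"
  obtains N r and \<phi> :: "(complex^'n) set \<Rightarrow> complex^'n" where "0 < r" "r < norm (p $ i)" "N = affine_domain i p r" "wandering \<mu> N" "p \<in> N"
    "hopf_chart \<mu> (hopf_proj \<mu> ` N) \<phi>" "\<phi> ` hopf_proj \<mu> ` N = unit_polydisc"
    "\<forall>z\<in>N. \<phi> (hopf_proj \<mu> z) = affine_chart i p r z"
proof -
  have \<mu>0: "\<mu> \<noteq> 0"
    using \<mu> by auto
  define r where "r = norm (p $ i) * (1 - norm \<mu>) / 2"
  have r0: "0 < r"
    using \<mu> p by (simp add: r_def)
  have "norm (p $ i) * (1 - norm \<mu>) \<le> norm (p $ i) * 1"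
    using \<mu> by (intro mult_left_mono) auto
  moreover have "0 < norm (p $ i)"
    using p by simp
  ultimately have r1: "r < norm (p $ i)"
    unfolding r_def by linarith
  define N where "N = affine_domain i p r"
  have wan: "wandering \<mu> N"
    unfolding N_def by (rule wandering_affine_domain[OF \<mu> p r_def])
  define \<phi> where "\<phi> = (\<lambda>x. affine_chart i p r (hopf_lift \<mu> N x))"
  have \<phi>: "\<forall>z\<in>N. \<phi> (hopf_proj \<mu> z) = affine_chart i p r z"
    by (simp add: \<phi>_def hopf_lift_proj[OF \<mu>0 wan])
  have img: "affine_chart i p r ` N = unit_polydisc"
    unfolding N_def by (rule affine_chart_image[OF r0 r1])
  have "affine_chart i p r p = 0"
    by (simp add: affine_chart_def vec_eq_iff)
  then have pN: "p \<in> N"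
    using p by (simp add: N_def affine_domain_def unit_polydisc_def)
  have Nsub: "N \<subseteq> {z. z $ i \<noteq> 0}"
    by (auto simp: N_def affine_domain_def)
  have hol: "holo_map_on N (affine_chart i p r)"
    unfolding holo_map_on_def
  proof
    fix j
    have "open N"
      using wan by (simp add: wandering_def)
    moreover have "holo_fun_on {z. z $ i \<noteq> 0} (\<lambda>z. affine_chart i p r z $ j)"
      using holo_affine_chart unfolding holo_map_on_def by blast
    ultimately show "holo_fun_on N (\<lambda>z. affine_chart i p r z $ j)"
      using holo_subset Nsub by blast
  qed
  have "hopf_chart \<mu> (hopf_proj \<mu> ` N) \<phi>"
    unfolding \<phi>_def
    by (rule hopf_chart_lift[OF \<mu>0 wan hol holo_affine_chart_inv[of i p r] img])
      (use affine_chart_inv_chart[OF r0] Nsub in blast)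
  moreover have "\<phi> ` hopf_proj \<mu> ` N = unit_polydisc"
    unfolding img[symmetric] image_image using \<phi> by (intro image_cong) auto
  ultimately show thesis
    using that[OF r0 r1 N_def wan pN _ _ \<phi>] by blast
qed

lemma line_in_affine_chart:
  fixes z w p :: "complex^'n"
  assumes z: "z \<in> affine_domain i p r" and w: "w $ i \<noteq> 0"
  shows "z \<in> punctured_line w \<longleftrightarrow> (\<forall>j. j \<noteq> i \<longrightarrow> affine_chart i p r z $ j = w $ j / w $ i - p $ j / p $ i)"
proof -
  have zi: "z $ i \<noteq> 0"
    using z by (simp add: affine_domain_def)
  have "(z $ j = (w $ j / w $ i) * z $ i) \<longleftrightarrow> (j \<noteq> i \<longrightarrow> affine_chart i p r z $ j = w $ j / w $ i - p $ j / p $ i)" for j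
    using zi w by (cases "j = i") (auto simp: affine_chart_def divide_eq_eq)
  then show ?thesis
    using mem_punctured_line_iff[OF zi, of w] w by simp
qed

section \<open>The foliation by radial elliptic curves\<close>

lemma path_components_of_path_connected:
  assumes "path_connectedin X S" "C \<in> path_components_of (subtopology X S)"
  shows "C = S"
proof (rule antisym)
  have S: "S \<subseteq> topspace X"
    using assms(1) path_connectedin_subset_topspace by blast
  then show CS: "C \<subseteq> S"
    using path_components_of_subset[OF assms(2)] by simp
  have "\<not> disjnt C S"
    using CS nonempty_path_components_of[OF assms(2)] by (auto simp: disjnt_def)
  then show "S \<subseteq> C"
    using path_components_of_maximal[OF assms(2)] assms(1) by (simp add: path_connectedin_subtopology)
qed

text \<open>In an affine chart a leaf either does not meet the domain or is a single slice: a slice is the image of a disc, hence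
  path-connected, and each line corresponds to one value of the affine coordinates.\<close>

lemma radial_leaves_foliation:
  fixes \<mu> :: complex
  assumes \<mu>: "0 < norm \<mu>" "norm \<mu> < 1"
  shows "one_dim_foliation \<mu> (radial_leaf \<mu> ` (punctured :: (complex^'n) set))"
  unfolding one_dim_foliation_def
proof (intro conjI ballI)
  let ?F = "radial_leaf \<mu> ` (punctured :: (complex^'n) set)"
  have \<mu>0: "\<mu> \<noteq> 0"
    using \<mu> by auto
  have self: "hopf_proj \<mu> z \<in> radial_leaf \<mu> z" for z :: "complex^'n"
    using hopf_proj_mem_radial_leaf[OF \<mu>0] mem_punctured_line_self by blast
  show "\<Union>?F = hopf \<mu>"
  proof (intro equalityI subsetI)
    fix y :: "(complex^'n) set" assume "y \<in> hopf \<mu>"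
    then obtain z where "z \<in> punctured" "y = hopf_proj \<mu> z"
      by (auto simp: hopf_def)
    then show "y \<in> \<Union>?F"
      using self by blast
  next
    fix y assume "y \<in> \<Union>?F"
    then obtain w :: "complex^'n" where "w \<noteq> 0" "y \<in> radial_leaf \<mu> w"
      by blast
    then show "y \<in> hopf \<mu>"
      using radial_leaf_subset by blast
  qed
  show "disjoint ?F"
  proof (rule disjointI)
    fix K L assume KL: "K \<in> ?F" "L \<in> ?F" "K \<noteq> L"
    then obtain v w :: "complex^'n" where v: "K = radial_leaf \<mu> v" and w: "L = radial_leaf \<mu> w"
      by blast
    show "K \<inter> L = {}"
    proof (rule ccontr)
      assume "K \<inter> L \<noteq> {}"
      then obtain z where z: "z \<in> punctured_line v" "hopf_proj \<mu> z \<in> radial_leaf \<mu> w"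
        unfolding v w radial_leaf_def by blast
      then have "z \<in> punctured_line w"
        using hopf_proj_mem_radial_leaf[OF \<mu>0] by blast
      from radial_leaf_eq[OF this, of \<mu>] radial_leaf_eq[OF z(1), of \<mu>] v w KL(3) show False
        by simp
    qed
  qed
  show "{} \<notin> ?F"
    using self by blast
  show "path_connectedin (hopf_topology \<mu>) L" if "L \<in> ?F" for L
    using that path_connectedin_radial_leaf by blast
  fix x :: "(complex^'n) set" assume "x \<in> hopf \<mu>"
  then obtain p where p: "p \<noteq> 0" "x = hopf_proj \<mu> p"
    by (auto simp: hopf_def)
  then obtain i where i: "p $ i \<noteq> 0"
    by (auto simp: vec_eq_iff)
  obtain N r and \<phi> :: "(complex^'n) set \<Rightarrow> complex^'n" where r: "0 < r" "r < norm (p $ i)" and N: "N = affine_domain i p r"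
    and wan: "wandering \<mu> N" and pN: "p \<in> N"
    and chart: "hopf_chart \<mu> (hopf_proj \<mu> ` N) \<phi>" and img: "\<phi> ` hopf_proj \<mu> ` N = unit_polydisc"
    and \<phi>: "\<forall>z\<in>N. \<phi> (hopf_proj \<mu> z) = affine_chart i p r z"
    by (rule exists_line_chart[OF \<mu> i])
  let ?U = "hopf_proj \<mu> ` N"
  have Np: "N \<subseteq> punctured"
    using wan by (simp add: wandering_def)
  have "\<exists>c. C = {y\<in>?U. \<forall>j. j \<noteq> i \<longrightarrow> \<phi> y $ j = c $ j}"
    if L: "L \<in> ?F" and C: "C \<in> path_components_of (subtopology (hopf_topology \<mu>) (L \<inter> ?U))" for L C
  proof -
    obtain w where w: "w \<noteq> 0" "L = radial_leaf \<mu> w"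
      using L by blast
    have "L \<inter> ?U \<noteq> {}"
      using nonempty_path_components_of[OF C] path_components_of_subset[OF C] by auto
    then obtain z0 where z0: "z0 \<in> N" "z0 \<in> punctured_line w"
      using hopf_proj_mem_radial_leaf[OF \<mu>0] w(2) by blast
    have "z0 $ i \<noteq> 0"
      using z0(1) by (simp add: N affine_domain_def)
    from mem_punctured_line_iff[OF this, of w] z0(2) have wi: "w $ i \<noteq> 0"
      by blast
    define c where "c = (\<chi> j. w $ j / w $ i - p $ j / p $ i)"
    have line: "z \<in> punctured_line w \<longleftrightarrow> (\<forall>j. j \<noteq> i \<longrightarrow> affine_chart i p r z $ j = c $ j)" if "z \<in> N" for z
      using line_in_affine_chart[OF that[unfolded N] wi] by (simp add: c_def)
    have LU: "L \<inter> ?U = {y\<in>?U. \<forall>j. j \<noteq> i \<longrightarrow> \<phi> y $ j = c $ j}"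
      using \<phi> line hopf_proj_mem_radial_leaf[OF \<mu>0, of _ w] w(2) by auto
    define \<gamma> where "\<gamma> = (\<lambda>t. affine_chart_inv i p r (\<chi> j. if j = i then t else c $ j))"
    have poly: "(\<chi> j. if j = i then t else c $ j) \<in> unit_polydisc" if "t \<in> ball 0 1" for t
    proof -
      have "norm (c $ j) < 1" if "j \<noteq> i" for j
      proof -
        have "affine_chart i p r z0 $ j = c $ j"
          using line[OF z0(1)] z0(2) that by blast
        moreover have "affine_chart i p r z0 \<in> unit_polydisc"
          using z0(1) by (simp add: N affine_domain_def)
        ultimately show ?thesis
          unfolding unit_polydisc_def by (metis mem_Collect_eq)
      qed
      with that show ?thesis
        by (simp add: unit_polydisc_def)
    qed
    have \<gamma>N: "\<gamma> t \<in> N" and \<gamma>chart: "affine_chart i p r (\<gamma> t) = (\<chi> j. if j = i then t else c $ j)" if "t \<in> ball 0 1" for t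
      unfolding N \<gamma>_def
      by (rule affine_chart_inv_mem[OF r poly[OF that]], rule affine_chart_chart_inv[OF r poly[OF that]])
    have "L \<inter> ?U = (\<lambda>t. hopf_proj \<mu> (\<gamma> t)) ` ball 0 1"
    proof (intro equalityI subsetI)
      fix y assume "y \<in> (\<lambda>t. hopf_proj \<mu> (\<gamma> t)) ` ball 0 1"
      then obtain t where t: "t \<in> ball 0 1" "y = hopf_proj \<mu> (\<gamma> t)"
        by blast
      have "\<gamma> t \<in> punctured_line w"
        using line[OF \<gamma>N[OF t(1)]] \<gamma>chart[OF t(1)] by simp
      then show "y \<in> L \<inter> ?U"
        using t(2) \<gamma>N[OF t(1)] hopf_proj_mem_radial_leaf[OF \<mu>0, of "\<gamma> t" w] w(2) by blast
    next
      fix y assume "y \<in> L \<inter> ?U"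
      then obtain z where z: "z \<in> N" "y = hopf_proj \<mu> z" "y \<in> L"
        by blast
      then have zl: "\<forall>j. j \<noteq> i \<longrightarrow> affine_chart i p r z $ j = c $ j"
        using line[OF z(1)] hopf_proj_mem_radial_leaf[OF \<mu>0, of z w] w(2) by blast
      define t where "t = affine_chart i p r z $ i"
      have chart_z: "affine_chart i p r z = (\<chi> j. if j = i then t else c $ j)"
        using zl by (simp add: vec_eq_iff t_def)
      have "z $ i \<noteq> 0" "affine_chart i p r z \<in> unit_polydisc"
        using z(1) by (auto simp: N affine_domain_def)
      then have "z = \<gamma> t" "t \<in> ball 0 1"
        using affine_chart_inv_chart[OF r(1), of z i p] unfolding \<gamma>_def chart_z[symmetric]
        by (auto simp: unit_polydisc_def t_def)
      with z(2) show "y \<in> (\<lambda>t. hopf_proj \<mu> (\<gamma> t)) ` ball 0 1"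
        by blast
    qed
    moreover have "path_connectedin (hopf_topology \<mu>) ((\<lambda>t. hopf_proj \<mu> (\<gamma> t)) ` ball 0 1)"
    proof (rule path_connectedin_hopf_image)
      have cont: "continuous_on (ball 0 1) (\<lambda>t. \<chi> j. if j = i then t else c $ j)"
      proof (rule continuous_on_vec_lambda)
        fix j
        show "continuous_on (ball 0 1) (\<lambda>t. if j = i then t else c $ j)"
          by (cases "j = i") (auto intro!: continuous_intros)
      qed
      show "continuous_on (ball 0 1) \<gamma>"
        unfolding \<gamma>_def
        by (rule continuous_on_compose2[OF holo_map_continuous[OF holo_affine_chart_inv] cont])
          (rule image_subsetI, rule poly)
      show "\<gamma> ` ball 0 1 \<subseteq> punctured"
        by (rule image_subsetI) (rule subsetD[OF Np \<gamma>N])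
    qed (simp add: convex_imp_path_connected)
    ultimately have "C = L \<inter> ?U"
      using path_components_of_path_connected[OF _ C] by simp
    with LU show ?thesis
      by blast
  qed
  then show "\<exists>U \<phi> i. hopf_chart \<mu> U \<phi> \<and> x \<in> U \<and> \<phi> ` U = {w. \<forall>j. norm (w $ j) < 1} \<and>
        (\<forall>L\<in>?F. \<forall>C\<in>path_components_of (subtopology (hopf_topology \<mu>) (L \<inter> U)).
           \<exists>c. C = {y\<in>U. \<forall>j. j \<noteq> i \<longrightarrow> \<phi> y $ j = c $ j})"
    using chart img p(2) pN
    by (intro exI[of _ ?U] exI[of _ \<phi>] exI[of _ i] conjI ballI) (auto simp: unit_polydisc_def)
qed

lemma regular_point_radial_leaf:
  fixes w :: "complex^'n"
  assumes \<mu>: "0 < norm \<mu>" "norm \<mu> < 1" and w: "w \<noteq> 0" and x: "x \<in> radial_leaf \<mu> w"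
  shows "regular_point \<mu> (radial_leaf \<mu> w) 1 x"
proof -
  have \<mu>0: "\<mu> \<noteq> 0"
    using \<mu> by auto
  obtain p where p: "p \<in> punctured_line w" "x = hopf_proj \<mu> p"
    using x unfolding radial_leaf_def by blast
  have "p \<noteq> 0"
    using p(1) punctured_line_subset[OF w] by blast
  then obtain i where i: "p $ i \<noteq> 0"
    by (auto simp: vec_eq_iff)
  obtain N r and \<phi> :: "(complex^'n) set \<Rightarrow> complex^'n" where N: "N = affine_domain i p r" and pN: "p \<in> N"
    and chart: "hopf_chart \<mu> (hopf_proj \<mu> ` N) \<phi>"
    and \<phi>: "\<forall>z\<in>N. \<phi> (hopf_proj \<mu> z) = affine_chart i p r z"
    by (rule exists_line_chart[OF \<mu> i])
  have "hopf_proj \<mu> z \<in> radial_leaf \<mu> w \<longleftrightarrow> (\<forall>j\<in>UNIV - {i}. \<phi> (hopf_proj \<mu> z) $ j = 0)" if "z \<in> N" for z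
    using hopf_proj_mem_radial_leaf[OF \<mu>0, of z w] line_in_affine_chart[OF that[unfolded N] i]
      punctured_line_eq[OF p(1)] \<phi> that by (auto simp: i)
  then have "\<phi> ` (radial_leaf \<mu> w \<inter> hopf_proj \<mu> ` N) =
      {v \<in> \<phi> ` hopf_proj \<mu> ` N. \<forall>j\<in>UNIV - {i}. v $ j = 0}"
    by auto
  moreover have "card (UNIV - {i}) + 1 = CARD('n)"
    using card_Suc_Diff1[of UNIV i] by simp
  ultimately show ?thesis
    unfolding regular_point_def using chart pN p(2) x by blast
qed

text \<open>The velocity of a curve in the line spanned by \<open>w\<close> is a multiple of its position, and the value of \<open>\<omega>\<close> on the position vector is the radial contraction.\<close>

lemma form_vanishes_on_radial_leaf:
  fixes w :: "complex^'n"
  assumes \<mu>0: "\<mu> \<noteq> 0" and w: "w \<noteq> 0" and P0: "\<And>z. z \<noteq> 0 \<Longrightarrow> radial_contraction \<omega> z = 0"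
  shows "form_vanishes_on \<mu> \<omega> (radial_leaf \<mu> w)"
  unfolding form_vanishes_on_def hopf_preimage_radial_leaf[OF \<mu>0 w]
proof (intro allI impI ballI, elim conjE)
  fix S and \<gamma> :: "complex \<Rightarrow> complex^'n" and t
  assume S: "open S" and hol: "\<forall>i. (\<lambda>t. \<gamma> t $ i) holomorphic_on S"
    and sub: "\<gamma> ` S \<subseteq> punctured_line w" and t: "t \<in> S"
  obtain i where i: "w $ i \<noteq> 0"
    using w by (auto simp: vec_eq_iff)
  have nz: "\<gamma> u $ i \<noteq> 0" if "u \<in> S" for u
  proof -
    have "\<gamma> u \<in> punctured_line w"
      using sub that by blast
    then obtain s where "s \<noteq> 0" "\<gamma> u = s *s w"
      by (auto simp: punctured_line_def)
    with i show ?thesis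
      by simp
  qed
  have coord: "\<gamma> u $ j = (w $ j / w $ i) * \<gamma> u $ i" if "u \<in> S" for u j
    using mem_punctured_line_iff[OF nz[OF that], of w] sub that by blast
  have D: "deriv (\<lambda>u. \<gamma> u $ j) t = (w $ j / w $ i) * deriv (\<lambda>u. \<gamma> u $ i) t" for j
  proof (rule DERIV_imp_deriv)
    have "((\<lambda>u. \<gamma> u $ i) has_field_derivative deriv (\<lambda>u. \<gamma> u $ i) t) (at t)"
      using hol S t holomorphic_derivI by blast
    from DERIV_cmult[OF this, of "w $ j / w $ i"]
    show "((\<lambda>u. \<gamma> u $ j) has_field_derivative (w $ j / w $ i) * deriv (\<lambda>u. \<gamma> u $ i) t) (at t)"
      by (rule has_field_derivative_transform_within_open[OF _ S t]) (rule coord[symmetric])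
  qed
  have E: "(w $ j / w $ i) * deriv (\<lambda>u. \<gamma> u $ i) t = (deriv (\<lambda>u. \<gamma> u $ i) t / \<gamma> t $ i) * \<gamma> t $ j" for j
    using arg_cong[OF coord[OF t, of j], of "\<lambda>x. deriv (\<lambda>u. \<gamma> u $ i) t / \<gamma> t $ i * x"] nz[OF t]
    by (simp add: field_simps)
  have "(\<chi> j. deriv (\<lambda>u. \<gamma> u $ j) t) = (deriv (\<lambda>u. \<gamma> u $ i) t / \<gamma> t $ i) *s \<gamma> t"
  proof (rule vec_eq_iff[THEN iffD2], rule allI)
    fix j
    show "(\<chi> j. deriv (\<lambda>u. \<gamma> u $ j) t) $ j = ((deriv (\<lambda>u. \<gamma> u $ i) t / \<gamma> t $ i) *s \<gamma> t) $ j"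
      using trans[OF D[of j] E[of j]] by simp
  qed
  moreover have "\<gamma> t \<noteq> 0"
    using nz[OF t] by auto
  ultimately show "covec_app (\<omega> (\<gamma> t)) (\<chi> j. deriv (\<lambda>u. \<gamma> u $ j) t) = 0"
    using P0[of "\<gamma> t"] by (simp add: covec_app_scale radial_contraction_def)
qed

section \<open>The radial leaves are tori\<close>

definition log_ratio :: "complex \<Rightarrow> complex \<Rightarrow> real" where
  "log_ratio \<mu> t = ln (norm t) / ln (norm \<mu>)"

text \<open>Write \<open>t = \<mu>^x * u\<close> with \<open>x\<close> real and \<open>norm u = 1\<close>, where \<open>\<mu>^x\<close> uses the principal logarithm of \<open>\<mu>\<close>. Then \<open>x\<close> is
  the logarithmic ratio, and the two torus coordinates are \<open>exp (2 * pi * \<i> * x)\<close> and \<open>u\<close>. Multiplication of \<open>t\<close> by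
  \<open>\<mu>\<close> replaces \<open>x\<close> by \<open>x + 1\<close> and keeps \<open>u\<close>.\<close>

definition torus_coord1 :: "complex \<Rightarrow> complex \<Rightarrow> complex" where
  "torus_coord1 \<mu> t = exp (2 * of_real pi * \<i> * of_real (log_ratio \<mu> t))"

definition torus_coord2 :: "complex \<Rightarrow> complex \<Rightarrow> complex" where
  "torus_coord2 \<mu> t = t / exp (of_real (log_ratio \<mu> t) * Ln \<mu>)"

lemma norm_exp_log_ratio:
  assumes \<mu>: "0 < norm \<mu>" "norm \<mu> < 1" and t: "t \<noteq> 0"
  shows "norm (exp (of_real (log_ratio \<mu> t) * Ln \<mu>)) = norm t"
proof -
  have "\<mu> \<noteq> 0" "ln (norm \<mu>) \<noteq> 0"
    using \<mu> by auto
  then have "Re (of_real (log_ratio \<mu> t) * Ln \<mu>) = ln (norm t)"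
    by (simp add: log_ratio_def Re_Ln)
  then show ?thesis
    using t by (simp add: norm_exp_eq_Re)
qed

lemma torus_coord_norm:
  assumes \<mu>: "0 < norm \<mu>" "norm \<mu> < 1" and t: "t \<noteq> 0"
  shows "norm (torus_coord1 \<mu> t) = 1" "norm (torus_coord2 \<mu> t) = 1"
  using norm_exp_log_ratio[OF assms] t
  by (simp_all add: torus_coord1_def torus_coord2_def norm_exp_eq_Re norm_divide)

lemma exp_of_int_mult_Ln: "\<mu> \<noteq> 0 \<Longrightarrow> exp (of_int k * Ln \<mu>) = \<mu> powi k"
  by (simp flip: exp_power_int)

lemma log_ratio_powi:
  assumes \<mu>: "0 < norm \<mu>" "norm \<mu> < 1" and t: "t \<noteq> 0"
  shows "log_ratio \<mu> ((\<mu> powi k) * t) = of_int k + log_ratio \<mu> t"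
proof -
  have pos: "0 < norm \<mu> powi k"
    using \<mu> by simp
  have "ln (norm \<mu> powi k) = of_int k * ln (norm \<mu>)"
    using \<mu> by (simp add: ln_powr flip: powr_real_of_int')
  moreover have "ln (norm \<mu>) \<noteq> 0" "\<mu> \<noteq> 0"
    using \<mu> by auto
  ultimately show ?thesis
    using pos t by (simp add: log_ratio_def norm_mult norm_power_int ln_mult field_simps)
qed

lemma torus_coord_powi:
  assumes \<mu>: "0 < norm \<mu>" "norm \<mu> < 1" and t: "t \<noteq> 0"
  shows "torus_coord1 \<mu> ((\<mu> powi k) * t) = torus_coord1 \<mu> t"
    and "torus_coord2 \<mu> ((\<mu> powi k) * t) = torus_coord2 \<mu> t"
proof -
  have \<mu>0: "\<mu> \<noteq> 0"
    using \<mu> by auto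
  have "exp (2 * of_real pi * \<i> * of_int k) = 1"
    using exp_integer_2pi[of "of_int k"] by (simp add: mult_ac)
  then show "torus_coord1 \<mu> ((\<mu> powi k) * t) = torus_coord1 \<mu> t"
    by (simp add: torus_coord1_def log_ratio_powi[OF assms] distrib_left exp_add)
  show "torus_coord2 \<mu> ((\<mu> powi k) * t) = torus_coord2 \<mu> t"
    using \<mu>0 by (simp add: torus_coord2_def log_ratio_powi[OF assms] distrib_right exp_add exp_of_int_mult_Ln[OF \<mu>0])
qed

lemma torus_coord_eqD:
  assumes \<mu>: "0 < norm \<mu>" "norm \<mu> < 1" and t: "t \<noteq> 0" "u \<noteq> 0"
    and eq: "torus_coord1 \<mu> t = torus_coord1 \<mu> u" "torus_coord2 \<mu> t = torus_coord2 \<mu> u"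
  obtains k where "t = (\<mu> powi k) * u"
proof -
  have \<mu>0: "\<mu> \<noteq> 0"
    using \<mu> by auto
  obtain k where "2 * of_real pi * \<i> * of_real (log_ratio \<mu> t) =
      2 * of_real pi * \<i> * of_real (log_ratio \<mu> u) + of_real (real_of_int (2 * k) * pi) * \<i>"
    using eq(1) unfolding torus_coord1_def exp_eq by blast
  then have "(2 * of_real pi * \<i>) * of_real (log_ratio \<mu> t) =
      (2 * of_real pi * \<i>) * of_real (log_ratio \<mu> u + of_int k)"
    by (simp add: algebra_simps)
  then have "complex_of_real (log_ratio \<mu> t) = of_real (log_ratio \<mu> u + of_int k)"
    by simp
  then have x: "log_ratio \<mu> t = log_ratio \<mu> u + of_int k"
    by (simp only: of_real_eq_iff)
  have "exp (of_real (log_ratio \<mu> t) * Ln \<mu>) = exp (of_real (log_ratio \<mu> u) * Ln \<mu>) * (\<mu> powi k)"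
    by (simp add: x distrib_right exp_add exp_of_int_mult_Ln[OF \<mu>0])
  with eq(2) have "t = (\<mu> powi k) * u"
    by (simp add: torus_coord2_def field_simps)
  then show thesis
    by (rule that)
qed

lemma torus_coord_surj:
  assumes \<mu>: "0 < norm \<mu>" "norm \<mu> < 1" and a: "norm a = 1" "norm b = 1"
  obtains t where "t \<noteq> 0" "torus_coord1 \<mu> t = a" "torus_coord2 \<mu> t = b"
proof -
  have \<mu>0: "\<mu> \<noteq> 0" and ln0: "ln (norm \<mu>) \<noteq> 0"
    using \<mu> by auto
  define x where "x = Arg a / (2 * pi)"
  define t where "t = b * exp (of_real x * Ln \<mu>)"
  have "norm t = exp (x * ln (norm \<mu>))"
    using a \<mu>0 by (simp add: t_def norm_mult norm_exp_eq_Re Re_Ln)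
  then have ratio: "log_ratio \<mu> t = x"
    using ln0 by (simp add: log_ratio_def)
  have "a \<noteq> 0"
    using a by auto
  then have "exp (\<i> * of_real (Arg a)) = a"
    using Arg_eq[of a] a by simp
  then have "torus_coord1 \<mu> t = a"
    by (simp add: torus_coord1_def ratio x_def mult_ac)
  moreover have "torus_coord2 \<mu> t = b"
    unfolding torus_coord2_def ratio by (simp add: t_def)
  moreover have "t \<noteq> 0"
    using a by (auto simp: t_def)
  ultimately show thesis
    using that by blast
qed

lemma continuous_on_torus_coord:
  assumes "0 < norm \<mu>" "norm \<mu> < 1" "continuous_on S f" "\<And>x. x \<in> S \<Longrightarrow> f x \<noteq> 0"
  shows "continuous_on S (\<lambda>x. torus_coord1 \<mu> (f x))" "continuous_on S (\<lambda>x. torus_coord2 \<mu> (f x))"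
  unfolding torus_coord1_def torus_coord2_def log_ratio_def
  using assms by (auto intro!: continuous_intros)

text \<open>An invariant continuous function on an open set of \<open>W\<close> descends, as the projection is open; \<open>D\<close> allows for functions such as a quotient of coordinates, which make sense only on a part of \<open>W\<close>.\<close>

lemma continuous_map_from_hopf:
  fixes G :: "complex^'n \<Rightarrow> complex"
  assumes \<mu>: "\<mu> \<noteq> 0" and D: "open D" "D \<subseteq> punctured" and L: "L \<subseteq> hopf_proj \<mu> ` D"
    and G: "continuous_on D G" and F: "\<And>z. z \<in> D \<Longrightarrow> F (hopf_proj \<mu> z) = G z"
  shows "continuous_map (subtopology (hopf_topology \<mu>) L) euclidean F"
  unfolding continuous_map_def
proof (intro conjI allI impI)
  fix V :: "complex set" assume "openin euclidean V"
  then have "open (D \<inter> G -` V)"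
    using continuous_open_preimage[OF G D(1)] by simp
  then have "openin (hopf_topology \<mu>) (hopf_proj \<mu> ` (D \<inter> G -` V))"
    using D(2) by (intro openin_hopf_image[OF \<mu>]) auto
  moreover have "{y \<in> topspace (subtopology (hopf_topology \<mu>) L). F y \<in> V} = hopf_proj \<mu> ` (D \<inter> G -` V) \<inter> L"
  proof (intro equalityI subsetI)
    fix y assume "y \<in> {y \<in> topspace (subtopology (hopf_topology \<mu>) L). F y \<in> V}"
    then have y: "y \<in> L" "F y \<in> V"
      by auto
    then obtain z where "z \<in> D" "y = hopf_proj \<mu> z"
      using L by blast
    with y F show "y \<in> hopf_proj \<mu> ` (D \<inter> G -` V) \<inter> L"
      by auto
  next
    fix y assume y: "y \<in> hopf_proj \<mu> ` (D \<inter> G -` V) \<inter> L"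
    then obtain z where z: "z \<in> D" "G z \<in> V" "y = hopf_proj \<mu> z"
      by blast
    then have "y \<in> hopf \<mu>"
      using D(2) by (auto simp: hopf_def)
    with y z F show "y \<in> {y \<in> topspace (subtopology (hopf_topology \<mu>) L). F y \<in> V}"
      by (simp add: topspace_hopf_topology)
  qed
  ultimately show "openin (subtopology (hopf_topology \<mu>) L) {y \<in> topspace (subtopology (hopf_topology \<mu>) L). F y \<in> V}"
    unfolding openin_subtopology by blast
qed simp

text \<open>The torus coordinates of \<open>z $ i / w $ i\<close> are invariant under multiplication by \<open>\<mu>\<close>, so they descend to a
  continuous bijection from the leaf to the torus. As the leaf is compact and the torus Hausdorff, it is a homeomorphism.\<close>

lemma radial_leaf_homeomorphic_torus:
  fixes w :: "complex^'n"
  assumes \<mu>: "0 < norm \<mu>" "norm \<mu> < 1" and w: "w \<noteq> 0"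
  shows "subtopology (hopf_topology \<mu>) (radial_leaf \<mu> w) homeomorphic_space
       prod_topology (top_of_set (sphere (0::complex) 1)) (top_of_set (sphere (0::complex) 1))"
proof -
  have \<mu>0: "\<mu> \<noteq> 0"
    using \<mu> by auto
  let ?L = "radial_leaf \<mu> w"
  let ?X = "subtopology (hopf_topology \<mu>) ?L"
  let ?T = "prod_topology (top_of_set (sphere (0::complex) 1)) (top_of_set (sphere (0::complex) 1))"
  obtain i where i: "w $ i \<noteq> 0"
    using w by (auto simp: vec_eq_iff)
  define D where "D = {z::complex^'n. z $ i \<noteq> 0}"
  have D: "open D" "D \<subseteq> punctured"
    using open_coord_nonzero by (auto simp: D_def)
  define rep where "rep y = (SOME z. z \<in> y)" for y :: "(complex^'n) set"
  define F where "F c y = c (rep y $ i / w $ i)" for c :: "complex \<Rightarrow> complex" and y :: "(complex^'n) set"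
  have F: "F c (hopf_proj \<mu> z) = c (z $ i / w $ i)"
    if "z \<in> D" and c: "\<And>k t. t \<noteq> 0 \<Longrightarrow> c ((\<mu> powi k) * t) = c t" for c z
  proof -
    have "rep (hopf_proj \<mu> z) \<in> hopf_proj \<mu> z"
      unfolding rep_def by (rule someI[of "\<lambda>x. x \<in> hopf_proj \<mu> z", OF mem_hopf_proj_self])
    then obtain k where "rep (hopf_proj \<mu> z) = (\<mu> powi k) *s z"
      unfolding hopf_proj_def by blast
    then have "F c (hopf_proj \<mu> z) = c ((\<mu> powi k) * (z $ i / w $ i))"
      by (simp add: F_def)
    also have "\<dots> = c (z $ i / w $ i)"
      using that(1) i by (intro c) (simp add: D_def)
    finally show ?thesis .
  qed
  have F1: "F (torus_coord1 \<mu>) (hopf_proj \<mu> z) = torus_coord1 \<mu> (z $ i / w $ i)"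
    and F2: "F (torus_coord2 \<mu>) (hopf_proj \<mu> z) = torus_coord2 \<mu> (z $ i / w $ i)" if "z \<in> D" for z
    by (rule F[OF that torus_coord_powi(1)[OF \<mu>]], assumption, rule F[OF that torus_coord_powi(2)[OF \<mu>]], assumption)
  have line_D: "t *s w \<in> D" if "t \<noteq> 0" for t
    using i that by (simp add: D_def)
  have Fline: "F (torus_coord1 \<mu>) (hopf_proj \<mu> (t *s w)) = torus_coord1 \<mu> t"
    "F (torus_coord2 \<mu>) (hopf_proj \<mu> (t *s w)) = torus_coord2 \<mu> t" if "t \<noteq> 0" for t
    using F1[OF line_D[OF that]] F2[OF line_D[OF that]] i by simp_all
  have LD: "?L \<subseteq> hopf_proj \<mu> ` D"
    unfolding radial_leaf_image using line_D by blast
  have quot: "continuous_on D (\<lambda>z. z $ i / w $ i)" "\<And>z. z \<in> D \<Longrightarrow> z $ i / w $ i \<noteq> 0"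
    using i by (auto simp: D_def intro!: continuous_intros)
  note cont = continuous_on_torus_coord[OF \<mu> quot]
  define E where "E y = (F (torus_coord1 \<mu>) y, F (torus_coord2 \<mu>) y)" for y
  have top: "topspace ?X = ?L"
    using radial_leaf_subset[OF w] by (auto simp: topspace_hopf_topology)
  have E: "E (hopf_proj \<mu> (t *s w)) = (torus_coord1 \<mu> t, torus_coord2 \<mu> t)" if "t \<noteq> 0" for t
    by (simp add: E_def Fline[OF that])
  have img: "E ` ?L = sphere 0 1 \<times> sphere 0 1"
  proof (intro equalityI subsetI)
    fix p assume "p \<in> E ` ?L"
    then obtain t where "t \<noteq> 0" "p = E (hopf_proj \<mu> (t *s w))"
      unfolding radial_leaf_image by blast
    then show "p \<in> sphere 0 1 \<times> sphere 0 1"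
      using torus_coord_norm[OF \<mu>] by (simp add: E)
  next
    fix p :: "complex \<times> complex" assume "p \<in> sphere 0 1 \<times> sphere 0 1"
    then have "norm (fst p) = 1" "norm (snd p) = 1"
      by auto
    then obtain t where t: "t \<noteq> 0" "torus_coord1 \<mu> t = fst p" "torus_coord2 \<mu> t = snd p"
      by (rule torus_coord_surj[OF \<mu>])
    then have "p = E (hopf_proj \<mu> (t *s w))"
      by (simp add: E)
    moreover have "hopf_proj \<mu> (t *s w) \<in> ?L"
      unfolding radial_leaf_image using t(1) by blast
    ultimately show "p \<in> E ` ?L"
      by blast
  qed
  have fst_in: "F (torus_coord1 \<mu>) y \<in> sphere 0 1" "F (torus_coord2 \<mu>) y \<in> sphere 0 1" if "y \<in> ?L" for y
  proof -
    have "E y \<in> sphere 0 1 \<times> sphere 0 1"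
      using img that by blast
    then show "F (torus_coord1 \<mu>) y \<in> sphere 0 1" "F (torus_coord2 \<mu>) y \<in> sphere 0 1"
      by (simp_all add: E_def)
  qed
  have "continuous_map ?X ?T E"
    unfolding continuous_map_pairwise
  proof
    have "fst \<circ> E = F (torus_coord1 \<mu>)" "snd \<circ> E = F (torus_coord2 \<mu>)"
      by (auto simp: E_def)
    moreover have "continuous_map ?X (top_of_set (sphere 0 1)) (F (torus_coord1 \<mu>))"
      "continuous_map ?X (top_of_set (sphere 0 1)) (F (torus_coord2 \<mu>))"
      unfolding continuous_map_in_subtopology top
      using continuous_map_from_hopf[OF \<mu>0 D LD cont(1) F1] continuous_map_from_hopf[OF \<mu>0 D LD cont(2) F2] fst_in
      by auto
    ultimately show "continuous_map ?X (top_of_set (sphere 0 1)) (fst \<circ> E)"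
      "continuous_map ?X (top_of_set (sphere 0 1)) (snd \<circ> E)"
      by simp_all
  qed
  moreover have "compact_space ?X"
    by (rule compact_space_subtopology[OF compactin_radial_leaf[OF \<mu> w]])
  moreover have "Hausdorff_space ?T"
    unfolding Hausdorff_space_prod_topology by (intro disjI2 conjI Hausdorff_space_subtopology Hausdorff_space_euclidean)
  moreover have "E ` topspace ?X = topspace ?T"
    unfolding top by (simp add: img)
  moreover have "inj_on E (topspace ?X)"
    unfolding top
  proof (rule inj_onI)
    fix x y assume "x \<in> ?L" "y \<in> ?L" and xy: "E x = E y"
    then obtain t u where t: "t \<noteq> 0" "x = hopf_proj \<mu> (t *s w)" and u: "u \<noteq> 0" "y = hopf_proj \<mu> (u *s w)"
      unfolding radial_leaf_image by blast
    have "torus_coord1 \<mu> t = torus_coord1 \<mu> u" "torus_coord2 \<mu> t = torus_coord2 \<mu> u"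
      using xy E[OF t(1)] E[OF u(1)] t(2) u(2) by simp_all
    then obtain k where "t = (\<mu> powi k) * u"
      by (rule torus_coord_eqD[OF \<mu> t(1) u(1)])
    then have eq: "t *s w = (\<mu> powi k) *s (u *s w)"
      by (simp add: vector_smult_assoc)
    show "x = y"
      unfolding t(2) u(2) eq by (rule hopf_proj_powi[OF \<mu>0])
  qed
  ultimately have "homeomorphic_map ?X ?T E"
    by (rule continuous_imp_homeomorphic_map)
  then show ?thesis
    by (rule homeomorphic_map_imp_homeomorphic_space)
qed

lemma radial_elliptic_subfoliation:
  fixes \<omega> :: "complex^'n \<Rightarrow> complex^'n"
  assumes \<mu>: "0 < norm \<mu>" "norm \<mu> < 1" and P0: "\<And>z. z \<noteq> 0 \<Longrightarrow> radial_contraction \<omega> z = 0"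
  shows "elliptic_subfoliation \<mu> \<omega> (radial_leaf \<mu> ` punctured)"
  unfolding elliptic_subfoliation_def
proof (intro conjI ballI)
  have \<mu>0: "\<mu> \<noteq> 0"
    using \<mu> by auto
  show "one_dim_foliation \<mu> (radial_leaf \<mu> ` (punctured :: (complex^'n) set))"
    by (rule radial_leaves_foliation[OF \<mu>])
  fix L assume "L \<in> radial_leaf \<mu> ` (punctured :: (complex^'n) set)"
  then obtain w :: "complex^'n" where w: "w \<noteq> 0" and L: "L = radial_leaf \<mu> w"
    by blast
  show "elliptic_curve \<mu> L"
    unfolding elliptic_curve_def L
    using compactin_radial_leaf[OF \<mu> w] path_connectedin_imp_connectedin[OF path_connectedin_radial_leaf[OF w]]
      regular_point_radial_leaf[OF \<mu> w] radial_leaf_homeomorphic_torus[OF \<mu> w]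
    by (intro conjI ballI)
  show "form_vanishes_on \<mu> \<omega> L"
    unfolding L by (rule form_vanishes_on_radial_leaf[OF \<mu>0 w P0])
qed

theorem theorem1p12:
  fixes \<mu> b :: complex
    and s :: "((complex^'n) \<times> (complex^'n)) set \<Rightarrow> ((complex^'n) \<times> complex) set"
    and \<omega> :: "complex^'n \<Rightarrow> complex^'n"
  assumes "CARD('n) \<ge> 3"
    and "0 < norm \<mu>" and "norm \<mu> < 1"
    and "codim_one_foliation \<mu> b s \<omega>"
  shows "(\<exists>H. invariant_hypersurface \<mu> \<omega> H) \<or> (\<exists>\<F>. elliptic_subfoliation \<mu> \<omega> \<F>)"
proof (cases "\<exists>z. z \<noteq> 0 \<and> radial_contraction \<omega> z \<noteq> 0")
  case False
  then have "elliptic_subfoliation \<mu> \<omega> (radial_leaf \<mu> ` punctured)"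
    using radial_elliptic_subfoliation[OF assms(2,3)] by blast
  then show ?thesis
    by blast
next
  case True
  have b: "b \<noteq> 0" and sec: "section_with_pullback \<mu> b s \<omega>"
    and nz: "\<exists>z. z \<noteq> 0 \<and> \<omega> z \<noteq> 0" and int: "integrable_on_set punctured \<omega>"
    using assms(4) by (auto simp: codim_one_foliation_def)
  have hol: "holo_map_on punctured \<omega>"
    using sec by (simp add: section_with_pullback_def)
  have "b / \<mu> \<noteq> 0"
    using b assms(2) by auto
  from semi_invariant_imp_homogeneous[OF assms(2,3) this hol section_semi_invariant[OF assms(2,3) sec] nz]
  obtain d where d: "\<forall>i. homogeneous_on_punctured d (\<lambda>z. \<omega> z $ i)"
    by blast
  have zero: "\<exists>z. z \<noteq> 0 \<and> radial_contraction \<omega> z = 0"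
    by (rule radial_contraction_has_zero[OF _ hol d[rule_format] nz]) (use assms(1) in simp)
  have "invariant_hypersurface \<mu> \<omega> (zero_locus \<mu> (radial_contraction \<omega>))"
    by (rule zero_locus_invariant[OF assms(2,3) hol d[rule_format] int True zero])
  then show ?thesis
    by blast
qed

end
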